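(* Let $f$ be a nonnegative operator monotone function on $(0,\infty)$, and let $\mathbf A=(A_s)_{s\in T}$, $\mathbf B=(B_s)_{s\in T}$, $\mathbf C=(C_s)_{s\in T}$, $\mathbf D=(D_s)_{s\in T}$ be continuous fields of strictly positive operators in $\mathscr A$. Then $$\widetilde S_0^f(\mathbf A+\mathbf B|\mathbf C+\mathbf D)\ \ge\ \widetilde S_0^f(\mathbf A|\mathbf C)+\widetilde S_0^f(\mathbf B|\mathbf D),$$ where $\mathbf A+\mathbf B=(A_s+B_s)_{s\in T}$ and $\mathbf C+\mathbf D=(C_s+D_s)_{s\in T}$.
   Context: $\mathscr H$ is a complex Hilbert space, and $\le$ is the usual (Loewner) order on self-adjoint operators in $\mathbb B(\mathscr H)$. An operator is strictly positive if it is positive and invertible. $\mathscr A$ is a $C^*$-algebra of operators acting on $\mathscr H$, $T$ is a locally compact Hausdorff space and $\mu$ is a Radon measure on $T$. A family $(A_t)_{t\in T}$ in $\mathscr A$ is a continuous field of operators if $t\mapsto A_t$ is norm continuous and $t\mapsto\|A_t\|$ is $\mu$-integrable; its Bochner integral $\int_T A_t\,d\mu(t)$ is the unique element of $\mathscr A$ with $\varphi(\int_T A_t\,d\mu(t))=\int_T\varphi(A_t)\,d\mu(t)$ for all $\varphi\in\mathscr A^*$. A continuous function $f:J\to\mathbb R$ on an interval $J$ is operator monotone if $X\le Y$ implies $f(X)\le f(Y)$ for all self-adjoint operators $X,Y$ (on any complex Hilbert space) with spectra in $J$. For strictly positive $X,Y$: $S_0^f(X|Y)=X^{1/2}f(X^{-1/2}YX^{-1/2})X^{1/2}$,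 and for fields $\widetilde S_0^f(\mathbf A|\mathbf B)=\int_T S_0^f(A_s|B_s)\,d\mu(s)$ (the generalized relative operator entropy for $q=0$). *)

theory Defs
  imports "HOL-Analysis.Analysis" "HOL-Computational_Algebra.Polynomial"
begin

section \<open>Complex Hilbert spaces as structures on a carrier set\<close>

text \<open>
  Operator monotonicity quantifies over all complex Hilbert spaces, and HOL formulas cannot quantify
  over types. Hilbert spaces, their bounded operators and the functional calculus are therefore
  developed for explicit structures on carrier sets. The Hilbert space on which the fields of operators
  act is a type of class \<open>chilbert_space\<close> (below), viewed as such a structure.
\<close>

record 'a hilbert =
  hcarrier :: "'a set"
  hadd :: "'a \<Rightarrow> 'a \<Rightarrow> 'a"
  hzero :: 'a
  hscale :: "complex \<Rightarrow> 'a \<Rightarrow> 'a"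
  hinner :: "'a \<Rightarrow> 'a \<Rightarrow> complex"  \<comment> \<open>linear in the first argument\<close>

definition hdiff :: "'a hilbert \<Rightarrow> 'a \<Rightarrow> 'a \<Rightarrow> 'a" where
  "hdiff K x y = hadd K x (hscale K (-1) y)"

definition hnorm :: "'a hilbert \<Rightarrow> 'a \<Rightarrow> real" where
  "hnorm K x = sqrt (Re (hinner K x x))"

definition complex_hilbert_space :: "'a hilbert \<Rightarrow> bool" where
  "complex_hilbert_space K \<longleftrightarrow>
     (let V = hcarrier K; add = hadd K; scale = hscale K; inner = hinner K in
       hzero K \<in> V \<and>
       (\<forall>x\<in>V. \<forall>y\<in>V. add x y \<in> V) \<and>
       (\<forall>c. \<forall>x\<in>V. scale c x \<in> V) \<and>
       (\<forall>x\<in>V. \<forall>y\<in>V. \<forall>z\<in>V. add (add x y) z = add x (add y z)) \<and>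
       (\<forall>x\<in>V. \<forall>y\<in>V. add x y = add y x) \<and>
       (\<forall>x\<in>V. add x (hzero K) = x) \<and>
       (\<forall>x\<in>V. add x (scale (-1) x) = hzero K) \<and>
       (\<forall>c. \<forall>x\<in>V. \<forall>y\<in>V. scale c (add x y) = add (scale c x) (scale c y)) \<and>
       (\<forall>c d. \<forall>x\<in>V. scale (c + d) x = add (scale c x) (scale d x)) \<and>
       (\<forall>c d. \<forall>x\<in>V. scale (c * d) x = scale c (scale d x)) \<and>
       (\<forall>x\<in>V. scale 1 x = x) \<and>
       (\<forall>x\<in>V. \<forall>y\<in>V. \<forall>z\<in>V. inner (add x y) z = inner x z + inner y z) \<and>
       (\<forall>c. \<forall>x\<in>V. \<forall>y\<in>V. inner (scale c x) y = c * inner x y) \<and>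
       (\<forall>x\<in>V. \<forall>y\<in>V. inner y x = cnj (inner x y)) \<and>
       (\<forall>x\<in>V. 0 \<le> Re (inner x x)) \<and>
       (\<forall>x\<in>V. inner x x = 0 \<longrightarrow> x = hzero K) \<and>
       Metric_space.mcomplete V (\<lambda>x y. hnorm K (hdiff K x y)))"


section \<open>Bounded operators, spectrum, functional calculus\<close>

text \<open>Operators are extensional functions, so that they are determined by their values on the carrier.\<close>

definition bounded_ops :: "'a hilbert \<Rightarrow> ('a \<Rightarrow> 'a) set" where
  "bounded_ops K = {X \<in> hcarrier K \<rightarrow>\<^sub>E hcarrier K.
     (\<forall>x\<in>hcarrier K. \<forall>y\<in>hcarrier K. X (hadd K x y) = hadd K (X x) (X y)) \<and>
     (\<forall>c. \<forall>x\<in>hcarrier K. X (hscale K c x) = hscale K c (X x)) \<and>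
     (\<exists>b. \<forall>x\<in>hcarrier K. hnorm K (X x) \<le> b * hnorm K x)}"

definition op_norm :: "'a hilbert \<Rightarrow> ('a \<Rightarrow> 'a) \<Rightarrow> real" where
  "op_norm K X = (SUP x\<in>{x \<in> hcarrier K. hnorm K x \<le> 1}. hnorm K (X x))"

definition self_adjoint :: "'a hilbert \<Rightarrow> ('a \<Rightarrow> 'a) \<Rightarrow> bool" where
  "self_adjoint K X \<longleftrightarrow> X \<in> bounded_ops K \<and>
     (\<forall>x\<in>hcarrier K. \<forall>y\<in>hcarrier K. hinner K (X x) y = hinner K x (X y))"

definition positive_op :: "'a hilbert \<Rightarrow> ('a \<Rightarrow> 'a) \<Rightarrow> bool" where
  "positive_op K X \<longleftrightarrow> self_adjoint K X \<and> (\<forall>x\<in>hcarrier K. 0 \<le> Re (hinner K (X x) x))"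

definition loewner_le :: "'a hilbert \<Rightarrow> ('a \<Rightarrow> 'a) \<Rightarrow> ('a \<Rightarrow> 'a) \<Rightarrow> bool" where
  "loewner_le K X Y \<longleftrightarrow> self_adjoint K X \<and> self_adjoint K Y \<and>
     positive_op K (\<lambda>x\<in>hcarrier K. hdiff K (Y x) (X x))"

definition invertible_op :: "'a hilbert \<Rightarrow> ('a \<Rightarrow> 'a) \<Rightarrow> bool" where
  "invertible_op K X \<longleftrightarrow> X \<in> bounded_ops K \<and>
     (\<exists>Y\<in>bounded_ops K. \<forall>x\<in>hcarrier K. Y (X x) = x \<and> X (Y x) = x)"

definition spectrum :: "'a hilbert \<Rightarrow> ('a \<Rightarrow> 'a) \<Rightarrow> complex set" where
  "spectrum K X = {z. \<not> invertible_op K (\<lambda>x\<in>hcarrier K. hdiff K (X x) (hscale K z x))}"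

text \<open>The operator \<open>p(X)\<close> for a real polynomial \<open>p\<close>, by Horner's scheme exactly as in the library's
  definition of \<open>poly\<close>.\<close>

definition op_poly :: "'a hilbert \<Rightarrow> real poly \<Rightarrow> ('a \<Rightarrow> 'a) \<Rightarrow> 'a \<Rightarrow> 'a" where
  "op_poly K p X = restrict
     (fold_coeffs (\<lambda>a g x. hadd K (hscale K (complex_of_real a) x) (X (g x))) p (\<lambda>x. hzero K))
     (hcarrier K)"

text \<open>Continuous functional calculus of a self-adjoint \<open>X\<close>, for \<open>f\<close> continuous on the spectrum of \<open>X\<close>:
  \<open>f(X)\<close> is the operator-norm limit of \<open>p n (X)\<close> whenever polynomials \<open>p n\<close> converge to \<open>f\<close> uniformly
  on the spectrum. It is arbitrary (an unspecified description) for other \<open>X\<close> or \<open>f\<close>.\<close>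

definition fun_calc :: "'a hilbert \<Rightarrow> (real \<Rightarrow> real) \<Rightarrow> ('a \<Rightarrow> 'a) \<Rightarrow> 'a \<Rightarrow> 'a" where
  "fun_calc K f X = (THE Y. Y \<in> bounded_ops K \<and>
     (\<forall>p :: nat \<Rightarrow> real poly.
        uniform_limit {t. complex_of_real t \<in> spectrum K X} (\<lambda>n. poly (p n)) f sequentially \<longrightarrow>
        (\<lambda>n. op_norm K (\<lambda>x\<in>hcarrier K. hdiff K (op_poly K (p n) X x) (Y x))) \<longlonglongrightarrow> 0))"

text \<open>
  Operator monotonicity on the interval \<open>J\<close>, tested on all complex Hilbert spaces whose underlying set
  is a subset of the type \<open>'u\<close>. As the structure on that set is arbitrary, this covers up to
  isomorphism all Hilbert spaces whose cardinality does not exceed that of \<open>'u\<close>. For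
  \<open>'u = 'h \<Rightarrow> complex\<close> with \<open>'h\<close> a Hilbert space these include \<open>'h\<close> itself, its finite and countable
  Hilbert sums, every $\ell^2(I)$ with \<open>I \<subseteq> 'h\<close>, and every separable Hilbert space (also if \<open>'h\<close> is
  finite-dimensional or zero).
\<close>

definition operator_monotone :: "'u itself \<Rightarrow> real set \<Rightarrow> (real \<Rightarrow> real) \<Rightarrow> bool" where
  "operator_monotone U J f \<longleftrightarrow> is_interval J \<and> continuous_on J f \<and>
     (\<forall>K :: 'u hilbert. complex_hilbert_space K \<longrightarrow>
       (\<forall>X Y. self_adjoint K X \<and> self_adjoint K Y \<and>
          spectrum K X \<subseteq> complex_of_real ` J \<and> spectrum K Y \<subseteq> complex_of_real ` J \<and>
          loewner_le K X Y \<longrightarrow> loewner_le K (fun_calc K f X) (fun_calc K f Y)))"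


section \<open>Complex Hilbert spaces as types\<close>

class chilbert_space = banach +
  fixes scaleC :: "complex \<Rightarrow> 'a \<Rightarrow> 'a"  (infixr \<open>*\<^sub>C\<close> 75)
    and cinner :: "'a \<Rightarrow> 'a \<Rightarrow> complex"
  assumes scaleC_add_right: "c *\<^sub>C (x + y) = c *\<^sub>C x + c *\<^sub>C y"
    and scaleC_add_left: "(c + d) *\<^sub>C x = c *\<^sub>C x + d *\<^sub>C x"
    and scaleC_scaleC: "c *\<^sub>C d *\<^sub>C x = (c * d) *\<^sub>C x"
    and scaleC_of_real: "complex_of_real r *\<^sub>C x = r *\<^sub>R x"
    and cinner_add_left: "cinner (x + y) z = cinner x z + cinner y z"
    and cinner_scaleC_left: "cinner (c *\<^sub>C x) y = c * cinner x y"
    and cinner_commute: "cinner y x = cnj (cinner x y)"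
    and cinner_self: "cinner x x = complex_of_real ((norm x)\<^sup>2)"

definition hilbert_UNIV :: "'h::chilbert_space hilbert" where
  "hilbert_UNIV = \<lparr>hcarrier = UNIV, hadd = (+), hzero = 0, hscale = scaleC, hinner = cinner\<rparr>"

instantiation complex :: chilbert_space
begin
definition scaleC_complex :: "complex \<Rightarrow> complex \<Rightarrow> complex" where "scaleC_complex c x = c * x"
definition cinner_complex :: "complex \<Rightarrow> complex \<Rightarrow> complex" where "cinner_complex x y = x * cnj y"
instance
  by standard
    (simp_all add: scaleC_complex_def cinner_complex_def algebra_simps scaleR_conv_of_real
       complex_norm_square[symmetric])
end

lemma hdiff_hilbert_UNIV: "hdiff hilbert_UNIV x y = x - y"
proof -
  have "(-1) *\<^sub>C y = - y"
    using scaleC_of_real[of "-1" y] by simp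
  then show ?thesis
    by (simp add: hdiff_def hilbert_UNIV_def)
qed

lemma hnorm_hilbert_UNIV: "hnorm hilbert_UNIV x = norm x"
  by (simp add: hnorm_def hilbert_UNIV_def cinner_self)

lemma complex_hilbert_space_UNIV:
  "complex_hilbert_space (hilbert_UNIV :: 'h::chilbert_space hilbert)"
proof -
  have "Metric_space.mcomplete (UNIV :: 'h set) dist"
    using mcomplete_iff_complete[where 'a = 'h] complete_UNIV by (metis mspace_euclidean_metric
        mdist_euclidean_metric mcomplete_of_def)
  moreover have "(-1) *\<^sub>C x = - x" "1 *\<^sub>C x = x" for x :: 'h
    using scaleC_of_real[of "-1" x] scaleC_of_real[of 1 x] by simp_all
  moreover have "(\<lambda>x y :: 'h. norm (x - y)) = dist"
    by (simp add: dist_norm fun_eq_iff)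
  ultimately show ?thesis
    unfolding complex_hilbert_space_def Let_def hdiff_hilbert_UNIV hnorm_hilbert_UNIV
    by (simp add: hilbert_UNIV_def scaleC_add_right scaleC_add_left scaleC_scaleC cinner_add_left
        cinner_scaleC_left cinner_commute[symmetric] cinner_self add_ac)
qed


section \<open>Operators on a Hilbert space type\<close>

text \<open>
  Elements of \<open>'h \<Rightarrow>\<^sub>L 'h\<close> are real-linear; the bounded operators in the complex sense are those with
  \<open>blinfun_apply X \<in> bounded_ops hilbert_UNIV\<close>. The norm of such an operator is its usual operator norm.
\<close>

abbreviation cbounded :: "('h::chilbert_space \<Rightarrow>\<^sub>L 'h) \<Rightarrow> bool" where
  "cbounded X \<equiv> blinfun_apply X \<in> bounded_ops hilbert_UNIV"

definition op_le :: "('h::chilbert_space \<Rightarrow>\<^sub>L 'h) \<Rightarrow> ('h \<Rightarrow>\<^sub>L 'h) \<Rightarrow> bool"  (infix \<open>\<preceq>\<close> 50) where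
  "X \<preceq> Y \<longleftrightarrow> loewner_le hilbert_UNIV (blinfun_apply X) (blinfun_apply Y)"

definition strictly_positive :: "('h::chilbert_space \<Rightarrow>\<^sub>L 'h) \<Rightarrow> bool" where
  "strictly_positive X \<longleftrightarrow> positive_op hilbert_UNIV (blinfun_apply X) \<and>
     invertible_op hilbert_UNIV (blinfun_apply X)"

definition op_fun :: "(real \<Rightarrow> real) \<Rightarrow> ('h::chilbert_space \<Rightarrow>\<^sub>L 'h) \<Rightarrow> ('h \<Rightarrow>\<^sub>L 'h)" where
  "op_fun f X = Blinfun (fun_calc hilbert_UNIV f (blinfun_apply X))"

definition op_powr :: "('h::chilbert_space \<Rightarrow>\<^sub>L 'h) \<Rightarrow> real \<Rightarrow> ('h \<Rightarrow>\<^sub>L 'h)" where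
  "op_powr X r = op_fun (\<lambda>t. t powr r) X"

definition op_scaleC :: "complex \<Rightarrow> ('h::chilbert_space \<Rightarrow>\<^sub>L 'h) \<Rightarrow> ('h \<Rightarrow>\<^sub>L 'h)" where
  "op_scaleC c X = Blinfun (\<lambda>x. c *\<^sub>C X x)"

definition is_adjoint :: "('h::chilbert_space \<Rightarrow>\<^sub>L 'h) \<Rightarrow> ('h \<Rightarrow>\<^sub>L 'h) \<Rightarrow> bool" where
  "is_adjoint X Y \<longleftrightarrow> (\<forall>x y. cinner (X x) y = cinner x (Y y))"

text \<open>Norm-closed self-adjoint algebras of operators, not assumed to contain the identity.\<close>

definition cstar_algebra :: "('h::chilbert_space \<Rightarrow>\<^sub>L 'h) set \<Rightarrow> bool" where
  "cstar_algebra \<A> \<longleftrightarrow>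
     (\<forall>X\<in>\<A>. cbounded X) \<and> 0 \<in> \<A> \<and>
     (\<forall>X\<in>\<A>. \<forall>Y\<in>\<A>. X + Y \<in> \<A>) \<and>
     (\<forall>c. \<forall>X\<in>\<A>. op_scaleC c X \<in> \<A>) \<and>
     (\<forall>X\<in>\<A>. \<forall>Y\<in>\<A>. X o\<^sub>L Y \<in> \<A>) \<and>
     (\<forall>X\<in>\<A>. \<exists>Y\<in>\<A>. is_adjoint X Y) \<and>
     closed \<A>"

text \<open>Bounded complex-linear functionals on \<open>\<A>\<close>; only their values on \<open>\<A>\<close> matter.\<close>

definition dual_space :: "('h::chilbert_space \<Rightarrow>\<^sub>L 'h) set \<Rightarrow> (('h \<Rightarrow>\<^sub>L 'h) \<Rightarrow> complex) set" where
  "dual_space \<A> = {\<phi>.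
     (\<forall>X\<in>\<A>. \<forall>Y\<in>\<A>. \<phi> (X + Y) = \<phi> X + \<phi> Y) \<and>
     (\<forall>c. \<forall>X\<in>\<A>. \<phi> (op_scaleC c X) = c * \<phi> X) \<and>
     (\<exists>b. \<forall>X\<in>\<A>. cmod (\<phi> X) \<le> b * norm X)}"


section \<open>Continuous fields of operators and the generalized relative operator entropy\<close>

definition radon_measure :: "'t::t2_space measure \<Rightarrow> bool" where
  "radon_measure M \<longleftrightarrow> sets M = sets borel \<and>
     (\<forall>C. compact C \<longrightarrow> emeasure M C < \<infinity>) \<and>
     (\<forall>B\<in>sets borel. emeasure M B = (INF U\<in>{U. open U \<and> B \<subseteq> U}. emeasure M U)) \<and>
     (\<forall>U. open U \<longrightarrow> emeasure M U = (SUP C\<in>{C. compact C \<and> C \<subseteq> U}. emeasure M C))"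

definition continuous_field ::
  "('h::chilbert_space \<Rightarrow>\<^sub>L 'h) set \<Rightarrow> 't::t2_space measure \<Rightarrow> ('t \<Rightarrow> 'h \<Rightarrow>\<^sub>L 'h) \<Rightarrow> bool" where
  "continuous_field \<A> M A \<longleftrightarrow>
     (\<forall>t. A t \<in> \<A>) \<and> continuous_on UNIV A \<and> integrable M (\<lambda>t. norm (A t))"

text \<open>The library's Bochner integral needs a second countable target space, which \<open>'h \<Rightarrow>\<^sub>L 'h\<close> is not;
  the integral of a field is given by its defining property with respect to the dual of \<open>\<A>\<close>.\<close>

definition field_integral ::
  "('h::chilbert_space \<Rightarrow>\<^sub>L 'h) set \<Rightarrow> 't measure \<Rightarrow> ('t \<Rightarrow> 'h \<Rightarrow>\<^sub>L 'h) \<Rightarrow> ('h \<Rightarrow>\<^sub>L 'h)" where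
  "field_integral \<A> M F =
     (THE Z. Z \<in> \<A> \<and> (\<forall>\<phi>\<in>dual_space \<A>. \<phi> Z = (LINT t|M. \<phi> (F t))))"

definition rel_entropy0 ::
  "(real \<Rightarrow> real) \<Rightarrow> ('h::chilbert_space \<Rightarrow>\<^sub>L 'h) \<Rightarrow> ('h \<Rightarrow>\<^sub>L 'h) \<Rightarrow> ('h \<Rightarrow>\<^sub>L 'h)" where
  "rel_entropy0 f X Y =
     op_powr X (1/2) o\<^sub>L
     op_fun f (op_powr X (-1/2) o\<^sub>L Y o\<^sub>L op_powr X (-1/2)) o\<^sub>L
     op_powr X (1/2)"

definition gen_rel_entropy0 ::
  "('h::chilbert_space \<Rightarrow>\<^sub>L 'h) set \<Rightarrow> 't measure \<Rightarrow> (real \<Rightarrow> real) \<Rightarrow>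
     ('t \<Rightarrow> 'h \<Rightarrow>\<^sub>L 'h) \<Rightarrow> ('t \<Rightarrow> 'h \<Rightarrow>\<^sub>L 'h) \<Rightarrow> ('h \<Rightarrow>\<^sub>L 'h)" where
  "gen_rel_entropy0 \<A> M f A B = field_integral \<A> M (\<lambda>s. rel_entropy0 f (A s) (B s))"

end

theory Submission
  imports Defs "HOL-Computational_Algebra.Fundamental_Theorem_Algebra"
begin

text \<open>
  The inequality already holds for the integrands, and integration preserves it: the integral of a field
  commutes with every bounded functional, in particular with the vector functionals
  \<open>X \<mapsto> \<langle>X x, x\<rangle>\<close> that decide the Loewner order. Two things remain: the pointwise inequality
  \<open>S(A|C) + S(B|D) \<preceq> S(A+B|C+D)\<close> for strictly positive operators (\<open>rel_entropy0_superadditive\<close>), and the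
  fact that the three entropy fields are continuous fields in the algebra and have integrals there
  (\<open>continuous_field_rel_entropy0\<close>, \<open>field_integral\<close>).

  Pointwise, put \<open>E = A + B\<close>. The map \<open>V x = (A\<^sup>1\<^sup>/\<^sup>2 E\<^sup>-\<^sup>1\<^sup>/\<^sup>2 x, B\<^sup>1\<^sup>/\<^sup>2 E\<^sup>-\<^sup>1\<^sup>/\<^sup>2 x)\<close> is an isometry into the
  direct sum of two copies of the Hilbert space, and it compresses the diagonal operator \<open>X\<close> with entries
  \<open>A\<^sup>-\<^sup>1\<^sup>/\<^sup>2 C A\<^sup>-\<^sup>1\<^sup>/\<^sup>2\<close> and \<open>B\<^sup>-\<^sup>1\<^sup>/\<^sup>2 D B\<^sup>-\<^sup>1\<^sup>/\<^sup>2\<close> to \<open>E\<^sup>-\<^sup>1\<^sup>/\<^sup>2 (C + D) E\<^sup>-\<^sup>1\<^sup>/\<^sup>2\<close>. So the pointwise inequality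
  is Jensen's inequality \<open>V\<^sup>* f(X) V \<preceq> f(V\<^sup>* X V)\<close>, evaluated at \<open>E\<^sup>1\<^sup>/\<^sup>2 x\<close>. Jensen's inequality in turn follows
  from operator monotonicity on the direct sum (\<open>operator_Jensen\<close>): with \<open>Z = V\<^sup>* X V\<close>, \<open>e > 0\<close> and \<open>l\<close> large,
  \<open>X \<preceq> Y = (1 + e) V Z V\<^sup>* + l (1 - V V\<^sup>*)\<close>. The operator \<open>Y\<close> leaves the range of \<open>V\<close> invariant and acts there
  as \<open>(1 + e) Z\<close>, whence \<open>V\<^sup>* f(X) V \<preceq> V\<^sup>* f(Y) V = f((1 + e) Z)\<close>; let \<open>e\<close> tend to 0. Monotonicity is a
  hypothesis about Hilbert spaces carried by sets of functions \<open>'h \<Rightarrow> complex\<close>, so the direct sum is first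
  copied into that type (\<open>operator_monotone_op_fun\<close>).

  For the integrals, \<open>S(A|C)\<close> lies in the algebra because \<open>f(X) = X g(X)\<close> with \<open>g(t) = f(t)/t\<close> is a limit of
  polynomials in \<open>X\<close> without constant term. It depends continuously on \<open>A\<close> and \<open>C\<close>, and its norm is
  integrable because superadditivity itself gives
  \<open>0 \<preceq> S(A|C) \<preceq> S(A|C) + S(C|A) \<preceq> S(A+C|A+C) = f(1) (A + C)\<close>. A continuous field with integrable norm has an
  integral: by regularity of the measure it vanishes almost everywhere off a \<open>\<sigma>\<close>-compact set, and Riemann
  sums over fine partitions of compact sets converge in norm.

  All statements about \<open>f(X)\<close> come from one estimate, \<open>\<parallel>p(X)\<parallel> \<le> sup {\<bar>p(t)\<bar> | t in the spectrum of X}\<close> for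
  hermitian \<open>X\<close> and real polynomials \<open>p\<close> (\<open>norm_op_rpoly_le\<close>), which makes the limit that defines \<open>f(X)\<close> exist.
\<close>

section \<open>Complex inner products and hermitian operators\<close>

lemma hilbert_UNIV_simps [simp]:
  "hcarrier hilbert_UNIV = UNIV" "hadd hilbert_UNIV = (+)" "hzero hilbert_UNIV = 0"
  "hscale hilbert_UNIV = scaleC" "hinner hilbert_UNIV = cinner"
  by (simp_all add: hilbert_UNIV_def)

lemma scaleC_minus_one [simp]: "(-1) *\<^sub>C x = - (x :: 'h::chilbert_space)"
  using scaleC_of_real[of "-1" x] by simp

lemma scaleC_one [simp]: "1 *\<^sub>C x = (x :: 'h::chilbert_space)"
  using scaleC_of_real[of 1 x] by simp

lemma scaleC_zero_left [simp]: "0 *\<^sub>C x = (0 :: 'h::chilbert_space)"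
  using scaleC_of_real[of 0 x] by simp

lemma scaleC_zero_right [simp]: "c *\<^sub>C (0 :: 'h::chilbert_space) = 0"
  using scaleC_add_right[of c 0 "0::'h"] by simp

lemma scaleC_minus_right [simp]: "c *\<^sub>C (- x) = - (c *\<^sub>C (x :: 'h::chilbert_space))"
  using scaleC_add_right[of c x "- x"] by (simp add: eq_neg_iff_add_eq_0 add.commute)

lemma scaleC_diff_right: "c *\<^sub>C (x - y) = c *\<^sub>C x - c *\<^sub>C (y :: 'h::chilbert_space)"
  using scaleC_add_right[of c x "- y"] by simp

lemma cinner_add_right: "cinner x (y + z) = cinner x y + cinner x (z :: 'h::chilbert_space)"
  by (metis cinner_add_left cinner_commute complex_cnj_add)

lemma cinner_scaleC_right: "cinner x (c *\<^sub>C y) = cnj c * cinner x (y :: 'h::chilbert_space)"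
  by (metis cinner_scaleC_left cinner_commute complex_cnj_mult)

lemma cinner_scaleR_left: "cinner (r *\<^sub>R x) y = r *\<^sub>R cinner x (y :: 'h::chilbert_space)"
  by (metis cinner_scaleC_left scaleC_of_real scaleR_conv_of_real)

lemma cinner_scaleR_right: "cinner x (r *\<^sub>R y) = r *\<^sub>R cinner x (y :: 'h::chilbert_space)"
  by (metis cinner_scaleC_right complex_cnj_complex_of_real scaleC_of_real scaleR_conv_of_real)

lemma cinner_minus_left: "cinner (- x) y = - cinner x (y :: 'h::chilbert_space)"
  using cinner_scaleR_left[of "-1" x y] by simp

lemma cinner_minus_right: "cinner x (- y) = - cinner x (y :: 'h::chilbert_space)"
  using cinner_scaleR_right[of x "-1" y] by simp

lemma cinner_diff_left: "cinner (x - y) z = cinner x z - cinner y (z :: 'h::chilbert_space)"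
  using cinner_add_left[of x "- y" z] by (simp add: cinner_minus_left)

lemma cinner_diff_right: "cinner z (x - y) = cinner z x - cinner z (y :: 'h::chilbert_space)"
  using cinner_add_right[of z x "- y"] by (simp add: cinner_minus_right)

lemma cinner_zero [simp]: "cinner 0 x = 0" "cinner x (0 :: 'h::chilbert_space) = 0"
  using cinner_scaleR_left[of 0 x x] cinner_scaleR_right[of x 0 x] by simp_all

lemmas cinner_simps = cinner_add_left cinner_add_right cinner_diff_left cinner_diff_right
  cinner_scaleC_left cinner_scaleC_right cinner_scaleR_left cinner_scaleR_right
  cinner_minus_left cinner_minus_right

lemma Re_cinner_self [simp]: "Re (cinner x x) = (norm (x :: 'h::chilbert_space))\<^sup>2"
  by (simp add: cinner_self)

lemma cmod_cinner_self [simp]: "cmod (cinner x x) = (norm (x :: 'h::chilbert_space))\<^sup>2"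
  by (simp add: cinner_self norm_power)

lemma norm_scaleC [simp]: "norm (c *\<^sub>C x) = cmod c * norm (x :: 'h::chilbert_space)"
proof -
  have "complex_of_real ((norm (c *\<^sub>C x))\<^sup>2) = c * cnj c * cinner x x"
    unfolding cinner_self[symmetric] by (simp add: cinner_simps)
  also have "\<dots> = complex_of_real ((cmod c * norm x)\<^sup>2)"
    by (simp add: cinner_self complex_mult_cnj cmod_power2 power_mult_distrib)
  finally show ?thesis
    by (simp only: of_real_eq_iff) (simp add: power2_eq_iff_nonneg)
qed

lemma scaleC_eq_0_iff [simp]: "c *\<^sub>C x = 0 \<longleftrightarrow> c = 0 \<or> x = (0 :: 'h::chilbert_space)"
  by (metis norm_scaleC mult_eq_0_iff norm_eq_zero)

lemma cinner_ext:
  assumes "\<And>y. cinner x y = cinner z y"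
  shows "x = (z :: 'h::chilbert_space)"
proof -
  have "cinner (x - z) (x - z) = 0"
    using assms by (simp add: cinner_diff_left)
  then show ?thesis
    by (simp add: cinner_self)
qed

abbreviation hermitian :: "('h::chilbert_space \<Rightarrow>\<^sub>L 'h) \<Rightarrow> bool" where
  "hermitian X \<equiv> is_adjoint X X"

lemma hermitianD: "hermitian X \<Longrightarrow> cinner (X x) y = cinner x (X y)"
  by (simp add: is_adjoint_def)

lemma hermitian_Im:
  assumes "hermitian X"
  shows "Im (cinner (X x) x) = 0"
  using hermitianD[OF assms, of x x] cinner_commute[of x "X x"]
  by (metis Reals_cnj_iff complex_is_Real_iff)

text \<open>
  The quadratic polynomial \<open>t \<mapsto> \<langle>P (x + c y), x + c y\<rangle>\<close> with \<open>c = - t \<langle>P x, y\<rangle>\<close> is nonnegative. The form may be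
  degenerate: the case \<open>\<langle>P y, y\<rangle> = 0\<close>, in which that polynomial is affine, is included.
\<close>

lemma positive_form_Cauchy_Schwarz:
  assumes P: "hermitian P" and pos: "\<And>x. 0 \<le> Re (cinner (P x) x)"
  shows "(cmod (cinner (P x) y))\<^sup>2 \<le> Re (cinner (P x) x) * Re (cinner (P y) y)"
proof -
  define s where "s = cinner (P x) y"
  define a b where "a = Re (cinner (P x) x)" and "b = Re (cinner (P y) y)"
  have yx: "cinner (P y) x = cnj s"
    unfolding s_def using hermitianD[OF P, of y x] cinner_commute[of "P x" y] by simp
  have key: "0 \<le> a - 2 * t * (cmod s)\<^sup>2 + t\<^sup>2 * (cmod s)\<^sup>2 * b" for t
  proof -
    have lin: "P (c *\<^sub>C y) = c *\<^sub>C P y" for c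
      by (rule cinner_ext) (simp add: hermitianD[OF P] cinner_simps)
    define c where "c = - complex_of_real t * s"
    have "cinner (P (x + c *\<^sub>C y)) (x + c *\<^sub>C y) =
        cinner (P x) x + cnj c * s + c * cnj s + c * cnj c * cinner (P y) y"
      by (simp add: blinfun.add_right lin cinner_simps yx s_def algebra_simps)
    then have "Re (cinner (P (x + c *\<^sub>C y)) (x + c *\<^sub>C y)) =
        a + Re (cnj c * s + c * cnj s) + Re (c * cnj c * cinner (P y) y)"
      by (simp add: a_def)
    also have "cnj c * s + c * cnj s = complex_of_real (- 2 * t * (cmod s)\<^sup>2)"
      using complex_norm_square[of s] by (simp add: c_def mult_ac)
    also have "c * cnj c * cinner (P y) y = complex_of_real (t\<^sup>2 * (cmod s)\<^sup>2) * cinner (P y) y"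
      using complex_norm_square[of s] by (simp add: c_def mult_ac power2_eq_square)
    also have "Re \<dots> = t\<^sup>2 * (cmod s)\<^sup>2 * b"
      by (simp add: b_def)
    finally show ?thesis
      using pos[of "x + c *\<^sub>C y"] by simp
  qed
  have b0: "0 \<le> b" unfolding b_def by (rule pos)
  have "(cmod s)\<^sup>2 \<le> a * b"
  proof (cases "b = 0")
    case True
    have "(cmod s)\<^sup>2 = 0"
    proof (rule ccontr)
      assume "(cmod s)\<^sup>2 \<noteq> 0"
      then show False
        using key[of "(a + 1) / (2 * (cmod s)\<^sup>2)"] True by simp
    qed
    with True show ?thesis by simp
  next
    case False
    with b0 have "0 < b" by simp
    have "0 \<le> a - (cmod s)\<^sup>2 / b"
      using key[of "1 / b"] \<open>0 < b\<close> by (simp add: power2_eq_square field_simps)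
    with \<open>0 < b\<close> show ?thesis by (simp add: field_simps)
  qed
  then show ?thesis by (simp add: s_def a_def b_def)
qed

text \<open>
  The case of the identity operator.
\<close>

lemma cinner_Cauchy_Schwarz: "cmod (cinner x y) \<le> norm x * norm (y :: 'h::chilbert_space)"
proof -
  have "(cmod (cinner x y))\<^sup>2 \<le> (norm x * norm y)\<^sup>2"
    using positive_form_Cauchy_Schwarz[of "id_blinfun :: 'h \<Rightarrow>\<^sub>L 'h" x y]
    by (simp add: is_adjoint_def power_mult_distrib)
  then show ?thesis
    by (rule power2_le_imp_le) simp
qed

lemma bounded_bilinear_cinner: "bounded_bilinear (cinner :: 'h::chilbert_space \<Rightarrow> 'h \<Rightarrow> complex)"
  by (rule bounded_bilinear.intro)
    (auto simp: cinner_simps intro!: exI[of _ 1] cinner_Cauchy_Schwarz)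

lemmas tendsto_cinner [tendsto_intros] = bounded_bilinear.tendsto[OF bounded_bilinear_cinner]

lemma Re_cinner_le:
  fixes X :: "'h::chilbert_space \<Rightarrow>\<^sub>L 'h"
  shows "\<bar>Re (cinner (X x) x)\<bar> \<le> norm X * (norm x)\<^sup>2"
proof -
  have "\<bar>Re (cinner (X x) x)\<bar> \<le> norm (X x) * norm x"
    using abs_Re_le_cmod cinner_Cauchy_Schwarz order_trans by blast
  also have "\<dots> \<le> norm X * norm x * norm x"
    by (intro mult_right_mono norm_blinfun) simp
  finally show ?thesis by (simp add: power2_eq_square mult.assoc)
qed


section \<open>Complex-linear operators, invertibility and the spectrum\<close>

definition complex_linear :: "('v::chilbert_space \<Rightarrow>\<^sub>L 'w::chilbert_space) \<Rightarrow> bool" where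
  "complex_linear X \<longleftrightarrow> (\<forall>c x. X (c *\<^sub>C x) = c *\<^sub>C X x)"

lemma hermitian_complex_linear: "hermitian X \<Longrightarrow> complex_linear X"
  unfolding complex_linear_def by (intro allI, rule cinner_ext) (simp add: hermitianD cinner_simps)

lemma complex_linear_intros [intro, simp]:
  "complex_linear 0" "complex_linear id_blinfun"
  "complex_linear X \<Longrightarrow> complex_linear Y \<Longrightarrow> complex_linear (X + Y)"
  "complex_linear X \<Longrightarrow> complex_linear Y \<Longrightarrow> complex_linear (X - Y)"
  "complex_linear Z \<Longrightarrow> complex_linear Y \<Longrightarrow> complex_linear (Z o\<^sub>L Y)"
  by (simp_all add: complex_linear_def blinfun.bilinear_simps scaleC_add_right scaleC_diff_right)

lemma bounded_ops_iff_complex_linear: "cbounded X \<longleftrightarrow> complex_linear X"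
  using norm_blinfun[of X]
  by (auto simp: bounded_ops_def complex_linear_def blinfun.bilinear_simps hnorm_hilbert_UNIV
      intro!: exI[of _ "norm X"])

lemma bounded_ops_blinfun:
  assumes "F \<in> bounded_ops (hilbert_UNIV :: 'h::chilbert_space hilbert)"
  obtains X where "F = blinfun_apply X" "complex_linear X"
proof -
  obtain b where b: "\<And>x. norm (F x) \<le> b * norm x"
    using assms by (auto simp: bounded_ops_def hnorm_hilbert_UNIV)
  have "bounded_linear F"
  proof (rule bounded_linear_intro)
    show "F (r *\<^sub>R x) = r *\<^sub>R F x" for r x
      using assms by (simp add: bounded_ops_def flip: scaleC_of_real)
    show "norm (F x) \<le> norm x * b" for x
      using b[of x] by (simp add: mult.commute)
  qed (use assms in \<open>simp add: bounded_ops_def\<close>)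
  then have "F = blinfun_apply (Blinfun F)"
    by (simp add: bounded_linear_Blinfun_apply)
  then show thesis
    using that assms bounded_ops_iff_complex_linear by metis
qed

lemma blinfun_apply_op_scaleC [simp]: "op_scaleC c X x = c *\<^sub>C X x"
proof -
  have "bounded_linear (\<lambda>x. c *\<^sub>C X x)"
  proof (rule bounded_linear_intro)
    show "norm (c *\<^sub>C X x) \<le> norm x * (cmod c * norm X)" for x
      using mult_left_mono[OF norm_blinfun[of X x], of "cmod c"] by (simp add: mult_ac)
    show "c *\<^sub>C X (r *\<^sub>R x) = r *\<^sub>R c *\<^sub>C X x" for r x
      unfolding blinfun.scaleR_right
      by (simp add: scaleC_scaleC mult.commute flip: scaleC_of_real)
  qed (simp add: blinfun.bilinear_simps scaleC_add_right)
  then show ?thesis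
    by (simp add: op_scaleC_def bounded_linear_Blinfun_apply)
qed

lemma complex_linear_op_scaleC [intro, simp]: "complex_linear X \<Longrightarrow> complex_linear (op_scaleC c X)"
  by (simp add: complex_linear_def scaleC_scaleC mult.commute)

lemma op_scaleC_of_real: "op_scaleC (complex_of_real r) X = r *\<^sub>R X"
  by (rule blinfun_eqI) (simp add: scaleC_of_real blinfun.bilinear_simps)

definition invertible_blinfun :: "('h::chilbert_space \<Rightarrow>\<^sub>L 'h) \<Rightarrow> bool" where
  "invertible_blinfun T \<longleftrightarrow> (\<exists>S. S o\<^sub>L T = id_blinfun \<and> T o\<^sub>L S = id_blinfun)"

lemma invertible_op_iff:
  assumes "complex_linear T"
  shows "invertible_op hilbert_UNIV (blinfun_apply T) \<longleftrightarrow> invertible_blinfun T"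
proof
  assume "invertible_op hilbert_UNIV (blinfun_apply T)"
  then obtain F where F: "F \<in> bounded_ops hilbert_UNIV" "\<And>x. F (T x) = x" "\<And>x. T (F x) = x"
    by (auto simp: invertible_op_def)
  obtain S where "F = blinfun_apply S"
    using bounded_ops_blinfun[OF F(1)] by blast
  with F have "S o\<^sub>L T = id_blinfun" "T o\<^sub>L S = id_blinfun"
    by (auto intro: blinfun_eqI)
  then show "invertible_blinfun T"
    by (auto simp: invertible_blinfun_def)
next
  assume "invertible_blinfun T"
  then obtain S where S: "S o\<^sub>L T = id_blinfun" "T o\<^sub>L S = id_blinfun"
    by (auto simp: invertible_blinfun_def)
  have S': "S (T x) = x" "T (S x) = x" for x
    using S by (metis blinfun_apply_blinfun_compose blinfun_apply_id_blinfun)+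
  have "S (c *\<^sub>C x) = c *\<^sub>C S x" for c x
    by (metis S' assms complex_linear_def)
  then have "cbounded S"
    by (simp add: bounded_ops_iff_complex_linear complex_linear_def)
  then show "invertible_op hilbert_UNIV (blinfun_apply T)"
    unfolding invertible_op_def
    using assms S' by (intro conjI bexI[of _ "blinfun_apply S"])
      (simp_all add: bounded_ops_iff_complex_linear)
qed

lemma spectrum_iff:
  assumes "complex_linear X"
  shows "z \<in> spectrum hilbert_UNIV (blinfun_apply X) \<longleftrightarrow>
    \<not> invertible_blinfun (X - op_scaleC z id_blinfun)"
proof -
  have "(\<lambda>x\<in>hcarrier hilbert_UNIV. hdiff hilbert_UNIV (X x) (hscale hilbert_UNIV z x)) =
      blinfun_apply (X - op_scaleC z id_blinfun)"
    by (simp add: fun_eq_iff hdiff_hilbert_UNIV blinfun.bilinear_simps)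
  then show ?thesis
    using assms by (simp add: spectrum_def invertible_op_iff)
qed

lemma invertible_blinfun_compose:
  assumes "invertible_blinfun S" "invertible_blinfun T"
  shows "invertible_blinfun (S o\<^sub>L T)"
proof -
  obtain S' T' where *: "S' o\<^sub>L S = id_blinfun" "S o\<^sub>L S' = id_blinfun"
      "T' o\<^sub>L T = id_blinfun" "T o\<^sub>L T' = id_blinfun"
    using assms by (auto simp: invertible_blinfun_def)
  then have "S' (S x) = x" "S (S' x) = x" "T' (T y) = y" "T (T' y) = y" for x y
    by (metis blinfun_apply_blinfun_compose blinfun_apply_id_blinfun)+
  then show ?thesis
    unfolding invertible_blinfun_def
    by (intro exI[of _ "T' o\<^sub>L S'"]) (auto intro!: blinfun_eqI)
qed

text \<open>
  The equation \<open>T x = y\<close> is the fixed point equation of the contraction \<open>x \<mapsto> x - w T x + w y\<close>. The factor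
  \<open>w\<close> allows rotating and scaling \<open>T\<close> before comparing it with the identity.
\<close>

lemma invertible_if_contraction:
  fixes T :: "'h::chilbert_space \<Rightarrow>\<^sub>L 'h"
  assumes w: "w \<noteq> 0" and r: "0 \<le> r" "r < 1"
    and contr: "\<And>x. norm (x - w *\<^sub>C T x) \<le> r * norm x"
  shows "invertible_blinfun T"
proof -
  have ex1: "\<exists>!x. T x = y" for y
  proof -
    have "\<exists>!x. x - w *\<^sub>C T x + w *\<^sub>C y = x"
    proof (rule banach_fix_type[OF r])
      show "\<forall>x z. dist (x - w *\<^sub>C T x + w *\<^sub>C y) (z - w *\<^sub>C T z + w *\<^sub>C y) \<le> r * dist x z"
      proof (intro allI)
        fix x z
        have eq: "(x - w *\<^sub>C T x + w *\<^sub>C y) - (z - w *\<^sub>C T z + w *\<^sub>C y) = (x - z) - w *\<^sub>C T (x - z)"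
          by (simp add: blinfun.diff_right scaleC_diff_right)
        show "dist (x - w *\<^sub>C T x + w *\<^sub>C y) (z - w *\<^sub>C T z + w *\<^sub>C y) \<le> r * dist x z"
          unfolding dist_norm eq by (rule contr)
      qed
    qed
    moreover have "x - w *\<^sub>C T x + w *\<^sub>C y = x \<longleftrightarrow> T x = y" for x
    proof -
      have "x - w *\<^sub>C T x + w *\<^sub>C y = x \<longleftrightarrow> w *\<^sub>C (y - T x) = 0"
        by (auto simp: scaleC_diff_right algebra_simps)
      also have "\<dots> \<longleftrightarrow> T x = y"
        using w by auto
      finally show ?thesis .
    qed
    ultimately show ?thesis by simp
  qed
  define S where "S y = (THE x. T x = y)" for y
  have TS: "T (S y) = y" for y
    unfolding S_def using theI'[OF ex1] .
  have ST: "S (T x) = x" for x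
    using TS ex1 by metis
  have bdd: "norm x \<le> norm (T x) * (cmod w / (1 - r))" for x
  proof -
    have "norm x \<le> norm (x - w *\<^sub>C T x) + norm (w *\<^sub>C T x)"
      by (metis diff_add_cancel norm_triangle_ineq)
    also have "\<dots> \<le> r * norm x + cmod w * norm (T x)"
      using contr[of x] by simp
    finally have "(1 - r) * norm x \<le> cmod w * norm (T x)"
      by (simp add: algebra_simps)
    with r show ?thesis by (simp add: field_simps)
  qed
  have "bounded_linear S"
  proof (rule bounded_linear_intro)
    show "S (x + y) = S x + S y" for x y
      by (metis ST TS blinfun.add_right)
    show "S (c *\<^sub>R x) = c *\<^sub>R S x" for c x
      by (metis ST TS blinfun.scaleR_right)
    show "norm (S x) \<le> norm x * (cmod w / (1 - r))" for x
      using bdd[of "S x"] by (simp add: TS)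
  qed
  then have "blinfun_apply (Blinfun S) = S"
    by (rule bounded_linear_Blinfun_apply)
  then show ?thesis
    unfolding invertible_blinfun_def
    by (intro exI[of _ "Blinfun S"]) (auto intro!: blinfun_eqI simp: TS ST)
qed

text \<open>
  The lemma of Lax and Milgram: for small \<open>t > 0\<close>, \<open>1 - t c T\<close> is a strict contraction. With suitable \<open>c\<close> it
  gives both the reality of the spectrum and its location between the bounds of the quadratic form.
\<close>

lemma invertible_if_coercive:
  fixes T :: "'h::chilbert_space \<Rightarrow>\<^sub>L 'h"
  assumes m: "0 < m" and c: "c \<noteq> 0"
    and coercive: "\<And>x. m * (norm x)\<^sup>2 \<le> Re (c * cinner (T x) x)"
  shows "invertible_blinfun T"
proof -
  \<comment> \<open>The summand \<open>m\<close> only ensures \<open>m \<le> N\<close> and \<open>0 < N\<close>; the choice of \<open>t\<close> minimises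
    \<open>1 - 2 t m + t\<^sup>2 N\<^sup>2\<close>, the bound for \<open>\<parallel>1 - t c T\<parallel>\<^sup>2\<close>, and \<open>r\<^sup>2\<close> is the minimum.\<close>
  define N where "N = cmod c * norm T + m"
  have N: "m \<le> N" "0 < N" using m by (simp_all add: N_def add_nonneg_pos)
  define t where "t = m / N\<^sup>2"
  have t: "0 < t" using N m by (simp add: t_def)
  define r where "r = sqrt (1 - m\<^sup>2 / N\<^sup>2)"
  have mN: "m\<^sup>2 / N\<^sup>2 \<le> 1" "0 < m\<^sup>2 / N\<^sup>2"
    using N m by (simp_all add: power_mono)
  show ?thesis
  proof (rule invertible_if_contraction)
    show "complex_of_real t * c \<noteq> 0" "0 \<le> r" "r < 1"
      using t c mN by (simp_all add: r_def)
    fix x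
    define u where "u = c *\<^sub>C T x"
    have u: "norm u \<le> N * norm x"
    proof -
      have "norm u \<le> cmod c * (norm T * norm x)"
        unfolding u_def by (simp add: mult_left_mono norm_blinfun)
      also have "\<dots> \<le> N * norm x"
        using m by (simp add: N_def algebra_simps)
      finally show ?thesis .
    qed
    have "(norm (x - t *\<^sub>R u))\<^sup>2 = Re (cinner (x - t *\<^sub>R u) (x - t *\<^sub>R u))"
      by simp
    also have "\<dots> = (norm x)\<^sup>2 - 2 * t * Re (cinner u x) + t\<^sup>2 * (norm u)\<^sup>2"
      using cinner_commute[of x u]
      by (simp add: cinner_simps algebra_simps power2_eq_square del: Re_cinner_self)
        (simp add: cinner_self power2_eq_square)
    also have "\<dots> \<le> (norm x)\<^sup>2 - 2 * t * (m * (norm x)\<^sup>2) + t\<^sup>2 * (N * norm x)\<^sup>2"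
      using coercive[of x] t u
      by (intro add_mono diff_mono mult_left_mono power_mono) (auto simp: u_def cinner_simps)
    also have "\<dots> = (r * norm x)\<^sup>2"
    proof -
      have r2: "r\<^sup>2 = 1 - m\<^sup>2 / N\<^sup>2"
        using mN by (simp add: r_def)
      have tN: "t * N\<^sup>2 = m"
        using N by (simp add: t_def)
      then have tN2: "t\<^sup>2 * N\<^sup>2 = t * m"
        by (simp add: power2_eq_square mult.assoc)
      have tm: "t * m = m\<^sup>2 / N\<^sup>2"
        by (simp add: t_def power2_eq_square)
      have "(norm x)\<^sup>2 - 2 * t * (m * (norm x)\<^sup>2) + t\<^sup>2 * (N\<^sup>2 * (norm x)\<^sup>2) =
          (1 - 2 * (t * m) + t\<^sup>2 * N\<^sup>2) * (norm x)\<^sup>2"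
        by (simp add: algebra_simps)
      then show ?thesis
        unfolding power_mult_distrib r2 tN2 tm by simp
    qed
    finally have "norm (x - t *\<^sub>R u) \<le> r * norm x"
      by (rule power2_le_imp_le) (use mN in \<open>simp add: r_def\<close>)
    then show "norm (x - (complex_of_real t * c) *\<^sub>C T x) \<le> r * norm x"
      by (simp only: u_def scaleC_scaleC scaleC_of_real[symmetric])
  qed
qed

text \<open>
  Bounds on the quadratic form serve as a substitute for bounds on the spectrum: they pass directly to sums,
  compressions, congruences and limits.
\<close>

definition hermitian_between :: "real \<Rightarrow> real \<Rightarrow> ('h::chilbert_space \<Rightarrow>\<^sub>L 'h) \<Rightarrow> bool" where
  "hermitian_between a b X \<longleftrightarrow> hermitian X \<and>
     (\<forall>x. a * (norm x)\<^sup>2 \<le> Re (cinner (X x) x) \<and> Re (cinner (X x) x) \<le> b * (norm x)\<^sup>2)"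

lemma hermitian_between_hermitian: "hermitian_between a b X \<Longrightarrow> hermitian X"
  by (simp add: hermitian_between_def)

lemma hermitian_between_complex_linear: "hermitian_between a b X \<Longrightarrow> complex_linear X"
  by (simp add: hermitian_between_def hermitian_complex_linear)

lemma hermitian_between_mono:
  assumes "hermitian_between a b X" "a' \<le> a" "b \<le> b'"
  shows "hermitian_between a' b' X"
  using assms unfolding hermitian_between_def
  by (meson mult_right_mono order_trans zero_le_power2)

lemma hermitian_between_norm: "hermitian X \<Longrightarrow> hermitian_between (- norm X) (norm X) X"
  using Re_cinner_le[of X] by (auto simp: hermitian_between_def abs_le_iff minus_le_iff)

lemma spectrum_hermitian_between:
  assumes X: "hermitian_between a b X"
  shows "spectrum hilbert_UNIV (blinfun_apply X) \<subseteq> complex_of_real ` {a..b}"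
proof
  fix z assume "z \<in> spectrum hilbert_UNIV (blinfun_apply X)"
  then have ninv: "\<not> invertible_blinfun (X - op_scaleC z id_blinfun)"
    using X by (simp add: spectrum_iff hermitian_between_complex_linear)
  have form: "cinner ((X - op_scaleC z id_blinfun) x) x =
      complex_of_real (Re (cinner (X x) x)) - z * complex_of_real ((norm x)\<^sup>2)" for x
    using X hermitian_Im[of X x]
    by (auto simp: hermitian_between_def blinfun.bilinear_simps cinner_simps cinner_self
        complex_eq_iff)
  have bds: "a * (norm x)\<^sup>2 \<le> Re (cinner (X x) x)" "Re (cinner (X x) x) \<le> b * (norm x)\<^sup>2" for x
    using X by (auto simp: hermitian_between_def)
  \<comment> \<open>The form of \<open>X - z\<close> is coercive after multiplication by \<open>\<i> Im z\<close>, 1 or -1 if \<open>z\<close> is, respectively,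
    not real, to the left of \<open>a\<close>, or to the right of \<open>b\<close>.\<close>
  have "Im z = 0"
  proof (rule ccontr)
    assume "Im z \<noteq> 0"
    then have "invertible_blinfun (X - op_scaleC z id_blinfun)"
      by (intro invertible_if_coercive[where m = "(Im z)\<^sup>2" and c = "\<i> * Im z"])
        (simp_all add: form, simp add: power2_eq_square algebra_simps)
    with ninv show False by simp
  qed
  moreover have "a \<le> Re z"
  proof (rule ccontr)
    assume "\<not> a \<le> Re z"
    then have "invertible_blinfun (X - op_scaleC z id_blinfun)"
      using bds(1) by (intro invertible_if_coercive[where m = "a - Re z" and c = 1])
        (auto simp: form algebra_simps)
    with ninv show False by simp
  qed
  moreover have "Re z \<le> b"
  proof (rule ccontr)
    assume "\<not> Re z \<le> b"
    then have "invertible_blinfun (X - op_scaleC z id_blinfun)"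
      using bds(2) by (intro invertible_if_coercive[where m = "Re z - b" and c = "-1"])
        (auto simp: form algebra_simps)
    with ninv show False by simp
  qed
  ultimately show "z \<in> complex_of_real ` {a..b}"
    by (auto intro!: image_eqI[of _ _ "Re z"] simp: complex_eq_iff)
qed

text \<open>
  Cauchy-Schwarz for the form of \<open>X\<close>, with the second vector \<open>X y\<close>. The alternative \<open>X = 0\<close> covers the zero
  space, on which the bounds hold for negative \<open>M\<close> as well.
\<close>

lemma norm_le_if_hermitian_between:
  assumes X: "hermitian_between 0 M X"
  shows "norm X \<le> M \<or> X = 0"
proof (cases "X = 0")
  case False
  then obtain x where "X x \<noteq> 0" by (metis blinfun_eqI zero_blinfun.rep_eq)
  then have x: "x \<noteq> 0" by auto
  have "0 * (norm x)\<^sup>2 \<le> M * (norm x)\<^sup>2"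
    using X order_trans unfolding hermitian_between_def by blast
  with x have M: "0 \<le> M" by (simp add: zero_le_mult_iff)
  have "norm (X y) \<le> M * norm y" for y
  proof (cases "X y = 0")
    case False
    have "(cmod (cinner (X y) (X y)))\<^sup>2 \<le> Re (cinner (X y) y) * Re (cinner (X (X y)) (X y))"
      using X by (intro positive_form_Cauchy_Schwarz) (auto simp: hermitian_between_def)
    also have "\<dots> \<le> (M * (norm y)\<^sup>2) * (M * (norm (X y))\<^sup>2)"
      using X M by (intro mult_mono) (auto simp: hermitian_between_def)
    also have "\<dots> = (M * norm y * norm (X y))\<^sup>2"
      by (simp add: power2_eq_square)
    finally have "(norm (X y) * norm (X y))\<^sup>2 \<le> (M * norm y * norm (X y))\<^sup>2"
      by (simp add: power2_eq_square)
    then have "norm (X y) * norm (X y) \<le> M * norm y * norm (X y)"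
      by (rule power2_le_imp_le) (use M in simp)
    with False show ?thesis by simp
  qed (use M in simp)
  then show ?thesis using M by (auto intro: norm_blinfun_bound)
qed simp

lemma self_adjoint_UNIV_iff:
  "self_adjoint hilbert_UNIV (blinfun_apply X) \<longleftrightarrow> hermitian X"
  using bounded_ops_iff_complex_linear[of X] hermitian_complex_linear[of X]
  by (auto simp: self_adjoint_def is_adjoint_def)

lemma positive_op_UNIV_iff:
  "positive_op hilbert_UNIV (blinfun_apply X) \<longleftrightarrow> hermitian X \<and> (\<forall>x. 0 \<le> Re (cinner (X x) x))"
  by (simp add: positive_op_def self_adjoint_UNIV_iff)

lemma op_le_iff:
  "X \<preceq> Y \<longleftrightarrow> hermitian X \<and> hermitian Y \<and> (\<forall>x. Re (cinner (X x) x) \<le> Re (cinner (Y x) x))"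
proof -
  have "(\<lambda>x\<in>hcarrier hilbert_UNIV. hdiff hilbert_UNIV (Y x) (X x)) = blinfun_apply (Y - X)"
    by (simp add: fun_eq_iff hdiff_hilbert_UNIV blinfun.bilinear_simps)
  then show ?thesis
    unfolding op_le_def loewner_le_def
    by (auto simp: self_adjoint_UNIV_iff positive_op_UNIV_iff is_adjoint_def blinfun.bilinear_simps
        cinner_simps)
qed

text \<open>
  If \<open>S\<close> inverts \<open>X\<close>, then \<open>\<parallel>x\<parallel>\<^sup>2 \<le> \<parallel>S\<parallel>\<^sup>2 \<parallel>X x\<parallel>\<^sup>2\<close>, and \<open>\<parallel>X x\<parallel>\<^sup>2 \<le> \<parallel>X\<parallel> \<langle>X x, x\<rangle>\<close> by Cauchy-Schwarz for the form of
  \<open>X\<close>; so invertibility bounds a positive form away from 0. The converse is coercivity.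
\<close>

lemma strictly_positive_iff:
  "strictly_positive X \<longleftrightarrow> (\<exists>a b. 0 < a \<and> hermitian_between a b X)"
proof
  assume "strictly_positive X"
  then have X: "hermitian X" "\<And>x. 0 \<le> Re (cinner (X x) x)" and "invertible_blinfun X"
    by (auto simp: strictly_positive_def positive_op_UNIV_iff invertible_op_iff
        hermitian_complex_linear)
  then obtain S where S: "S o\<^sub>L X = id_blinfun" by (auto simp: invertible_blinfun_def)
  define k where "k = (norm S)\<^sup>2 * norm X + 1"
  have k: "0 < k" by (simp add: k_def add_nonneg_pos)
  have "(norm x)\<^sup>2 \<le> k * Re (cinner (X x) x)" for x
  proof -
    have Xx: "(norm (X x))\<^sup>2 \<le> norm X * Re (cinner (X x) x)"
    proof (cases "X x = 0")
      case False
      have "(cmod (cinner (X x) (X x)))\<^sup>2 \<le> Re (cinner (X x) x) * Re (cinner (X (X x)) (X x))"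
        by (rule positive_form_Cauchy_Schwarz[OF X])
      also have "\<dots> \<le> Re (cinner (X x) x) * (norm X * (norm (X x))\<^sup>2)"
        using Re_cinner_le[of X "X x"] X(2) by (intro mult_left_mono) auto
      finally have "(norm (X x))\<^sup>2 * (norm (X x))\<^sup>2 \<le> norm X * Re (cinner (X x) x) * (norm (X x))\<^sup>2"
        by (simp add: power2_eq_square mult_ac)
      with False show ?thesis
        by (simp only: mult_le_cancel_right) simp
    qed (use X(2) in simp)
    have "norm x = norm (S (X x))"
      using S by (metis blinfun_apply_blinfun_compose blinfun_apply_id_blinfun)
    also have "\<dots> \<le> norm S * norm (X x)" by (rule norm_blinfun)
    finally have "(norm x)\<^sup>2 \<le> (norm S)\<^sup>2 * (norm (X x))\<^sup>2"
      by (metis norm_ge_zero power_mono power_mult_distrib)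
    also have "\<dots> \<le> (norm S)\<^sup>2 * (norm X * Re (cinner (X x) x))"
      by (intro mult_left_mono Xx) simp
    also have "\<dots> \<le> k * Re (cinner (X x) x)"
      using X(2)[of x] by (simp add: k_def algebra_simps)
    finally show ?thesis .
  qed
  then have "hermitian_between (1 / k) (norm X) X"
    using X k hermitian_between_norm[OF X(1)]
    by (auto simp: hermitian_between_def field_simps)
  with k show "\<exists>a b. 0 < a \<and> hermitian_between a b X"
    by (intro exI[of _ "1 / k"] exI[of _ "norm X"]) simp
next
  assume "\<exists>a b. 0 < a \<and> hermitian_between a b X"
  then obtain a b where ab: "0 < a" "hermitian_between a b X" by blast
  then have X: "hermitian X" "\<And>x. a * (norm x)\<^sup>2 \<le> Re (cinner (X x) x)"
    by (auto simp: hermitian_between_def)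
  have "invertible_blinfun X"
    by (rule invertible_if_coercive[where m = a and c = 1]) (use ab X in auto)
  moreover have "0 \<le> Re (cinner (X x) x)" for x
    using X(2)[of x] ab(1) by (meson mult_nonneg_nonneg less_imp_le order_trans zero_le_power2)
  ultimately show "strictly_positive X"
    using X by (simp add: strictly_positive_def positive_op_UNIV_iff invertible_op_iff
        hermitian_complex_linear)
qed

section \<open>Polynomials of an operator\<close>

text \<open>
  Complex coefficients are allowed because the spectral estimate below splits polynomials into linear factors.
\<close>

definition op_cpoly :: "complex poly \<Rightarrow> ('h::chilbert_space \<Rightarrow>\<^sub>L 'h) \<Rightarrow> ('h \<Rightarrow>\<^sub>L 'h)" where
  "op_cpoly p X = fold_coeffs (\<lambda>a G. op_scaleC a id_blinfun + (X o\<^sub>L G)) p 0"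

lemma op_cpoly_0 [simp]: "op_cpoly 0 X = 0"
  by (simp add: op_cpoly_def)

lemma op_cpoly_pCons [simp]:
  "op_cpoly (pCons a p) X = op_scaleC a id_blinfun + (X o\<^sub>L op_cpoly p X)"
  by (cases "p = 0 \<and> a = 0") (auto simp: op_cpoly_def intro!: blinfun_eqI)

lemma complex_linear_op_cpoly [intro, simp]: "complex_linear X \<Longrightarrow> complex_linear (op_cpoly p X)"
  by (induction p) auto

lemma op_cpoly_add: "op_cpoly (p + q) X = op_cpoly p X + op_cpoly q X"
  by (induction p q rule: poly_induct2)
    (auto intro!: blinfun_eqI simp: blinfun.bilinear_simps scaleC_add_left)

lemma op_cpoly_smult:
  "complex_linear X \<Longrightarrow> op_cpoly (smult c p) X = op_scaleC c (op_cpoly p X)"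
  by (induction p)
    (auto intro!: blinfun_eqI simp: complex_linear_def blinfun.bilinear_simps scaleC_add_right scaleC_scaleC)

lemma op_cpoly_mult:
  assumes "complex_linear X"
  shows "op_cpoly (p * q) X = op_cpoly p X o\<^sub>L op_cpoly q X"
  using assms
  by (induction p)
    (auto intro!: blinfun_eqI simp: op_cpoly_add op_cpoly_smult blinfun.bilinear_simps)

lemma scaleC_diff_left: "(c - d) *\<^sub>C x = c *\<^sub>C x - d *\<^sub>C (x :: 'h::chilbert_space)"
  using scaleC_add_left[of "c - d" d x] by simp

lemma op_cpoly_diff: "op_cpoly (p - q) X = op_cpoly p X - op_cpoly q X"
  using op_cpoly_add[of "p - q" q X] by simp

definition op_rpoly :: "real poly \<Rightarrow> ('h::chilbert_space \<Rightarrow>\<^sub>L 'h) \<Rightarrow> ('h \<Rightarrow>\<^sub>L 'h)" where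
  "op_rpoly p = op_cpoly (map_poly complex_of_real p)"

lemma op_rpoly_0 [simp]: "op_rpoly 0 X = 0"
  by (simp add: op_rpoly_def)

lemma op_rpoly_pCons [simp]: "op_rpoly (pCons a p) X = a *\<^sub>R id_blinfun + (X o\<^sub>L op_rpoly p X)"
  by (simp add: op_rpoly_def map_poly_pCons op_scaleC_of_real)

lemma complex_linear_op_rpoly [intro, simp]: "complex_linear X \<Longrightarrow> complex_linear (op_rpoly p X)"
  by (simp add: op_rpoly_def)

lemma map_poly_of_real_hom:
  fixes p q :: "real poly"
  shows "map_poly complex_of_real (p - q) = map_poly of_real p - map_poly of_real q"
    "map_poly complex_of_real (p * q) = map_poly of_real p * map_poly of_real q"
  by (auto intro!: poly_eqI simp: coeff_map_poly coeff_mult)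

lemma poly_map_poly_of_real:
  "poly (map_poly complex_of_real p) (complex_of_real t) = complex_of_real (poly p t)"
  by (induction p) (auto simp: map_poly_pCons)

lemma op_rpoly_diff: "op_rpoly (p - q) X = op_rpoly p X - op_rpoly q X"
  by (simp add: op_rpoly_def map_poly_of_real_hom op_cpoly_diff)

lemma op_rpoly_mult:
  "complex_linear X \<Longrightarrow> op_rpoly (p * q) X = op_rpoly p X o\<^sub>L op_rpoly q X"
  by (simp add: op_rpoly_def map_poly_of_real_hom op_cpoly_mult)

text \<open>
  The operators \<open>X\<close> and \<open>Y\<close> may act on different spaces. This one relation yields the functional calculus
  of direct sums (\<open>V\<close> a projection) and of operators with an invariant subspace (\<open>V\<close> an isometry).
\<close>

lemma op_rpoly_intertwine:
  assumes "X o\<^sub>L V = V o\<^sub>L Y"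
  shows "op_rpoly p X o\<^sub>L V = V o\<^sub>L op_rpoly p Y"
proof (induction p)
  case (pCons a p)
  have "X (V x) = V (Y x)" "op_rpoly p X (V x) = V (op_rpoly p Y x)" for x
    using assms pCons by (metis blinfun_apply_blinfun_compose)+
  then show ?case
    by (auto intro!: blinfun_eqI simp: blinfun.bilinear_simps)
qed (auto intro!: blinfun_eqI)

lemma hermitian_op_rpoly:
  assumes X: "hermitian X"
  shows "hermitian (op_rpoly p X)"
proof (induction p)
  case (pCons a p)
  have "X o\<^sub>L X = X o\<^sub>L X" ..
  from op_rpoly_intertwine[OF this, of p]
  have "op_rpoly p X (X y) = X (op_rpoly p X y)" for y
    by (metis blinfun_apply_blinfun_compose)
  then show ?case
    using X pCons by (simp add: is_adjoint_def blinfun.bilinear_simps cinner_simps)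
qed (simp add: is_adjoint_def)

lemma tendsto_op_rpoly [tendsto_intros]:
  "(X \<longlongrightarrow> X0) F \<Longrightarrow> ((\<lambda>s. op_rpoly p (X s)) \<longlongrightarrow> op_rpoly p X0) F"
  by (induction p) (auto intro!: tendsto_intros bounded_bilinear.tendsto[OF bounded_bilinear_blinfun_compose])

lemma op_poly_hilbert_UNIV: "op_poly hilbert_UNIV p (blinfun_apply X) = blinfun_apply (op_rpoly p X)"
proof (induction p)
  case 0
  show ?case by (simp add: op_poly_def fun_eq_iff)
next
  case (pCons a p)
  then show ?case
    by (cases "a = 0") (simp_all add: op_poly_def fun_eq_iff scaleC_of_real blinfun.bilinear_simps)
qed


section \<open>The norm of a polynomial of a hermitian operator\<close>

text \<open>
  Over the complex numbers \<open>q\<close> splits into linear factors, and \<open>q(X)\<close> is the product of the corresponding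
  operators \<open>X - z\<close>.
\<close>

lemma invertible_op_cpoly:
  assumes X: "complex_linear X" and "q \<noteq> 0"
    and "\<And>z. poly q z = 0 \<Longrightarrow> invertible_blinfun (X - op_scaleC z id_blinfun)"
  shows "invertible_blinfun (op_cpoly q X)"
  using assms(2,3)
proof (induction "degree q" arbitrary: q)
  case 0
  then obtain c where q: "q = [:c:]" using degree_eq_zeroE by metis
  with 0 have c: "c \<noteq> 0" by auto
  show ?case
    unfolding invertible_blinfun_def
    by (intro exI[of _ "op_scaleC (1 / c) id_blinfun"])
      (use c in \<open>auto intro!: blinfun_eqI simp: q scaleC_scaleC\<close>)
next
  case (Suc n)
  then have "\<not> constant (poly q)"
    by (simp add: constant_degree)
  then obtain z where z: "poly q z = 0"
    using fundamental_theorem_of_algebra by blast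
  then obtain r where q: "q = [:- z, 1:] * r"
    by (metis poly_eq_0_iff_dvd dvdE)
  with Suc have r: "r \<noteq> 0" by auto
  then have "degree q = Suc (degree r)"
    unfolding q by (subst degree_mult_eq) auto
  with Suc have "n = degree r" by simp
  then have "invertible_blinfun (op_cpoly r X)"
    using Suc r by (intro Suc.hyps) (auto simp: q)
  moreover have "invertible_blinfun (X - op_scaleC z id_blinfun)"
    by (rule Suc.prems(2)[OF z])
  moreover have "op_cpoly [:- z, 1:] X = X - op_scaleC z id_blinfun"
    using scaleC_diff_left[of 0 z]
    by (auto intro!: blinfun_eqI simp: blinfun.bilinear_simps)
  ultimately show ?case
    unfolding q op_cpoly_mult[OF X] by (simp add: invertible_blinfun_compose)
qed

text \<open>
  Unit vectors on which \<open>Z\<close> almost attains its norm are approximate eigenvectors of \<open>Z\<^sup>2\<close> for the eigenvalue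
  \<open>(norm Z)\<^sup>2\<close>; a bounded inverse of \<open>(norm Z)\<^sup>2 - Z\<^sup>2\<close> would keep \<open>norm (Z x)\<close> uniformly below \<open>norm Z\<close>.
\<close>

lemma norm_square_in_spectrum:
  fixes Z :: "'h::chilbert_space \<Rightarrow>\<^sub>L 'h"
  assumes Z: "hermitian Z" and nontriv: "(x0 :: 'h) \<noteq> 0"
  shows "\<not> invertible_blinfun ((norm Z)\<^sup>2 *\<^sub>R id_blinfun - (Z o\<^sub>L Z))"
proof
  define N where "N = norm Z"
  define T where "T = N\<^sup>2 *\<^sub>R id_blinfun - (Z o\<^sub>L Z)"
  assume "invertible_blinfun ((norm Z)\<^sup>2 *\<^sub>R id_blinfun - (Z o\<^sub>L Z))"
  then obtain S where S: "S o\<^sub>L T = id_blinfun"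
    by (auto simp: invertible_blinfun_def T_def N_def)
  \<comment> \<open>The summand 1 makes \<open>k\<close> positive also when \<open>N = 0\<close>.\<close>
  define k where "k = (norm S)\<^sup>2 * N\<^sup>2 + 1"
  have k: "0 < k" by (simp add: k_def add_nonneg_pos)
  have NZ: "(norm (Z x))\<^sup>2 \<le> N\<^sup>2 * (norm x)\<^sup>2" for x
    using norm_blinfun[of Z x] by (simp add: N_def power_mono flip: power_mult_distrib)
  have main: "(norm x)\<^sup>2 \<le> k * (N\<^sup>2 * (norm x)\<^sup>2 - (norm (Z x))\<^sup>2)" for x
  proof -
    have "norm x = norm (S (T x))"
      using S by (metis blinfun_apply_blinfun_compose blinfun_apply_id_blinfun)
    also have "\<dots> \<le> norm S * norm (T x)" by (rule norm_blinfun)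
    finally have "(norm x)\<^sup>2 \<le> (norm S)\<^sup>2 * (norm (T x))\<^sup>2"
      by (metis norm_ge_zero power_mono power_mult_distrib)
    also have "(norm (T x))\<^sup>2 = Re (cinner (T x) (T x))" by simp
    also have "\<dots> = N\<^sup>2 * N\<^sup>2 * (norm x)\<^sup>2 - 2 * N\<^sup>2 * (norm (Z x))\<^sup>2 + (norm (Z (Z x)))\<^sup>2"
      using hermitianD[OF Z, of x "Z x"] hermitianD[OF Z, of "Z x" x] Re_cinner_self[of "Z x"]
      by (simp add: T_def blinfun.bilinear_simps cinner_simps algebra_simps)
    also have "\<dots> \<le> N\<^sup>2 * N\<^sup>2 * (norm x)\<^sup>2 - 2 * N\<^sup>2 * (norm (Z x))\<^sup>2 + N\<^sup>2 * (norm (Z x))\<^sup>2"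
      using NZ[of "Z x"] by simp
    also have "\<dots> = N\<^sup>2 * (N\<^sup>2 * (norm x)\<^sup>2 - (norm (Z x))\<^sup>2)"
      by (simp add: algebra_simps)
    finally have "(norm x)\<^sup>2 \<le> (norm S)\<^sup>2 * (N\<^sup>2 * (N\<^sup>2 * (norm x)\<^sup>2 - (norm (Z x))\<^sup>2))"
      by (simp add: mult_left_mono)
    also have "\<dots> \<le> k * (N\<^sup>2 * (norm x)\<^sup>2 - (norm (Z x))\<^sup>2)"
      unfolding k_def distrib_right mult.assoc using NZ[of x] by simp
    finally show ?thesis .
  qed
  have bd: "(norm (Z x))\<^sup>2 \<le> (N\<^sup>2 - 1 / k) * (norm x)\<^sup>2" for x
    using main[of x] k by (simp add: field_simps)
  have nonneg: "0 \<le> N\<^sup>2 - 1 / k"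
  proof -
    have "0 \<le> (N\<^sup>2 - 1 / k) * (norm x0)\<^sup>2"
      using bd[of x0] zero_le_power2 order_trans by blast
    with nontriv show ?thesis by (simp add: zero_le_mult_iff)
  qed
  have "norm Z \<le> sqrt (N\<^sup>2 - 1 / k)"
  proof (rule norm_blinfun_bound)
    show "0 \<le> sqrt (N\<^sup>2 - 1 / k)" using nonneg by simp
    show "norm (Z x) \<le> sqrt (N\<^sup>2 - 1 / k) * norm x" for x
      using real_le_rsqrt[OF bd[of x]] nonneg by (simp add: real_sqrt_mult)
  qed
  then have "N\<^sup>2 \<le> N\<^sup>2 - 1 / k"
    using nonneg real_sqrt_le_mono[of "N\<^sup>2"] unfolding N_def
    by (metis norm_ge_zero power_mono real_sqrt_pow2)
  with k show False by simp
qed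

text \<open>
  With \<open>N = \<parallel>p(X)\<parallel>\<close>, the operator \<open>(N\<^sup>2 - p\<^sup>2)(X)\<close> is not invertible, so the polynomial \<open>N\<^sup>2 - p\<^sup>2\<close> has a zero \<open>t\<close> in the
  spectrum, that is, \<open>N = \<bar>p(t)\<bar>\<close>.
\<close>

lemma norm_op_rpoly_le:
  fixes X :: "'h::chilbert_space \<Rightarrow>\<^sub>L 'h"
  assumes X: "hermitian X" and c: "0 \<le> c"
    and bound: "\<And>t. complex_of_real t \<in> spectrum hilbert_UNIV (blinfun_apply X) \<Longrightarrow> \<bar>poly p t\<bar> \<le> c"
  shows "norm (op_rpoly p X) \<le> c"
proof (cases "\<exists>x::'h. x \<noteq> 0")
  case False
  then have "op_rpoly p X = 0" by (auto intro!: blinfun_eqI)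
  with c show ?thesis by simp
next
  case True
  then obtain x0 :: 'h where x0: "x0 \<noteq> 0" by blast
  have lin: "complex_linear X" using X by (rule hermitian_complex_linear)
  let ?q = "\<lambda>p. [:complex_of_real ((norm (op_rpoly p X))\<^sup>2):] -
    map_poly complex_of_real p * map_poly complex_of_real p"
  have attained: "\<exists>t. complex_of_real t \<in> spectrum hilbert_UNIV (blinfun_apply X) \<and>
      poly (?q p) (complex_of_real t) = 0" if nz: "?q p \<noteq> 0" for p
  proof -
    have "op_cpoly (?q p) X = (norm (op_rpoly p X))\<^sup>2 *\<^sub>R id_blinfun - (op_rpoly p X o\<^sub>L op_rpoly p X)"
      unfolding op_cpoly_diff op_cpoly_mult[OF lin] op_rpoly_def op_cpoly_pCons op_scaleC_of_real
      by simp
    then have "\<not> invertible_blinfun (op_cpoly (?q p) X)"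
      using norm_square_in_spectrum[OF hermitian_op_rpoly[OF X] x0] by simp
    then obtain z where z: "poly (?q p) z = 0" "\<not> invertible_blinfun (X - op_scaleC z id_blinfun)"
      using invertible_op_cpoly[OF lin nz] by blast
    then have "z \<in> spectrum hilbert_UNIV (blinfun_apply X)"
      using lin by (simp add: spectrum_iff)
    with z(1) spectrum_hermitian_between[OF hermitian_between_norm[OF X]] show ?thesis
      by blast
  qed
  \<comment> \<open>If \<open>N\<^sup>2 - p\<^sup>2\<close> is the zero polynomial, any point of the spectrum will do; the polynomial
    \<open>p(t) = t\<close> shows that there is one.\<close>
  have "?q [:0, 1:] \<noteq> 0"
    by (simp add: map_poly_pCons)
  from attained[OF this] obtain s where
    s: "complex_of_real s \<in> spectrum hilbert_UNIV (blinfun_apply X)" by blast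
  have "\<exists>t. complex_of_real t \<in> spectrum hilbert_UNIV (blinfun_apply X) \<and>
      poly (?q p) (complex_of_real t) = 0"
  proof (cases "?q p = 0")
    case True
    show ?thesis
      using s unfolding True poly_0 by blast
  qed (rule attained)
  then obtain t where t: "complex_of_real t \<in> spectrum hilbert_UNIV (blinfun_apply X)"
    "poly (?q p) (complex_of_real t) = 0"
    by blast
  have "complex_of_real ((norm (op_rpoly p X))\<^sup>2) = complex_of_real ((poly p t)\<^sup>2)"
    using t(2) by (simp add: poly_map_poly_of_real power2_eq_square)
  then have "(norm (op_rpoly p X))\<^sup>2 = (poly p t)\<^sup>2"
    by (simp only: of_real_eq_iff)
  then have "norm (op_rpoly p X) = \<bar>poly p t\<bar>"
    by (metis abs_norm_cancel power2_eq_iff_nonneg abs_ge_zero power2_abs)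
  with bound[OF t(1)] show ?thesis by simp
qed


section \<open>Continuous functional calculus\<close>

lemma op_norm_hilbert_UNIV: "op_norm hilbert_UNIV (blinfun_apply T) = norm T"
proof -
  let ?S = "{x. norm x \<le> 1}"
  have eq: "op_norm hilbert_UNIV (blinfun_apply T) = (SUP x\<in>?S. norm (T x))"
    by (simp add: op_norm_def hnorm_hilbert_UNIV)
  have le: "norm (T x) \<le> norm T" if "x \<in> ?S" for x
    using that norm_blinfun[of T x] mult_left_mono[of "norm x" 1 "norm T"] by simp
  have bdd: "bdd_above ((\<lambda>x. norm (T x)) ` ?S)"
    using le by (intro bdd_aboveI2)
  have "(SUP x\<in>?S. norm (T x)) \<le> norm T"
    using le by (intro cSUP_least) (auto intro: exI[of _ 0])
  moreover have "norm T \<le> (SUP x\<in>?S. norm (T x))"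
  proof (rule norm_blinfun_bound)
    show "0 \<le> (SUP x\<in>?S. norm (T x))"
      using bdd by (intro cSUP_upper2[where x = 0]) auto
    fix x
    show "norm (T x) \<le> (SUP x\<in>?S. norm (T x)) * norm x"
    proof (cases "x = 0")
      case False
      have "norm (T ((1 / norm x) *\<^sub>R x)) \<le> (SUP x\<in>?S. norm (T x))"
        using False by (intro cSUP_upper bdd) auto
      with False show ?thesis
        by (simp add: blinfun.bilinear_simps field_simps)
    qed simp
  qed
  ultimately show ?thesis unfolding eq by simp
qed

lemma uniform_polynomial_approximation:
  fixes f :: "real \<Rightarrow> real"
  assumes "continuous_on {a..b} f"
  obtains p where "uniform_limit {a..b} (\<lambda>n. poly (p n)) f sequentially"
proof -
  have "\<exists>p. \<forall>t\<in>{a..b}. \<bar>f t - poly p t\<bar> < inverse (Suc n)" for n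
  proof -
    obtain g where g: "real_polynomial_function g"
        "\<And>t. t \<in> {a..b} \<Longrightarrow> \<bar>f t - g t\<bar> < inverse (Suc n)"
      using Stone_Weierstrass_real_polynomial_function[OF compact_Icc assms, of "inverse (Suc n)"]
      by auto
    then obtain c m where "g = (\<lambda>t. \<Sum>i\<le>m. c i * t ^ i)"
      by (auto simp: real_polynomial_function_iff_sum)
    then have "g = poly (\<Sum>i\<le>m. monom (c i) i)"
      by (simp add: fun_eq_iff poly_sum poly_monom)
    with g(2) show ?thesis
      by (intro exI[of _ "\<Sum>i\<le>m. monom (c i) i"]) auto
  qed
  then obtain p where p: "\<And>n t. t \<in> {a..b} \<Longrightarrow> \<bar>f t - poly (p n) t\<bar> < inverse (Suc n)"
    by metis
  have "uniform_limit {a..b} (\<lambda>n. poly (p n)) f sequentially"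
  proof (rule uniform_limitI)
    fix e :: real assume "0 < e"
    then obtain N where N: "inverse (real (Suc N)) < e"
      using reals_Archimedean by blast
    show "\<forall>\<^sub>F n in sequentially. \<forall>t\<in>{a..b}. dist (poly (p n) t) (f t) < e"
    proof (rule eventually_sequentiallyI, intro ballI)
      fix n t assume n: "N \<le> n" and t: "t \<in> {a..b}"
      have "\<bar>f t - poly (p n) t\<bar> < inverse (Suc n)" by (rule p[OF t])
      also have "\<dots> \<le> inverse (Suc N)" using n by (simp add: field_simps)
      finally show "dist (poly (p n) t) (f t) < e"
        using N by (simp add: dist_real_def abs_minus_commute)
    qed
  qed
  then show thesis by (rule that)
qed

text \<open>
  By \<open>norm_op_rpoly_le\<close>, polynomials that converge uniformly on the spectrum give a Cauchy sequence of operators,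
  and any two such sequences with the same limit function give the same operator. The approximation theorem of
  Weierstrass, applied on an interval around the spectrum, supplies one sequence; hence exactly one operator
  satisfies the defining condition. The existence clause is what allows computing the definite description for
  an isometric copy of the space.
\<close>

lemma op_fun_characterisation:
  fixes X :: "'h::chilbert_space \<Rightarrow>\<^sub>L 'h"
  assumes X: "hermitian_between a b X" and f: "continuous_on {a..b} f"
  shows "complex_linear (op_fun f X)" (is ?lin)
    and "blinfun_apply (op_fun f X) = fun_calc hilbert_UNIV f (blinfun_apply X)" (is ?apply)
    and "\<exists>!Y. Y \<in> bounded_ops hilbert_UNIV \<and>
     (\<forall>p :: nat \<Rightarrow> real poly.
        uniform_limit {t. complex_of_real t \<in> spectrum hilbert_UNIV (blinfun_apply X)}
          (\<lambda>n. poly (p n)) f sequentially \<longrightarrow>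
        (\<lambda>n. op_norm hilbert_UNIV (\<lambda>x\<in>hcarrier hilbert_UNIV.
           hdiff hilbert_UNIV (op_poly hilbert_UNIV (p n) (blinfun_apply X) x) (Y x))) \<longlonglongrightarrow> 0)"
       (is "\<exists>!Y. ?P Y")
    and "\<And>p. uniform_limit {a..b} (\<lambda>n. poly (p n)) f sequentially \<Longrightarrow>
      (\<lambda>n. op_rpoly (p n) X) \<longlonglongrightarrow> op_fun f X" (is "\<And>p. ?ul p \<Longrightarrow> ?lim p")
proof -
  let ?\<sigma> = "{t. complex_of_real t \<in> spectrum hilbert_UNIV (blinfun_apply X)}"
  have herm: "hermitian X" and lin: "complex_linear X"
    using X by (auto simp: hermitian_between_hermitian hermitian_between_complex_linear)
  have sub: "?\<sigma> \<subseteq> {a..b}"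
    using spectrum_hermitian_between[OF X] by auto
  have P_iff: "?P (blinfun_apply Y) \<longleftrightarrow> complex_linear Y \<and>
      (\<forall>p. uniform_limit ?\<sigma> (\<lambda>n. poly (p n)) f sequentially \<longrightarrow> (\<lambda>n. op_rpoly (p n) X) \<longlonglongrightarrow> Y)" for Y
  proof -
    have "op_norm hilbert_UNIV (\<lambda>x\<in>hcarrier hilbert_UNIV.
           hdiff hilbert_UNIV (op_poly hilbert_UNIV p (blinfun_apply X) x) (Y x)) =
        norm (op_rpoly p X - Y)" for p
      unfolding op_norm_hilbert_UNIV[symmetric]
      by (rule arg_cong[where f = "op_norm hilbert_UNIV"])
        (simp add: fun_eq_iff hdiff_hilbert_UNIV op_poly_hilbert_UNIV blinfun.bilinear_simps)
    moreover have "(\<lambda>n. norm (op_rpoly (p n) X - Y)) \<longlonglongrightarrow> 0 \<longleftrightarrow> (\<lambda>n. op_rpoly (p n) X) \<longlonglongrightarrow> Y" for p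
      by (simp add: tendsto_norm_zero_iff flip: LIM_zero_iff[of _ Y])
    ultimately show ?thesis
      by (simp add: bounded_ops_iff_complex_linear)
  qed
  obtain q where q: "uniform_limit {a..b} (\<lambda>n. poly (q n)) f sequentially"
    using uniform_polynomial_approximation[OF f] .
  have q\<sigma>: "uniform_limit ?\<sigma> (\<lambda>n. poly (q n)) f sequentially"
    using uniform_limit_on_subset[OF q sub] .
  have near: "norm (op_rpoly p X - op_rpoly r X) < e"
    if e: "0 < e" and p: "\<forall>t\<in>?\<sigma>. dist (poly p t) (f t) < e / 4"
      and r: "\<forall>t\<in>?\<sigma>. dist (poly r t) (f t) < e / 4" for p r e
  proof -
    have "norm (op_rpoly (p - r) X) \<le> e / 2"
    proof (rule norm_op_rpoly_le[OF herm])
      fix t assume "complex_of_real t \<in> spectrum hilbert_UNIV (blinfun_apply X)"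
      then have "dist (poly p t) (f t) < e / 4" "dist (poly r t) (f t) < e / 4"
        using p r by auto
      then show "\<bar>poly (p - r) t\<bar> \<le> e / 2"
        unfolding dist_real_def poly_diff by linarith
    qed (use e in simp)
    with e show ?thesis by (simp add: op_rpoly_diff)
  qed
  have close: "\<forall>\<^sub>F n in sequentially. norm (op_rpoly (p n) X - op_rpoly (q n) X) < e"
    if p: "uniform_limit ?\<sigma> (\<lambda>n. poly (p n)) f sequentially" and e: "0 < e" for p e
  proof -
    have "\<forall>\<^sub>F n in sequentially. \<forall>t\<in>?\<sigma>. dist (poly (p n) t) (f t) < e / 4"
         "\<forall>\<^sub>F n in sequentially. \<forall>t\<in>?\<sigma>. dist (poly (q n) t) (f t) < e / 4"
      using uniform_limitD[OF p, of "e / 4"] uniform_limitD[OF q\<sigma>, of "e / 4"] e by auto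
    then show ?thesis
      by eventually_elim (rule near[OF e])
  qed
  have "Cauchy (\<lambda>n. op_rpoly (q n) X)"
  proof (rule CauchyI)
    fix e :: real assume e: "0 < e"
    obtain N where N: "\<And>n. N \<le> n \<Longrightarrow> \<forall>t\<in>?\<sigma>. dist (poly (q n) t) (f t) < e / 4"
      using uniform_limitD[OF q\<sigma>, of "e / 4"] e unfolding eventually_sequentially by auto
    show "\<exists>M. \<forall>m\<ge>M. \<forall>n\<ge>M. norm (op_rpoly (q m) X - op_rpoly (q n) X) < e"
      by (intro exI[of _ N] allI impI near[OF e] N)
  qed
  then obtain Y where Y: "(\<lambda>n. op_rpoly (q n) X) \<longlonglongrightarrow> Y"
    using Cauchy_convergent convergentD by blast
  have "Y (c *\<^sub>C x) = c *\<^sub>C Y x" for c x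
  proof -
    have *: "(\<lambda>n. op_rpoly (q n) X y) \<longlonglongrightarrow> Y y" for y
      by (intro tendsto_intros Y)
    have sc: "(\<lambda>n. op_rpoly (q n) X (c *\<^sub>C x)) \<longlonglongrightarrow> op_scaleC c id_blinfun (Y x)"
      using blinfun.tendsto[OF tendsto_const[of "op_scaleC c id_blinfun"] *[of x]]
        complex_linear_op_rpoly[OF lin] by (simp add: complex_linear_def)
    show ?thesis
      using LIMSEQ_unique[OF *[of "c *\<^sub>C x"] sc] by simp
  qed
  then have Ylin: "complex_linear Y" by (simp add: complex_linear_def)
  have "(\<lambda>n. op_rpoly (p n) X) \<longlonglongrightarrow> Y"
    if p: "uniform_limit ?\<sigma> (\<lambda>n. poly (p n)) f sequentially" for p
  proof -
    have "(\<lambda>n. op_rpoly (p n) X - op_rpoly (q n) X) \<longlonglongrightarrow> 0"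
      using close[OF p] by (auto simp: tendsto_iff)
    from tendsto_add[OF this Y] show ?thesis by simp
  qed
  with Ylin have PY: "?P (blinfun_apply Y)"
    unfolding P_iff by blast
  have uniq: "F = blinfun_apply Y" if F: "?P F" for F
  proof -
    obtain Z where Z: "F = blinfun_apply Z"
      using F bounded_ops_blinfun by blast
    have "?P (blinfun_apply Z)" using F unfolding Z .
    then have "(\<lambda>n. op_rpoly (q n) X) \<longlonglongrightarrow> Z"
      unfolding P_iff using q\<sigma> by blast
    with Y Z show ?thesis
      using LIMSEQ_unique by blast
  qed
  show "\<exists>!Y. ?P Y" using PY uniq by blast
  have "fun_calc hilbert_UNIV f (blinfun_apply X) = blinfun_apply Y"
    unfolding fun_calc_def by (rule the_equality) (use PY uniq in blast)+
  then have opf: "op_fun f X = Y"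
    by (simp add: op_fun_def blinfun_apply_inverse)
  show ?lin using opf Ylin by simp
  show ?apply
    using \<open>fun_calc hilbert_UNIV f (blinfun_apply X) = blinfun_apply Y\<close> opf by simp
  show "?lim p" if "?ul p" for p
    using PY uniform_limit_on_subset[OF that sub] unfolding P_iff opf by blast
qed

lemmas op_fun_limit = op_fun_characterisation(4)

text \<open>
  This is how identities between functions that hold only on part of the real line, such as \<open>\<surd>t * \<surd>t = t\<close>, pass
  to operators with spectrum in that part.
\<close>

lemma op_fun_cong:
  assumes X: "hermitian_between a b X" and f: "continuous_on {a..b} f"
    and eq: "\<And>t. t \<in> {a..b} \<Longrightarrow> f t = g t"
  shows "op_fun f X = op_fun g X"
proof -
  obtain p where p: "uniform_limit {a..b} (\<lambda>n. poly (p n)) f sequentially"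
    using uniform_polynomial_approximation[OF f] .
  moreover have "uniform_limit {a..b} (\<lambda>n. poly (p n)) g sequentially"
  proof (rule uniform_limitI)
    fix e :: real assume "0 < e"
    then show "\<forall>\<^sub>F n in sequentially. \<forall>t\<in>{a..b}. dist (poly (p n) t) (g t) < e"
      using uniform_limitD[OF p] eq by (auto elim!: eventually_mono)
  qed
  moreover have "continuous_on {a..b} g"
    by (rule continuous_on_eq[OF f eq])
  ultimately show ?thesis
    using op_fun_limit[OF X] f LIMSEQ_unique by blast
qed

lemma op_fun_poly:
  assumes X: "hermitian_between a b X"
  shows "op_fun (poly p) X = op_rpoly p X"
proof -
  have "(\<lambda>n. op_rpoly p X) \<longlonglongrightarrow> op_fun (poly p) X"
  proof (rule op_fun_limit[OF X, of "poly p" "\<lambda>_. p"])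
    show "continuous_on {a..b} (poly p)" by (intro continuous_on_poly continuous_on_id)
    show "uniform_limit {a..b} (\<lambda>n. poly p) (poly p) sequentially" by (rule uniform_limit_const)
  qed
  from LIMSEQ_unique[OF this tendsto_const] show ?thesis .
qed

lemma op_fun_ident: "hermitian_between a b X \<Longrightarrow> op_fun (\<lambda>t. t) X = X"
  using op_fun_poly[of a b X "[:0, 1:]"] by (auto intro!: blinfun_eqI simp: poly_pCons[abs_def])

lemma op_fun_const: "hermitian_between a b X \<Longrightarrow> op_fun (\<lambda>t. c) X = c *\<^sub>R id_blinfun"
  using op_fun_poly[of a b X "[:c:]"] by (simp add: poly_pCons[abs_def])

lemma op_fun_id_blinfun: "op_fun f id_blinfun = f 1 *\<^sub>R id_blinfun"
proof -
  have id: "hermitian_between 1 1 id_blinfun"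
    by (simp add: hermitian_between_def is_adjoint_def)
  then have "op_fun f id_blinfun = op_fun (\<lambda>_. f 1) id_blinfun"
    by (rule op_fun_cong) auto
  also have "\<dots> = f 1 *\<^sub>R id_blinfun"
    by (rule op_fun_const[OF id])
  finally show ?thesis .
qed

lemma hermitian_op_fun:
  assumes X: "hermitian_between a b X" and f: "continuous_on {a..b} f"
  shows "hermitian (op_fun f X)"
proof -
  obtain p where "uniform_limit {a..b} (\<lambda>n. poly (p n)) f sequentially"
    using uniform_polynomial_approximation[OF f] .
  then have lim: "(\<lambda>n. op_rpoly (p n) X) \<longlonglongrightarrow> op_fun f X"
    by (rule op_fun_limit[OF X f])
  have "cinner (op_fun f X x) y = cinner x (op_fun f X y)" for x y
  proof (rule LIMSEQ_unique)
    show "(\<lambda>n. cinner (op_rpoly (p n) X x) y) \<longlonglongrightarrow> cinner (op_fun f X x) y"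
      by (intro tendsto_intros lim)
    have "(\<lambda>n. cinner x (op_rpoly (p n) X y)) \<longlonglongrightarrow> cinner x (op_fun f X y)"
      by (intro tendsto_intros lim)
    then show "(\<lambda>n. cinner (op_rpoly (p n) X x) y) \<longlonglongrightarrow> cinner x (op_fun f X y)"
      using hermitian_op_rpoly[OF hermitian_between_hermitian[OF X]] by (simp add: is_adjoint_def)
  qed
  then show ?thesis by (simp add: is_adjoint_def)
qed

lemma op_fun_mult:
  assumes X: "hermitian_between a b X"
    and f: "continuous_on {a..b} f" and g: "continuous_on {a..b} g"
  shows "op_fun (\<lambda>t. f t * g t) X = op_fun f X o\<^sub>L op_fun g X"
proof -
  obtain p where p: "uniform_limit {a..b} (\<lambda>n. poly (p n)) f sequentially"
    using uniform_polynomial_approximation[OF f] .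
  obtain q where q: "uniform_limit {a..b} (\<lambda>n. poly (q n)) g sequentially"
    using uniform_polynomial_approximation[OF g] .
  have "uniform_limit {a..b} (\<lambda>n t. poly (p n) t * poly (q n) t) (\<lambda>t. f t * g t) sequentially"
    using p q f g
    by (intro uniform_lim_mult compact_imp_bounded compact_continuous_image) auto
  then have "uniform_limit {a..b} (\<lambda>n. poly (p n * q n)) (\<lambda>t. f t * g t) sequentially"
    by (simp add: poly_mult[abs_def])
  then have "(\<lambda>n. op_rpoly (p n * q n) X) \<longlonglongrightarrow> op_fun (\<lambda>t. f t * g t) X"
    using f g by (intro op_fun_limit[OF X] continuous_intros)
  moreover have "(\<lambda>n. op_rpoly (p n) X o\<^sub>L op_rpoly (q n) X) \<longlonglongrightarrow> (op_fun f X o\<^sub>L op_fun g X)"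
    by (intro bounded_bilinear.tendsto[OF bounded_bilinear_blinfun_compose]
        op_fun_limit[OF X f p] op_fun_limit[OF X g q])
  ultimately show ?thesis
    unfolding op_rpoly_mult[OF hermitian_between_complex_linear[OF X]] by (rule LIMSEQ_unique)
qed

lemma op_fun_intertwine:
  assumes X: "hermitian_between a b X" and Y: "hermitian_between a b Y"
    and f: "continuous_on {a..b} f" and V: "X o\<^sub>L V = V o\<^sub>L Y"
  shows "op_fun f X o\<^sub>L V = V o\<^sub>L op_fun f Y"
proof -
  obtain p where p: "uniform_limit {a..b} (\<lambda>n. poly (p n)) f sequentially"
    using uniform_polynomial_approximation[OF f] .
  have "(\<lambda>n. op_rpoly (p n) X o\<^sub>L V) \<longlonglongrightarrow> (op_fun f X o\<^sub>L V)"
    by (intro bounded_bilinear.tendsto[OF bounded_bilinear_blinfun_compose] tendsto_const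
        op_fun_limit[OF X f p])
  moreover have "(\<lambda>n. V o\<^sub>L op_rpoly (p n) Y) \<longlonglongrightarrow> (V o\<^sub>L op_fun f Y)"
    by (intro bounded_bilinear.tendsto[OF bounded_bilinear_blinfun_compose] tendsto_const
        op_fun_limit[OF Y f p])
  ultimately show ?thesis
    unfolding op_rpoly_intertwine[OF V] by (rule LIMSEQ_unique)
qed

text \<open>
  The operator \<open>f(X)\<close> is the square of the hermitian operator \<open>(\<surd>f)(X)\<close>.
\<close>

lemma op_fun_nonneg:
  assumes X: "hermitian_between a b X" and f: "continuous_on {a..b} f"
    and nonneg: "\<And>t. t \<in> {a..b} \<Longrightarrow> 0 \<le> f t"
  shows "0 \<le> Re (cinner (op_fun f X x) x)"
proof -
  define r where "r = (\<lambda>t. sqrt (f t))"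
  have r: "continuous_on {a..b} r"
    unfolding r_def by (intro continuous_intros f)
  have "op_fun f X = op_fun (\<lambda>t. r t * r t) X"
    using X f nonneg by (intro op_fun_cong[of a b]) (auto simp: r_def)
  also have "\<dots> = op_fun r X o\<^sub>L op_fun r X"
    by (rule op_fun_mult[OF X r r])
  finally have "cinner (op_fun f X x) x = cinner (op_fun r X x) (op_fun r X x)"
    using hermitian_op_fun[OF X r] by (simp add: is_adjoint_def)
  then show ?thesis by simp
qed

lemma norm_op_fun_diff_op_rpoly:
  assumes X: "hermitian_between a b X" and f: "continuous_on {a..b} f" and e: "0 \<le> e"
    and close: "\<And>t. t \<in> {a..b} \<Longrightarrow> \<bar>f t - poly p t\<bar> \<le> e"
  shows "norm (op_fun f X - op_rpoly p X) \<le> e"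
proof (rule field_le_epsilon)
  fix d :: real assume d: "0 < d"
  obtain q where q: "uniform_limit {a..b} (\<lambda>n. poly (q n)) f sequentially"
    using uniform_polynomial_approximation[OF f] .
  have sub: "t \<in> {a..b}" if "complex_of_real t \<in> spectrum hilbert_UNIV (blinfun_apply X)" for t
    using that spectrum_hermitian_between[OF X] by auto
  show "norm (op_fun f X - op_rpoly p X) \<le> e + d"
  proof (rule Lim_norm_ubound)
    show "(\<lambda>n. op_rpoly (q n) X - op_rpoly p X) \<longlonglongrightarrow> op_fun f X - op_rpoly p X"
      by (intro tendsto_intros op_fun_limit[OF X f q])
    show "\<forall>\<^sub>F n in sequentially. norm (op_rpoly (q n) X - op_rpoly p X) \<le> e + d"
      using uniform_limitD[OF q d]
    proof eventually_elim
      case (elim n)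
      have "norm (op_rpoly (q n - p) X) \<le> e + d"
      proof (rule norm_op_rpoly_le[OF hermitian_between_hermitian[OF X]])
        fix t assume "complex_of_real t \<in> spectrum hilbert_UNIV (blinfun_apply X)"
        then have "\<bar>f t - poly p t\<bar> \<le> e" "dist (poly (q n) t) (f t) < d"
          using sub close elim by auto
        then show "\<bar>poly (q n - p) t\<bar> \<le> e + d"
          unfolding dist_real_def poly_diff by linarith
      qed (use d e in simp)
      then show ?case by (simp add: op_rpoly_diff)
    qed
  qed simp
qed

text \<open>
  One polynomial close to \<open>f\<close> on \<open>{a..b}\<close> approximates \<open>f(Y)\<close> uniformly over all \<open>Y\<close> between \<open>a\<close> and \<open>b\<close>, and
  polynomials of an operator are norm continuous.
\<close>

lemma tendsto_op_fun:
  assumes lim: "(X \<longlongrightarrow> X0) F" and f: "continuous_on {a..b} f"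
    and X: "\<forall>\<^sub>F s in F. hermitian_between a b (X s)" and X0: "hermitian_between a b X0"
  shows "((\<lambda>s. op_fun f (X s)) \<longlongrightarrow> op_fun f X0) F"
proof (rule tendstoI)
  fix e :: real assume e: "0 < e"
  obtain q where "uniform_limit {a..b} (\<lambda>n. poly (q n)) f sequentially"
    using uniform_polynomial_approximation[OF f] .
  from uniform_limitD[OF this, of "e / 4"] e
  obtain n where n: "\<And>t. t \<in> {a..b} \<Longrightarrow> dist (poly (q n) t) (f t) < e / 4"
    using eventually_happens by fastforce
  define p where "p = q n"
  have p: "\<bar>f t - poly p t\<bar> \<le> e / 4" if "t \<in> {a..b}" for t
    using n[OF that] by (simp add: p_def dist_real_def abs_minus_commute)
  have "\<forall>\<^sub>F s in F. dist (op_rpoly p (X s)) (op_rpoly p X0) < e / 4"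
    using tendstoD[OF tendsto_op_rpoly[OF lim], of "e / 4"] e by simp
  with X show "\<forall>\<^sub>F s in F. dist (op_fun f (X s)) (op_fun f X0) < e"
  proof eventually_elim
    case (elim s)
    have "norm (op_fun f (X s) - op_rpoly p (X s)) \<le> e / 4"
         "norm (op_fun f X0 - op_rpoly p X0) \<le> e / 4"
      using norm_op_fun_diff_op_rpoly[OF _ f _ p] elim X0 e by auto
    moreover have "op_fun f (X s) - op_fun f X0 = (op_fun f (X s) - op_rpoly p (X s)) +
        ((op_rpoly p (X s) - op_rpoly p X0) - (op_fun f X0 - op_rpoly p X0))"
      by simp
    then have "norm (op_fun f (X s) - op_fun f X0) \<le> norm (op_fun f (X s) - op_rpoly p (X s)) +
        (norm (op_rpoly p (X s) - op_rpoly p X0) + norm (op_fun f X0 - op_rpoly p X0))"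
      by (simp only: norm_triangle_mono[OF order_refl norm_triangle_ineq4])
    ultimately show ?case
      using elim e by (simp add: dist_norm)
  qed
qed

text \<open>
  Operators that are close in norm have close quadratic forms. This localises \<open>tendsto_op_fun\<close>: near a strictly
  positive operator all bounds can be taken the same.
\<close>

lemma eventually_hermitian_between:
  assumes lim: "(X \<longlongrightarrow> X0) F" and herm: "\<forall>\<^sub>F s in F. hermitian (X s)"
    and X0: "hermitian_between a b X0" and "a' < a" "b < b'"
  shows "\<forall>\<^sub>F s in F. hermitian_between a' b' (X s)"
proof -
  define e where "e = min (a - a') (b' - b)"
  have e: "0 < e" "e \<le> a - a'" "e \<le> b' - b" using assms by (auto simp: e_def)
  have "\<forall>\<^sub>F s in F. dist (X s) X0 < e"
    using tendstoD[OF lim e(1)] .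
  with herm show ?thesis
  proof eventually_elim
    case (elim s)
    have "a' * (norm x)\<^sup>2 \<le> Re (cinner (X s x) x) \<and> Re (cinner (X s x) x) \<le> b' * (norm x)\<^sup>2" for x
    proof -
      have "\<bar>Re (cinner (X s x) x) - Re (cinner (X0 x) x)\<bar> \<le> norm (X s - X0) * (norm x)\<^sup>2"
        using Re_cinner_le[of "X s - X0" x] by (simp add: blinfun.bilinear_simps cinner_simps)
      also have "\<dots> \<le> e * (norm x)\<^sup>2"
        using elim by (intro mult_right_mono) (auto simp: dist_norm)
      finally have "\<bar>Re (cinner (X s x) x) - Re (cinner (X0 x) x)\<bar> \<le> e * (norm x)\<^sup>2" .
      moreover have "e * (norm x)\<^sup>2 \<le> (a - a') * (norm x)\<^sup>2" "e * (norm x)\<^sup>2 \<le> (b' - b) * (norm x)\<^sup>2"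
        using e by (auto intro: mult_right_mono)
      moreover have "a * (norm x)\<^sup>2 \<le> Re (cinner (X0 x) x)" "Re (cinner (X0 x) x) \<le> b * (norm x)\<^sup>2"
        using X0 by (auto simp: hermitian_between_def)
      ultimately show ?thesis
        unfolding left_diff_distrib by linarith
    qed
    with elim show ?case by (simp add: hermitian_between_def)
  qed
qed

section \<open>Strictly positive operators\<close>

lemma strictly_positiveE:
  assumes "strictly_positive X"
  obtains a b where "0 < a" "a \<le> b" "hermitian_between a b X"
proof -
  obtain a b where "0 < a" "hermitian_between a b X"
    using assms strictly_positive_iff by blast
  then show thesis
    using that[of a "max a b"] hermitian_between_mono[of a b X a "max a b"] by simp
qed

lemma tendsto_op_fun_strictly_positive:
  assumes lim: "(X \<longlongrightarrow> X0) F" and X: "\<And>s. strictly_positive (X s)" and X0: "strictly_positive X0"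
    and f: "continuous_on {0<..} f"
  shows "((\<lambda>s. op_fun f (X s)) \<longlongrightarrow> op_fun f X0) F"
proof -
  obtain a b where ab: "0 < a" "hermitian_between a b X0"
    using X0 by (rule strictly_positiveE)
  have "hermitian (X s)" for s
    using X strictly_positive_iff hermitian_between_hermitian by blast
  then have "\<forall>\<^sub>F s in F. hermitian_between (a / 2) (b + 1) (X s)"
    using ab by (intro eventually_hermitian_between[OF lim _ ab(2)]) auto
  moreover have "hermitian_between (a / 2) (b + 1) X0"
    using ab by (auto intro: hermitian_between_mono)
  moreover have "continuous_on {a / 2..b + 1} f"
    using f by (rule continuous_on_subset) (use ab in auto)
  ultimately show ?thesis
    by (intro tendsto_op_fun[OF lim])
qed

lemma continuous_on_powr_Icc: "0 < a \<Longrightarrow> continuous_on {a..b} (\<lambda>t::real. t powr r)"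
  by (intro continuous_on_powr continuous_on_id continuous_on_const) auto

context
  fixes A :: "'h::chilbert_space \<Rightarrow>\<^sub>L 'h"
  assumes A: "strictly_positive A"
begin

lemma hermitian_op_powr: "hermitian (op_powr A r)"
proof -
  obtain a b where ab: "0 < a" "hermitian_between a b A"
    using A by (rule strictly_positiveE)
  show ?thesis
    unfolding op_powr_def by (rule hermitian_op_fun[OF ab(2) continuous_on_powr_Icc[OF ab(1)]])
qed

lemma op_powr_add: "op_powr A r o\<^sub>L op_powr A s = op_powr A (r + s)"
proof -
  obtain a b where ab: "0 < a" "hermitian_between a b A"
    using A by (rule strictly_positiveE)
  note cont = continuous_on_powr_Icc[OF ab(1)]
  show ?thesis
    unfolding op_powr_def powr_add
    by (rule op_fun_mult[OF ab(2) cont cont, symmetric])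
qed

lemma op_powr_one: "op_powr A 1 = A"
proof -
  obtain a b where ab: "0 < a" "hermitian_between a b A"
    using A by (rule strictly_positiveE)
  have "op_fun (\<lambda>t. t powr 1) A = op_fun (\<lambda>t. t) A"
    using ab(1) by (intro op_fun_cong[OF ab(2)] continuous_on_powr_Icc) auto
  then show ?thesis
    by (simp add: op_powr_def op_fun_ident[OF ab(2)])
qed

lemma op_powr_zero: "op_powr A 0 = id_blinfun"
proof -
  obtain a b where ab: "0 < a" "hermitian_between a b A"
    using A by (rule strictly_positiveE)
  have "op_fun (\<lambda>t. t powr 0) A = op_fun (\<lambda>t. 1) A"
    using ab(1) by (intro op_fun_cong[OF ab(2)] continuous_on_powr_Icc) auto
  then show ?thesis
    by (simp add: op_powr_def op_fun_const[OF ab(2)])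
qed

lemma op_powr_apply:
  "op_powr A (1/2) (op_powr A (1/2) x) = A x"
  "op_powr A (1/2) (op_powr A (-1/2) x) = x"
  "op_powr A (-1/2) (op_powr A (1/2) x) = x"
proof -
  have "op_powr A (1/2) o\<^sub>L op_powr A (1/2) = A" "op_powr A (1/2) o\<^sub>L op_powr A (-1/2) = id_blinfun"
    "op_powr A (-1/2) o\<^sub>L op_powr A (1/2) = id_blinfun"
    by (simp_all add: op_powr_add op_powr_one op_powr_zero)
  from this[THEN arg_cong[where f = "\<lambda>T. blinfun_apply T x"]]
  show "op_powr A (1/2) (op_powr A (1/2) x) = A x"
    "op_powr A (1/2) (op_powr A (-1/2) x) = x" "op_powr A (-1/2) (op_powr A (1/2) x) = x"
    by simp_all
qed

end

text \<open>
  The left inverse bounds \<open>norm (R x)\<close> below by a multiple of \<open>norm x\<close>, and so preserves the positive lower bound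
  of the form.
\<close>

lemma strictly_positive_congruence:
  fixes A R S :: "'h::chilbert_space \<Rightarrow>\<^sub>L 'h"
  assumes A: "strictly_positive A" and R: "hermitian R" and S: "\<And>x. S (R x) = x"
  shows "strictly_positive (R o\<^sub>L A o\<^sub>L R)"
proof -
  obtain a b where ab: "0 < a" "a \<le> b" "hermitian_between a b A"
    using A by (rule strictly_positiveE)
  define k where "k = (norm S)\<^sup>2 + 1"
  have k: "0 < k" by (simp add: k_def add_nonneg_pos)
  have form: "cinner ((R o\<^sub>L A o\<^sub>L R) x) y = cinner (A (R x)) (R y)" for x y
    using R by (simp add: is_adjoint_def)
  have herm: "hermitian (R o\<^sub>L A o\<^sub>L R)"
    using R ab(3) by (simp add: is_adjoint_def hermitian_between_def)
  have low: "a / k * (norm x)\<^sup>2 \<le> Re (cinner ((R o\<^sub>L A o\<^sub>L R) x) x)" for x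
  proof -
    have "norm x \<le> norm S * norm (R x)"
      using norm_blinfun[of S "R x"] S by simp
    then have "(norm x)\<^sup>2 \<le> (norm S)\<^sup>2 * (norm (R x))\<^sup>2"
      by (metis norm_ge_zero power_mono power_mult_distrib)
    also have "\<dots> \<le> k * (norm (R x))\<^sup>2"
      by (intro mult_right_mono) (auto simp: k_def)
    finally have "a / k * (norm x)\<^sup>2 \<le> a * (norm (R x))\<^sup>2"
      using ab(1) k by (simp add: field_simps)
    also have "\<dots> \<le> Re (cinner ((R o\<^sub>L A o\<^sub>L R) x) x)"
      using ab(3) unfolding form hermitian_between_def by blast
    finally show ?thesis .
  qed
  have "hermitian_between (a / k) (norm (R o\<^sub>L A o\<^sub>L R)) (R o\<^sub>L A o\<^sub>L R)"
    using herm low hermitian_between_norm[OF herm] by (simp add: hermitian_between_def)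
  moreover have "0 < a / k" using ab k by simp
  ultimately show ?thesis
    unfolding strictly_positive_iff by blast
qed

lemma strictly_positive_add:
  assumes "strictly_positive A" "strictly_positive B"
  shows "strictly_positive (A + B)"
proof -
  obtain a b where ab: "0 < a" "hermitian_between a b A"
    using assms(1) by (rule strictly_positiveE)
  obtain c d where cd: "0 < c" "hermitian_between c d B"
    using assms(2) by (rule strictly_positiveE)
  have "hermitian_between (a + c) (b + d) (A + B)"
    using ab cd unfolding hermitian_between_def
    by (auto simp: is_adjoint_def blinfun.bilinear_simps cinner_simps distrib_right intro: add_mono)
  moreover have "0 < a + c" using ab cd by simp
  ultimately show ?thesis
    unfolding strictly_positive_iff by blast
qed

section \<open>Copies of a Hilbert space inside another type\<close>

text \<open>
  The structure of the space \<open>'v\<close>, transported along an injection \<open>e\<close> to the range of \<open>e\<close>. Operator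
  monotonicity is a statement about all Hilbert space structures on subsets of a fixed type, and becomes
  available for \<open>'v\<close> through such a copy.
\<close>

definition copy_space :: "('v::chilbert_space \<Rightarrow> 'u) \<Rightarrow> 'u hilbert" where
  "copy_space e = \<lparr>hcarrier = range e, hadd = (\<lambda>u v. e (inv e u + inv e v)), hzero = e 0,
     hscale = (\<lambda>c u. e (c *\<^sub>C inv e u)), hinner = (\<lambda>u v. cinner (inv e u) (inv e v))\<rparr>"

definition copy_op :: "('v::chilbert_space \<Rightarrow> 'u) \<Rightarrow> ('v \<Rightarrow> 'v) \<Rightarrow> 'u \<Rightarrow> 'u" where
  "copy_op e X = (\<lambda>u\<in>range e. e (X (inv e u)))"

lemma copy_space_simps [simp]:
  "hcarrier (copy_space e) = range e" "hadd (copy_space e) u v = e (inv e u + inv e v)"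
  "hzero (copy_space e) = e 0" "hscale (copy_space e) c u = e (c *\<^sub>C inv e u)"
  "hinner (copy_space e) u v = cinner (inv e u) (inv e v)"
  by (simp_all add: copy_space_def)

context
  fixes e :: "'v::chilbert_space \<Rightarrow> 'u"
  assumes inj: "inj e"
begin

lemma inv_e [simp]: "inv e (e x) = x"
  using inj by simp

lemma e_eq_iff [simp]: "e x = e y \<longleftrightarrow> x = y"
  using inj by (simp add: inj_eq)

lemma hdiff_copy: "hdiff (copy_space e) u v = e (inv e u - inv e v)"
  by (simp add: hdiff_def)

lemma hnorm_copy: "hnorm (copy_space e) u = norm (inv e u)"
  by (simp add: hnorm_def cinner_self)

text \<open>
  The map \<open>e\<close> is an isometry onto the copy; so the copy inherits completeness.
\<close>

lemma complex_hilbert_space_copy: "complex_hilbert_space (copy_space e)"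
proof -
  let ?d = "\<lambda>u v. norm (inv e u - inv e v)"
  interpret M: Metric_space "range e" ?d
  proof
    show "norm (inv e x - inv e z) \<le> norm (inv e x - inv e y) + norm (inv e y - inv e z)" for x y z
      by (metis diff_add_cancel add_diff_eq norm_triangle_ineq)
  qed (auto simp: norm_minus_commute)
  have "M.mcomplete"
    unfolding M.mcomplete_def
  proof (intro allI impI)
    fix \<sigma> assume \<sigma>: "M.MCauchy \<sigma>"
    then have "Cauchy (\<lambda>n. inv e (\<sigma> n))"
      by (simp add: M.MCauchy_def Cauchy_def dist_norm)
    then obtain l where l: "(\<lambda>n. inv e (\<sigma> n)) \<longlonglongrightarrow> l"
      using Cauchy_convergent convergentD by blast
    have "limitin M.mtopology \<sigma> (e l) sequentially"
      unfolding M.limitin_metric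
    proof (intro conjI rangeI allI impI)
      fix \<epsilon> :: real assume "0 < \<epsilon>"
      have "\<sigma> n \<in> range e" for n
        using \<sigma> by (auto simp: M.MCauchy_def)
      with tendstoD[OF l \<open>0 < \<epsilon>\<close>]
      show "\<forall>\<^sub>F n in sequentially. \<sigma> n \<in> range e \<and> norm (inv e (\<sigma> n) - inv e (e l)) < \<epsilon>"
        by (simp add: dist_norm)
    qed
    then show "\<exists>x. limitin M.mtopology \<sigma> x sequentially" by blast
  qed
  moreover have "hnorm (copy_space e) (hdiff (copy_space e) u v) = ?d u v" for u v
    by (simp add: hnorm_copy hdiff_copy)
  ultimately show ?thesis
    unfolding complex_hilbert_space_def Let_def
    by (auto simp: scaleC_add_right scaleC_add_left scaleC_scaleC cinner_add_left
        cinner_scaleC_left cinner_commute[symmetric] cinner_self add_ac)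
qed

lemma copy_op_apply [simp]: "copy_op e X (e x) = e (X x)"
  by (simp add: copy_op_def)

lemma copy_op_ext:
  assumes "F \<in> extensional (range e)" "\<And>x. F (e x) = e (X x)"
  shows "F = copy_op e X"
  using assms by (auto simp: copy_op_def fun_eq_iff extensional_def)

lemma copy_op_bounded_ops_iff:
  "copy_op e X \<in> bounded_ops (copy_space e) \<longleftrightarrow> X \<in> bounded_ops hilbert_UNIV"
  by (auto simp: bounded_ops_def hnorm_copy hnorm_hilbert_UNIV copy_op_def)

text \<open>
  Operators on the copy are extensional functions, so each of them is the image of an operator on \<open>'v\<close>. This
  is what transfers the uniqueness part of the functional calculus.
\<close>

lemma bounded_ops_copyE:
  assumes "F \<in> bounded_ops (copy_space e)"
  obtains X where "X \<in> bounded_ops hilbert_UNIV" "F = copy_op e X"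
proof -
  have F: "F \<in> range e \<rightarrow>\<^sub>E range e"
    using assms by (simp add: bounded_ops_def)
  have "F = copy_op e (\<lambda>x. inv e (F (e x)))"
  proof (rule copy_op_ext)
    show "F \<in> extensional (range e)" using F by (simp add: PiE_def)
    show "F (e x) = e (inv e (F (e x)))" for x
      using F by (intro f_inv_into_f[symmetric]) auto
  qed
  with assms copy_op_bounded_ops_iff that show thesis by metis
qed

lemma copy_op_diff:
  "(\<lambda>u\<in>range e. hdiff (copy_space e) (copy_op e X u) (copy_op e Y u)) = copy_op e (\<lambda>x. X x - Y x)"
  by (rule copy_op_ext) (auto simp: hdiff_copy)

lemma op_norm_copy: "op_norm (copy_space e) (copy_op e X) = op_norm hilbert_UNIV X"
proof -
  have "{u \<in> range e. norm (inv e u) \<le> 1} = e ` {x. norm x \<le> 1}" by auto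
  then show ?thesis
    by (simp add: op_norm_def hnorm_copy hnorm_hilbert_UNIV image_image)
qed

lemma invertible_op_copy:
  "invertible_op (copy_space e) (copy_op e X) \<longleftrightarrow> invertible_op hilbert_UNIV X"
proof
  assume "invertible_op (copy_space e) (copy_op e X)"
  then obtain F where X: "copy_op e X \<in> bounded_ops (copy_space e)"
    and F: "F \<in> bounded_ops (copy_space e)"
      "\<And>x. F (copy_op e X (e x)) = e x" "\<And>x. copy_op e X (F (e x)) = e x"
    by (auto simp: invertible_op_def)
  obtain Y where Y: "Y \<in> bounded_ops hilbert_UNIV" "F = copy_op e Y"
    using F(1) by (rule bounded_ops_copyE)
  then show "invertible_op hilbert_UNIV X"
    using X F(2,3) by (auto simp: invertible_op_def copy_op_bounded_ops_iff)
next
  assume "invertible_op hilbert_UNIV X"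
  then obtain Y where "X \<in> bounded_ops hilbert_UNIV" "Y \<in> bounded_ops hilbert_UNIV"
      "\<And>x. Y (X x) = x" "\<And>x. X (Y x) = x"
    by (auto simp: invertible_op_def)
  then show "invertible_op (copy_space e) (copy_op e X)"
    unfolding invertible_op_def
    by (intro conjI bexI[of _ "copy_op e Y"]) (auto simp: copy_op_bounded_ops_iff)
qed

lemma spectrum_copy: "spectrum (copy_space e) (copy_op e X) = spectrum hilbert_UNIV X"
proof -
  have "(\<lambda>u\<in>range e. hdiff (copy_space e) (copy_op e X u) (e (z *\<^sub>C inv e u))) =
      copy_op e (\<lambda>x. X x - z *\<^sub>C x)" for z
    by (rule copy_op_ext) (auto simp: hdiff_copy)
  then show ?thesis
    by (simp add: spectrum_def invertible_op_copy hdiff_hilbert_UNIV restrict_UNIV)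
qed

lemma op_poly_copy: "op_poly (copy_space e) p (copy_op e X) = copy_op e (op_poly hilbert_UNIV p X)"
proof (rule copy_op_ext)
  show "op_poly (copy_space e) p (copy_op e X) (e x) = e (op_poly hilbert_UNIV p X x)" for x
  proof (induction p arbitrary: x)
    case 0
    show ?case by (simp add: op_poly_def)
  next
    case (pCons a p)
    then show ?case
      by (cases "a = 0") (simp_all add: op_poly_def)
  qed
qed (simp add: op_poly_def)

lemma self_adjoint_copy: "self_adjoint (copy_space e) (copy_op e X) \<longleftrightarrow> self_adjoint hilbert_UNIV X"
  by (auto simp: self_adjoint_def copy_op_bounded_ops_iff)

lemma loewner_le_copy:
  "loewner_le (copy_space e) (copy_op e X) (copy_op e Y) \<longleftrightarrow> loewner_le hilbert_UNIV X Y"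
  by (auto simp: loewner_le_def positive_op_def self_adjoint_copy copy_op_diff hdiff_hilbert_UNIV
      restrict_UNIV)

text \<open>
  The defining condition of the functional calculus is invariant under the isometry, and by
  \<open>op_fun_characterisation\<close> it describes exactly one operator.
\<close>

lemma fun_calc_copy:
  assumes X: "hermitian_between a b X" and f: "continuous_on {a..b} f"
  shows "fun_calc (copy_space e) f (copy_op e (blinfun_apply X)) = copy_op e (blinfun_apply (op_fun f X))"
proof -
  let ?Q = "\<lambda>K X Y. Y \<in> bounded_ops K \<and> (\<forall>p :: nat \<Rightarrow> real poly.
     uniform_limit {t. complex_of_real t \<in> spectrum K X} (\<lambda>n. poly (p n)) f sequentially \<longrightarrow>
     (\<lambda>n. op_norm K (\<lambda>x\<in>hcarrier K. hdiff K (op_poly K (p n) X x) (Y x))) \<longlonglongrightarrow> 0)"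
  have Q: "?Q (copy_space e) (copy_op e (blinfun_apply X)) (copy_op e Y) \<longleftrightarrow>
      ?Q hilbert_UNIV (blinfun_apply X) Y" for Y
    by (simp add: copy_op_bounded_ops_iff spectrum_copy op_poly_copy copy_op_diff op_norm_copy
        hdiff_hilbert_UNIV restrict_UNIV)
  note ex1 = op_fun_characterisation(3)[OF X f]
  have QX: "?Q hilbert_UNIV (blinfun_apply X) (blinfun_apply (op_fun f X))"
    unfolding op_fun_characterisation(2)[OF X f] fun_calc_def by (rule theI'[OF ex1])
  show ?thesis
    unfolding fun_calc_def
  proof (rule the_equality)
    show "?Q (copy_space e) (copy_op e (blinfun_apply X)) (copy_op e (blinfun_apply (op_fun f X)))"
      unfolding Q by (rule QX)
    fix F assume F: "?Q (copy_space e) (copy_op e (blinfun_apply X)) F"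
    then obtain Y where Y: "F = copy_op e Y"
      using bounded_ops_copyE by blast
    have "?Q hilbert_UNIV (blinfun_apply X) Y"
      using F unfolding Y Q .
    then have "Y = blinfun_apply (op_fun f X)"
      using ex1 QX by blast
    with Y show "F = copy_op e (blinfun_apply (op_fun f X))" by simp
  qed
qed

lemma operator_monotone_op_fun:
  fixes X Y :: "'v \<Rightarrow>\<^sub>L 'v"
  assumes f: "operator_monotone TYPE('u) {0<..} f"
    and X: "strictly_positive X" and Y: "strictly_positive Y" and le: "X \<preceq> Y"
  shows "op_fun f X \<preceq> op_fun f Y"
proof -
  obtain a b where ab: "0 < a" "a \<le> b" "hermitian_between a b X"
    using X by (rule strictly_positiveE)
  obtain c d where cd: "0 < c" "c \<le> d" "hermitian_between c d Y"
    using Y by (rule strictly_positiveE)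
  have cont: "continuous_on {0<..} f"
    using f by (simp add: operator_monotone_def)
  have cont_ab: "continuous_on {a..b} f"
    using cont by (rule continuous_on_subset) (use ab in auto)
  have cont_cd: "continuous_on {c..d} f"
    using cont by (rule continuous_on_subset) (use cd in auto)
  let ?X = "copy_op e (blinfun_apply X)" and ?Y = "copy_op e (blinfun_apply Y)"
  have "self_adjoint (copy_space e) ?X" "self_adjoint (copy_space e) ?Y"
    using ab(3) cd(3) by (simp_all add: self_adjoint_copy self_adjoint_UNIV_iff hermitian_between_hermitian)
  moreover have "spectrum (copy_space e) ?X \<subseteq> complex_of_real ` {0<..}"
    unfolding spectrum_copy
    by (rule order_trans[OF spectrum_hermitian_between[OF ab(3)] image_mono]) (use ab(1) in auto)
  moreover have "spectrum (copy_space e) ?Y \<subseteq> complex_of_real ` {0<..}"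
    unfolding spectrum_copy
    by (rule order_trans[OF spectrum_hermitian_between[OF cd(3)] image_mono]) (use cd(1) in auto)
  moreover have "loewner_le (copy_space e) ?X ?Y"
    using le by (simp add: loewner_le_copy op_le_def)
  ultimately have "loewner_le (copy_space e) (fun_calc (copy_space e) f ?X) (fun_calc (copy_space e) f ?Y)"
    using f complex_hilbert_space_copy unfolding operator_monotone_def by blast
  then show ?thesis
    by (simp add: fun_calc_copy[OF ab(3) cont_ab] fun_calc_copy[OF cd(3) cont_cd] loewner_le_copy op_le_def)
qed

end

text \<open>
  A pair is recorded by a function that takes the values 1 and 2 at its components, or the value 3 if they
  coincide, and 0 elsewhere. The construction works for every set, finite ones included.
\<close>

lemma ex_inj_pair_to_function:
  "\<exists>e :: 'h \<times> 'h \<Rightarrow> ('h \<Rightarrow> complex). inj e"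
proof -
  define e :: "'h \<times> 'h \<Rightarrow> ('h \<Rightarrow> complex)"
    where "e = (\<lambda>(x, y) z. (if z = x then 1 else 0) + (if z = y then 2 else 0))"
  have "x = x' \<and> y = y'" if eq: "e (x, y) = e (x', y')" for x y x' y'
    using fun_cong[OF eq, of x] fun_cong[OF eq, of y] by (auto simp: e_def split: if_splits)
  then have "inj e"
    by (intro injI) auto
  then show ?thesis by blast
qed

section \<open>The operator Jensen inequality\<close>

instantiation prod :: (chilbert_space, chilbert_space) chilbert_space
begin

definition scaleC_prod :: "complex \<Rightarrow> 'a \<times> 'b \<Rightarrow> 'a \<times> 'b" where
  "scaleC_prod c p = (c *\<^sub>C fst p, c *\<^sub>C snd p)"

definition cinner_prod :: "'a \<times> 'b \<Rightarrow> 'a \<times> 'b \<Rightarrow> complex" where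
  "cinner_prod p q = cinner (fst p) (fst q) + cinner (snd p) (snd q)"

instance
  by standard
    (auto simp: scaleC_prod_def cinner_prod_def scaleC_add_right scaleC_add_left scaleC_scaleC
      scaleC_of_real cinner_add_left cinner_scaleC_left cinner_self norm_prod_def algebra_simps
      prod_eq_iff cinner_commute[symmetric])

end

text \<open>
  The operator \<open>Y\<close> in the proof replaces the usual unitary dilation of \<open>V\<close>. It dominates \<open>X\<close> because the cross terms
  of the form of \<open>X\<close> between the range of \<open>V\<close> and its complement can be absorbed into the diagonal terms, at the
  price of the factor \<open>1 + e\<close> on the range of \<open>V\<close> and a large multiple \<open>l\<close> of the identity on the complement. The
  hypotheses \<open>adj\<close> and \<open>iso\<close> say that \<open>W\<close> is the adjoint of \<open>V\<close> and that \<open>V\<close> is isometric.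
\<close>

lemma operator_Jensen:
  fixes X :: "'v::chilbert_space \<Rightarrow>\<^sub>L 'v" and V :: "'h::chilbert_space \<Rightarrow>\<^sub>L 'v" and W :: "'v \<Rightarrow>\<^sub>L 'h"
  assumes mono: "\<And>X Y :: 'v \<Rightarrow>\<^sub>L 'v. strictly_positive X \<Longrightarrow> strictly_positive Y \<Longrightarrow> X \<preceq> Y \<Longrightarrow>
      op_fun f X \<preceq> op_fun f Y"
    and f: "continuous_on {0<..} f" and X: "strictly_positive X"
    and adj: "\<And>x y. cinner (V x) y = cinner x (W y)" and iso: "\<And>x. W (V x) = x"
  shows "Re (cinner (op_fun f X (V x)) (V x)) \<le> Re (cinner (op_fun f (W o\<^sub>L X o\<^sub>L V) x) x)"
proof -
  obtain a b where ab: "0 < a" "a \<le> b" "hermitian_between a b X"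
    using X by (rule strictly_positiveE)
  have herm: "hermitian X" using ab(3) by (rule hermitian_between_hermitian)
  have Xbd: "a * (norm y)\<^sup>2 \<le> Re (cinner (X y) y)" "Re (cinner (X y) y) \<le> b * (norm y)\<^sup>2" for y
    using ab(3) by (auto simp: hermitian_between_def)
  have adj': "cinner (W y) x = cinner y (V x)" for x y
    using adj[of x y] by (metis cinner_commute)
  have normV: "norm (V x) = norm x" for x
  proof -
    have "cinner (V x) (V x) = cinner x x" by (simp add: adj iso)
    then have "(norm (V x))\<^sup>2 = (norm x)\<^sup>2" by (metis Re_cinner_self)
    then show ?thesis by simp
  qed
  define Z where "Z = W o\<^sub>L X o\<^sub>L V"
  have Z: "hermitian_between a b Z"
    using Xbd[of "V x" for x] herm
    by (auto simp: hermitian_between_def Z_def adj' is_adjoint_def normV adj)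
  have Zpos: "strictly_positive (c *\<^sub>R Z)" if "0 < c" for c
  proof -
    have "hermitian_between (c * a) (c * b) (c *\<^sub>R Z)"
      using Z that by (auto simp: hermitian_between_def is_adjoint_def blinfun.bilinear_simps
          cinner_simps mult.assoc)
    moreover have "0 < c * a" using that ab by simp
    ultimately show ?thesis unfolding strictly_positive_iff by blast
  qed
  have main: "Re (cinner (op_fun f X (V x)) (V x)) \<le> Re (cinner (op_fun f ((1 + e) *\<^sub>R Z) x) x)"
    if e: "0 < e" for e
  proof -
    define l where "l = (1 + 1 / e) * b"
    define Y where "Y = (V o\<^sub>L (1 + e) *\<^sub>R Z o\<^sub>L W) + l *\<^sub>R (id_blinfun - (V o\<^sub>L W))"
    have Yherm: "hermitian Y"
      using hermitian_between_hermitian[OF Z]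
      by (simp add: is_adjoint_def Y_def blinfun.bilinear_simps cinner_simps adj adj')
    have XY: "Re (cinner (X w) w) \<le> Re (cinner (Y w) w)" for w
    proof -
      define u where "u = V (W w)"
      define w' where "w' = w - u"
      have w: "w = u + w'" by (simp add: w'_def)
      have "Re (cinner (X w) w) = Re (cinner (X u) u) + 2 * Re (cinner (X u) w') + Re (cinner (X w') w')"
        using hermitianD[OF herm, of w' u] cinner_commute[of "X u" w']
        by (simp add: w blinfun.add_right cinner_simps)
      moreover have "2 * Re (cinner (X u) w') \<le> e * Re (cinner (X u) u) + 1 / e * Re (cinner (X w') w')"
      proof -
        define s where "s = sqrt e"
        have s: "0 < s" "s * s = e" "1 / s * (1 / s) = 1 / e"
          using e by (simp_all add: s_def)
        \<comment> \<open>Expanding \<open>0 \<le> \<langle>X z, z\<rangle>\<close> at this \<open>z\<close> bounds the cross term by the diagonal terms with weights \<open>e\<close> and \<open>1 / e\<close>.\<close>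
        define z where "z = s *\<^sub>R u - (1 / s) *\<^sub>R w'"
        have "0 \<le> Re (cinner (X z) z)"
          using Xbd(1)[of z] ab(1) by (meson mult_nonneg_nonneg less_imp_le order_trans zero_le_power2)
        also have "Re (cinner (X z) z) = s * s * Re (cinner (X u) u) - 2 * Re (cinner (X u) w')
            + 1 / s * (1 / s) * Re (cinner (X w') w')"
          using hermitianD[OF herm, of w' u] cinner_commute[of w' "X u"] s(1)
          by (simp add: z_def blinfun.bilinear_simps cinner_simps algebra_simps)
        finally show ?thesis unfolding s(2,3) by simp
      qed
      moreover have "(1 + 1 / e) * Re (cinner (X w') w') \<le> l * (norm w')\<^sup>2"
        unfolding l_def mult.assoc using Xbd(2)[of w'] e by (intro mult_left_mono) auto
      moreover have "Re (cinner (Y w) w) = (1 + e) * Re (cinner (X u) u) + l * (norm w')\<^sup>2"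
      proof -
        have "cinner (Y w) w = (1 + e) *\<^sub>R cinner (X u) u + l *\<^sub>R cinner w' w"
          by (simp add: Y_def Z_def u_def w'_def blinfun.bilinear_simps adj adj' cinner_simps)
        moreover have "cinner w' u = 0"
          by (simp add: w'_def u_def blinfun.diff_right iso flip: adj')
        then have "cinner w' w = cinner w' w'"
          by (simp add: w cinner_simps)
        ultimately show ?thesis by simp
      qed
      ultimately show ?thesis
        by (simp add: distrib_right)
    qed
    have Ybd: "hermitian_between a (norm Y) Y"
      unfolding hermitian_between_def
      using Yherm XY Xbd(1) Re_cinner_le[of Y] by (meson abs_le_D1 order_trans)
    then have Ypos: "strictly_positive Y"
      using ab(1) strictly_positive_iff by blast
    \<comment> \<open>A common interval for \<open>Y\<close> and \<open>(1 + e) Z\<close>, as intertwining requires.\<close>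
    define m where "m = max (norm Y) ((1 + e) * b)"
    have Yab: "hermitian_between a m Y"
      using Ybd by (rule hermitian_between_mono) (auto simp: m_def)
    have Zab: "hermitian_between a m ((1 + e) *\<^sub>R Z)"
    proof -
      have "a \<le> (1 + e) * a" using ab e by simp
      moreover have "hermitian_between ((1 + e) * a) ((1 + e) * b) ((1 + e) *\<^sub>R Z)"
        using Z e by (auto simp: hermitian_between_def is_adjoint_def blinfun.bilinear_simps
            cinner_simps mult.assoc simp del: distrib_right_numeral)
      ultimately show ?thesis
        by (auto simp: m_def elim: hermitian_between_mono)
    qed
    have "Y o\<^sub>L V = V o\<^sub>L ((1 + e) *\<^sub>R Z)"
      by (rule blinfun_eqI) (simp add: Y_def blinfun.bilinear_simps iso)
    moreover have "continuous_on {a..m} f"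
      using f by (rule continuous_on_subset) (use ab in auto)
    ultimately have "op_fun f Y o\<^sub>L V = V o\<^sub>L op_fun f ((1 + e) *\<^sub>R Z)"
      by (intro op_fun_intertwine[OF Yab Zab])
    then have "op_fun f Y (V x) = V (op_fun f ((1 + e) *\<^sub>R Z) x)"
      by (metis blinfun_apply_blinfun_compose)
    then have "cinner (op_fun f Y (V x)) (V x) = cinner (op_fun f ((1 + e) *\<^sub>R Z) x) x"
      by (simp add: adj iso)
    moreover have "op_fun f X \<preceq> op_fun f Y"
      using mono[OF X Ypos] XY herm Yherm by (simp add: op_le_iff)
    ultimately show ?thesis
      unfolding op_le_iff by metis
  qed
  have "(\<lambda>n. op_fun f ((1 + 1 / real (Suc n)) *\<^sub>R Z)) \<longlonglongrightarrow> op_fun f Z"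
  proof (rule tendsto_op_fun_strictly_positive[OF _ _ _ f])
    have "(\<lambda>n. (1 + 1 / real (Suc n)) *\<^sub>R Z) \<longlonglongrightarrow> (1 + 0) *\<^sub>R Z"
      by (intro tendsto_intros LIMSEQ_Suc[OF lim_1_over_n])
    then show "(\<lambda>n. (1 + 1 / real (Suc n)) *\<^sub>R Z) \<longlonglongrightarrow> Z" by simp
    show "strictly_positive ((1 + 1 / real (Suc n)) *\<^sub>R Z)" for n
      by (rule Zpos) (simp add: add_pos_nonneg)
    show "strictly_positive Z" using Zpos[of 1] by simp
  qed
  then have "(\<lambda>n. Re (cinner (op_fun f ((1 + 1 / real (Suc n)) *\<^sub>R Z) x) x)) \<longlonglongrightarrow>
      Re (cinner (op_fun f Z x) x)"
    by (intro tendsto_intros)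
  then show ?thesis
    unfolding Z_def[symmetric] by (rule LIMSEQ_le_const) (auto intro!: exI[of _ 0] main)
qed


section \<open>The operator perspective\<close>

definition diagonal_op :: "('h::chilbert_space \<Rightarrow>\<^sub>L 'h) \<Rightarrow> ('h \<Rightarrow>\<^sub>L 'h) \<Rightarrow> (('h \<times> 'h) \<Rightarrow>\<^sub>L ('h \<times> 'h))" where
  "diagonal_op X Y = Blinfun (\<lambda>p. (X (fst p), Y (snd p)))"

lemma diagonal_op_apply [simp]: "diagonal_op X Y p = (X (fst p), Y (snd p))"
proof -
  have "bounded_linear (\<lambda>p. (X (fst p), Y (snd p)))"
    by (intro bounded_linear_Pair bounded_linear_compose[OF blinfun.bounded_linear_right]
        bounded_linear_fst bounded_linear_snd)
  then show ?thesis by (simp add: diagonal_op_def bounded_linear_Blinfun_apply)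
qed

lemma strictly_positive_diagonal_op:
  assumes "strictly_positive X" "strictly_positive Y"
  shows "strictly_positive (diagonal_op X Y)"
proof -
  obtain a b where ab: "0 < a" "hermitian_between a b X"
    using assms(1) by (rule strictly_positiveE)
  obtain c d where cd: "0 < c" "hermitian_between c d Y"
    using assms(2) by (rule strictly_positiveE)
  define m M where "m = min a c" and "M = max b d"
  have "hermitian_between m M X" "hermitian_between m M Y"
    using ab(2) cd(2) by (auto simp: m_def M_def elim: hermitian_between_mono)
  then have "hermitian_between m M (diagonal_op X Y)"
    by (auto simp: hermitian_between_def is_adjoint_def cinner_prod_def norm_prod_def distrib_left
        intro: add_mono)
  moreover have "0 < m" using ab cd by (simp add: m_def)
  ultimately show ?thesis unfolding strictly_positive_iff by blast
qed

text \<open>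
  The coordinate projections intertwine the diagonal operator with its entries.
\<close>

lemma op_fun_diagonal_op:
  assumes X: "strictly_positive X" and Y: "strictly_positive Y" and f: "continuous_on {0<..} f"
  shows "op_fun f (diagonal_op X Y) = diagonal_op (op_fun f X) (op_fun f Y)"
proof -
  obtain a b where ab: "0 < a" "hermitian_between a b X"
    using X by (rule strictly_positiveE)
  obtain c d where cd: "0 < c" "hermitian_between c d Y"
    using Y by (rule strictly_positiveE)
  obtain r s where rs: "0 < r" "hermitian_between r s (diagonal_op X Y)"
    using strictly_positive_diagonal_op[OF X Y] by (rule strictly_positiveE)
  define m M where "m = min (min a c) r" and "M = max (max b d) s"
  have bds: "hermitian_between m M X" "hermitian_between m M Y" "hermitian_between m M (diagonal_op X Y)"
    using ab(2) cd(2) rs(2) by (auto simp: m_def M_def elim: hermitian_between_mono)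
  have cont: "continuous_on {m..M} f"
    using f by (rule continuous_on_subset) (use ab cd rs in \<open>auto simp: m_def\<close>)
  have fst: "blinfun_apply (Blinfun fst) = fst" and snd: "blinfun_apply (Blinfun snd) = snd"
    by (auto intro!: bounded_linear_Blinfun_apply bounded_linear_fst bounded_linear_snd)
  have "op_fun f X o\<^sub>L Blinfun fst = Blinfun fst o\<^sub>L op_fun f (diagonal_op X Y)"
    by (rule op_fun_intertwine[OF bds(1,3) cont]) (auto intro!: blinfun_eqI simp: fst)
  moreover have "op_fun f Y o\<^sub>L Blinfun snd = Blinfun snd o\<^sub>L op_fun f (diagonal_op X Y)"
    by (rule op_fun_intertwine[OF bds(2,3) cont]) (auto intro!: blinfun_eqI simp: snd)
  ultimately have "op_fun f X (fst p) = fst (op_fun f (diagonal_op X Y) p)"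
      "op_fun f Y (snd p) = snd (op_fun f (diagonal_op X Y) p)" for p
    by (metis blinfun_apply_blinfun_compose fst) (metis \<open>_ = Blinfun snd o\<^sub>L _\<close> blinfun_apply_blinfun_compose snd)
  then show ?thesis
    by (intro blinfun_eqI) (simp add: prod_eq_iff)
qed

lemma cinner_rel_entropy0:
  assumes "strictly_positive A"
  shows "cinner (rel_entropy0 f A C x) y =
    cinner (op_fun f (op_powr A (-1/2) o\<^sub>L C o\<^sub>L op_powr A (-1/2)) (op_powr A (1/2) x)) (op_powr A (1/2) y)"
  using hermitian_op_powr[OF assms, of "1/2"] by (simp add: rel_entropy0_def is_adjoint_def)

lemma strictly_positive_entropy_argument:
  assumes A: "strictly_positive A" and C: "strictly_positive C"
  shows "strictly_positive (op_powr A (-1/2) o\<^sub>L C o\<^sub>L op_powr A (-1/2))"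
  by (rule strictly_positive_congruence[OF C hermitian_op_powr[OF A], where S = "op_powr A (1/2)"])
    (rule op_powr_apply(2)[OF A])

lemma hermitian_rel_entropy0:
  assumes A: "strictly_positive A" and C: "strictly_positive C" and f: "continuous_on {0<..} f"
  shows "hermitian (rel_entropy0 f A C)"
proof -
  obtain a b where ab: "0 < a" "hermitian_between a b (op_powr A (-1/2) o\<^sub>L C o\<^sub>L op_powr A (-1/2))"
    using strictly_positive_entropy_argument[OF A C] by (rule strictly_positiveE)
  have "continuous_on {a..b} f"
    using f by (rule continuous_on_subset) (use ab in auto)
  from hermitian_op_fun[OF ab(2) this] show ?thesis
    using hermitian_op_powr[OF A, of "1/2"] by (simp add: is_adjoint_def rel_entropy0_def)
qed

lemma rel_entropy0_nonneg:
  assumes A: "strictly_positive A" and C: "strictly_positive C" and f: "continuous_on {0<..} f"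
    and nonneg: "\<And>t. 0 < t \<Longrightarrow> 0 \<le> f t"
  shows "0 \<le> Re (cinner (rel_entropy0 f A C x) x)"
proof -
  obtain a b where ab: "0 < a" "hermitian_between a b (op_powr A (-1/2) o\<^sub>L C o\<^sub>L op_powr A (-1/2))"
    using strictly_positive_entropy_argument[OF A C] by (rule strictly_positiveE)
  have "continuous_on {a..b} f"
    using f by (rule continuous_on_subset) (use ab in auto)
  from op_fun_nonneg[OF ab(2) this] show ?thesis
    unfolding cinner_rel_entropy0[OF A] using ab(1) nonneg by simp
qed

text \<open>
  The argument of \<open>f\<close> is the identity. This is the normalisation that turns superadditivity into a norm bound.
\<close>

lemma rel_entropy0_same:
  assumes A: "strictly_positive A"
  shows "rel_entropy0 f A A = f 1 *\<^sub>R A"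
proof -
  note cancelA = op_powr_apply[OF A, simplified]
  have "op_powr A (-1/2) (A (op_powr A (-1/2) x)) = x" for x
    using cancelA by (simp flip: cancelA(1))
  then have "op_powr A (-1/2) o\<^sub>L A o\<^sub>L op_powr A (-1/2) = id_blinfun"
    by (intro blinfun_eqI) simp
  then show ?thesis
    unfolding rel_entropy0_def
    by (intro blinfun_eqI) (simp add: op_fun_id_blinfun blinfun.bilinear_simps cancelA)
qed

text \<open>
  Jensen's inequality for the isometry with components \<open>A\<^sup>1\<^sup>/\<^sup>2 (A+B)\<^sup>-\<^sup>1\<^sup>/\<^sup>2\<close> and \<open>B\<^sup>1\<^sup>/\<^sup>2 (A+B)\<^sup>-\<^sup>1\<^sup>/\<^sup>2\<close>, taken at the
  vector \<open>(A+B)\<^sup>1\<^sup>/\<^sup>2 x\<close>, which the isometry maps to \<open>(A\<^sup>1\<^sup>/\<^sup>2 x, B\<^sup>1\<^sup>/\<^sup>2 x)\<close>.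
\<close>

lemma rel_entropy0_superadditive:
  fixes A B C D :: "'h::chilbert_space \<Rightarrow>\<^sub>L 'h"
  assumes f: "operator_monotone TYPE('h \<Rightarrow> complex) {0<..} f"
    and A: "strictly_positive A" and B: "strictly_positive B"
    and C: "strictly_positive C" and D: "strictly_positive D"
  shows "Re (cinner (rel_entropy0 f A C x) x) + Re (cinner (rel_entropy0 f B D x) x)
    \<le> Re (cinner (rel_entropy0 f (A + B) (C + D) x) x)"
proof -
  have cont: "continuous_on {0<..} f"
    using f by (simp add: operator_monotone_def)
  obtain e :: "'h \<times> 'h \<Rightarrow> ('h \<Rightarrow> complex)" where e: "inj e"
    using ex_inj_pair_to_function by blast
  note AB = strictly_positive_add[OF A B]
  note cancelA = op_powr_apply[OF A, simplified] and cancelB = op_powr_apply[OF B, simplified]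
    and cancelAB = op_powr_apply[OF AB, simplified]
  let ?A = "op_powr A (1/2)" and ?A' = "op_powr A (-1/2)"
    and ?B = "op_powr B (1/2)" and ?B' = "op_powr B (-1/2)"
    and ?E = "op_powr (A + B) (1/2)" and ?E' = "op_powr (A + B) (-1/2)"
  define X where "X = ?A' o\<^sub>L C o\<^sub>L ?A'"
  define Y where "Y = ?B' o\<^sub>L D o\<^sub>L ?B'"
  have X: "strictly_positive X" and Y: "strictly_positive Y"
    unfolding X_def Y_def by (intro strictly_positive_entropy_argument A B C D)+
  have herm: "hermitian ?A" "hermitian ?B" "hermitian ?E'"
    using A B AB by (simp_all add: hermitian_op_powr)
  define V :: "'h \<Rightarrow>\<^sub>L ('h \<times> 'h)" where "V = Blinfun (\<lambda>x. (?A (?E' x), ?B (?E' x)))"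
  define W :: "('h \<times> 'h) \<Rightarrow>\<^sub>L 'h" where "W = Blinfun (\<lambda>p. ?E' (?A (fst p)) + ?E' (?B (snd p)))"
  have V: "V x = (?A (?E' x), ?B (?E' x))" for x
  proof -
    have "bounded_linear (\<lambda>x. (?A (?E' x), ?B (?E' x)))"
      by (intro bounded_linear_Pair bounded_linear_compose[OF blinfun.bounded_linear_right]
          bounded_linear_ident)
    then show ?thesis by (simp add: V_def bounded_linear_Blinfun_apply)
  qed
  have W: "W p = ?E' (?A (fst p)) + ?E' (?B (snd p))" for p
  proof -
    have "bounded_linear (\<lambda>p. ?E' (?A (fst p)) + ?E' (?B (snd p)))"
      by (intro bounded_linear_add bounded_linear_compose[OF blinfun.bounded_linear_right]
          bounded_linear_fst bounded_linear_snd)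
    then show ?thesis by (simp add: W_def bounded_linear_Blinfun_apply)
  qed
  have adj: "cinner (V x) p = cinner x (W p)" for x p
    using herm by (simp add: V W cinner_prod_def is_adjoint_def cinner_simps)
  have iso: "W (V x) = x" for x
  proof -
    have "W (V x) = ?E' ((A + B) (?E' x))"
      by (simp add: V W cancelA cancelB blinfun.bilinear_simps)
    also have "\<dots> = x"
      using cancelAB by simp metis
    finally show ?thesis .
  qed
  have WXV: "W o\<^sub>L diagonal_op X Y o\<^sub>L V = ?E' o\<^sub>L (C + D) o\<^sub>L ?E'"
    by (rule blinfun_eqI)
      (simp add: V W X_def Y_def cancelA cancelB blinfun.bilinear_simps)
  have "Re (cinner (op_fun f (diagonal_op X Y) (V (?E x))) (V (?E x)))
      \<le> Re (cinner (op_fun f (W o\<^sub>L diagonal_op X Y o\<^sub>L V) (?E x)) (?E x))"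
    by (rule operator_Jensen[OF operator_monotone_op_fun[OF e f] cont
          strictly_positive_diagonal_op[OF X Y] adj iso])
  moreover have "V (?E x) = (?A x, ?B x)"
    by (simp add: V cancelAB)
  ultimately show ?thesis
    unfolding WXV op_fun_diagonal_op[OF X Y cont] cinner_rel_entropy0[OF A] cinner_rel_entropy0[OF B]
      cinner_rel_entropy0[OF AB] X_def[symmetric] Y_def[symmetric]
    by (simp add: cinner_prod_def)
qed

text \<open>
  The chain \<open>0 \<preceq> S(A|C) \<preceq> S(A|C) + S(C|A) \<preceq> S(A+C|C+A) = f(1) (A+C)\<close>. Nonnegativity of \<open>f\<close> enters in the first two
  steps.
\<close>

lemma norm_rel_entropy0_le:
  fixes A C :: "'h::chilbert_space \<Rightarrow>\<^sub>L 'h"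
  assumes f: "operator_monotone TYPE('h \<Rightarrow> complex) {0<..} f"
    and nonneg: "\<And>t. 0 < t \<Longrightarrow> 0 \<le> f t"
    and A: "strictly_positive A" and C: "strictly_positive C"
  shows "norm (rel_entropy0 f A C) \<le> f 1 * (norm A + norm C)"
proof -
  have cont: "continuous_on {0<..} f"
    using f by (simp add: operator_monotone_def)
  have "Re (cinner (rel_entropy0 f A C x) x) \<le> f 1 * norm (A + C) * (norm x)\<^sup>2" for x
  proof -
    have "Re (cinner (rel_entropy0 f A C x) x) \<le>
        Re (cinner (rel_entropy0 f A C x) x) + Re (cinner (rel_entropy0 f C A x) x)"
      using rel_entropy0_nonneg[OF C A cont nonneg] by simp
    also have "\<dots> \<le> Re (cinner (rel_entropy0 f (A + C) (A + C) x) x)"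
      using rel_entropy0_superadditive[OF f A C C A] by (simp add: add.commute)
    also have "\<dots> = f 1 * Re (cinner ((A + C) x) x)"
      unfolding rel_entropy0_same[OF strictly_positive_add[OF A C]]
      by (simp add: blinfun.scaleR_left cinner_simps)
    also have "\<dots> \<le> f 1 * (norm (A + C) * (norm x)\<^sup>2)"
      using Re_cinner_le[of "A + C" x] nonneg[of 1] by (intro mult_left_mono) auto
    finally show ?thesis by (simp add: mult.assoc)
  qed
  then have "hermitian_between 0 (f 1 * norm (A + C)) (rel_entropy0 f A C)"
    using hermitian_rel_entropy0[OF A C cont] rel_entropy0_nonneg[OF A C cont nonneg]
    by (simp add: hermitian_between_def)
  then have "norm (rel_entropy0 f A C) \<le> f 1 * norm (A + C)"
    using norm_le_if_hermitian_between nonneg[of 1] by fastforce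
  also have "\<dots> \<le> f 1 * (norm A + norm C)"
    using nonneg[of 1] by (intro mult_left_mono norm_triangle_ineq) auto
  finally show ?thesis .
qed

text \<open>
  Square roots, inverse square roots and \<open>f\<close> are all continuous on strictly positive operators.
\<close>

lemma tendsto_rel_entropy0:
  assumes "(A \<longlongrightarrow> A0) F" "(C \<longlongrightarrow> C0) F"
    and "\<And>s. strictly_positive (A s)" "\<And>s. strictly_positive (C s)"
    and "strictly_positive A0" "strictly_positive C0"
    and f: "continuous_on {0<..} f"
  shows "((\<lambda>s. rel_entropy0 f (A s) (C s)) \<longlongrightarrow> rel_entropy0 f A0 C0) F"
proof -
  have powr: "((\<lambda>s. op_powr (A s) r) \<longlongrightarrow> op_powr A0 r) F" for r
    unfolding op_powr_def
    by (intro tendsto_op_fun_strictly_positive assms continuous_on_powr continuous_on_id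
        continuous_on_const) auto
  note compose = bounded_bilinear.tendsto[OF bounded_bilinear_blinfun_compose]
  show ?thesis
    unfolding rel_entropy0_def
    by (intro compose powr tendsto_op_fun_strictly_positive f assms strictly_positive_entropy_argument)
qed

section \<open>Integrating continuous fields\<close>

lemma radon_measure_sets: "radon_measure M \<Longrightarrow> sets M = sets borel"
  unfolding radon_measure_def by (rule conjunct1)

lemma radon_measure_space: "radon_measure M \<Longrightarrow> space M = UNIV"
  using sets_eq_imp_space_eq[OF radon_measure_sets, of M] by simp

lemma radon_measure_compact:
  assumes "radon_measure M" "compact C"
  shows "emeasure M C < \<infinity>"
proof -
  have "\<forall>C. compact C \<longrightarrow> emeasure M C < \<infinity>"
    using assms(1) unfolding radon_measure_def by (elim conjE)
  with assms(2) show ?thesis by blast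
qed

lemma radon_measure_open:
  assumes "radon_measure M" "open U"
  shows "emeasure M U = (SUP C\<in>{C. compact C \<and> C \<subseteq> U}. emeasure M C)"
proof -
  have "\<forall>U. open U \<longrightarrow> emeasure M U = (SUP C\<in>{C. compact C \<and> C \<subseteq> U}. emeasure M C)"
    using assms(1) unfolding radon_measure_def by (elim conjE)
  with assms(2) show ?thesis by blast
qed

lemma radon_measure_continuous_measurable:
  fixes g :: "'t::t2_space \<Rightarrow> 'a::topological_space"
  assumes "radon_measure M" "continuous_on UNIV g"
  shows "g \<in> borel_measurable M"
  using borel_measurable_continuous_onI[OF assms(2)] measurable_cong_sets[OF radon_measure_sets[OF assms(1)] refl]
  by blast

text \<open>
  The supremum in inner regularity is the limit along a sequence of compact sets; as the measure of \<open>U\<close> is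
  finite, nothing but a null set remains outside their union.
\<close>

lemma radon_measure_exhaust_open:
  fixes M :: "'t::t2_space measure"
  assumes M: "radon_measure M" and U: "open U" and fin: "emeasure M U < \<infinity>"
  obtains K where "\<And>k::nat. compact (K k)" "U - (\<Union>k. K k) \<in> null_sets M"
proof -
  let ?C = "{C. compact C \<and> C \<subseteq> U}"
  have sup: "emeasure M U = (SUP C\<in>?C. emeasure M C)"
    by (rule radon_measure_open[OF M U])
  have "emeasure M ` ?C \<noteq> {}" by auto
  from ennreal_Sup_countable_SUP[OF this]
  obtain g :: "nat \<Rightarrow> ennreal" where g: "range g \<subseteq> emeasure M ` ?C" "emeasure M U = (SUP k. g k)"
    unfolding sup by auto
  then have "\<exists>C. compact C \<and> C \<subseteq> U \<and> g k = emeasure M C" for k by blast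
  then obtain K where K: "\<And>k. compact (K k)" "\<And>k. K k \<subseteq> U" "\<And>k. g k = emeasure M (K k)"
    by metis
  have meas: "U \<in> sets M" "\<And>k. K k \<in> sets M"
    using U K(1) by (auto simp: radon_measure_sets[OF M] compact_imp_closed)
  have KU: "(\<Union>k. K k) \<in> sets M" using meas by auto
  have "emeasure M U \<le> emeasure M (\<Union>k. K k)"
    unfolding g(2) using KU by (intro SUP_least) (auto simp: K(3) intro!: emeasure_mono)
  moreover have sub: "(\<Union>k. K k) \<subseteq> U" using K(2) by blast
  moreover have "emeasure M (\<Union>k. K k) \<le> emeasure M U"
    using sub meas by (intro emeasure_mono) auto
  ultimately have "emeasure M (\<Union>k. K k) = emeasure M U" by simp
  then have "emeasure M (U - (\<Union>k. K k)) = 0"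
    using emeasure_Diff[OF _ meas(1) KU sub] fin by (simp add: less_top)
  then have "U - (\<Union>k. K k) \<in> null_sets M"
    using meas KU by auto
  with K(1) show thesis by (rule that)
qed

text \<open>
  The set where the field does not vanish is the union of the open sets \<open>{t. norm (F t) > 1/(n+1)}\<close>. These have
  finite measure by Markov's inequality, so each is exhausted by compact sets up to a null set.
\<close>

lemma continuous_field_sigma_compact_support:
  fixes M :: "'t::t2_space measure" and F :: "'t \<Rightarrow> 'b::real_normed_vector"
  assumes M: "radon_measure M" and F: "continuous_on UNIV F" and int: "integrable M (\<lambda>t. norm (F t))"
  shows "\<exists>L :: nat \<Rightarrow> 't set. incseq L \<and> (\<forall>n. compact (L n)) \<and>
    (AE t in M. t \<notin> (\<Union>n. L n) \<longrightarrow> F t = 0)"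
proof -
  define U where "U n = {t. inverse (real (Suc n)) < norm (F t)}" for n
  have cont: "continuous_on UNIV (\<lambda>t. norm (F t))"
    by (intro continuous_intros F)
  have opn: "open (U n)" for n
    unfolding U_def by (intro open_Collect_less cont continuous_on_const)
  have fin: "emeasure M (U n) < \<infinity>" for n
  proof -
    have "emeasure M (U n) \<le> emeasure M {t \<in> space M. inverse (real (Suc n)) \<le> norm (F t)}"
    proof (rule emeasure_mono)
      have "closed {t. inverse (real (Suc n)) \<le> norm (F t)}"
        by (intro closed_Collect_le cont continuous_on_const)
      then show "{t \<in> space M. inverse (real (Suc n)) \<le> norm (F t)} \<in> sets M"
        by (simp add: radon_measure_sets[OF M] radon_measure_space[OF M])
    qed (auto simp: U_def radon_measure_space[OF M])
    also have "\<dots> \<le> ennreal (1 / inverse (real (Suc n)) * (\<integral>t. norm (F t) \<partial>M))"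
      by (rule integral_Markov_inequality[OF int]) auto
    also have "\<dots> < \<infinity>" by simp
    finally show ?thesis .
  qed
  have "\<exists>K. (\<forall>k::nat. compact (K k)) \<and> U n - (\<Union>k. K k) \<in> null_sets M" for n
    using radon_measure_exhaust_open[OF M opn fin] by metis
  then obtain K where K: "\<And>n k::nat. compact (K n k)" "\<And>n. U n - (\<Union>k. K n k) \<in> null_sets M"
    by metis
  define L where "L m = (\<Union>n\<le>m. \<Union>k\<le>m. K n k)" for m
  show ?thesis
  proof (intro exI conjI allI)
    show "incseq L" unfolding incseq_def L_def by fastforce
    show "compact (L m)" for m
      unfolding L_def by (intro compact_UN finite_atMost K)
    have "AE t in M. t \<notin> (\<Union>n. U n - (\<Union>k. K n k))"
      using K(2) by (intro AE_not_in null_sets_UN)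
    then show "AE t in M. t \<notin> (\<Union>n. L n) \<longrightarrow> F t = 0"
    proof eventually_elim
      case (elim t)
      show ?case
      proof (intro impI, rule ccontr)
        assume t: "t \<notin> (\<Union>n. L n)" and "F t \<noteq> 0"
        then obtain n where "inverse (real (Suc n)) < norm (F t)"
          using reals_Archimedean[of "norm (F t)"] by auto
        with elim obtain k where "t \<in> K n k"
          by (auto simp: U_def)
        then have "t \<in> L (max n k)"
          unfolding L_def by (intro UN_I[of n] UN_I[of k]) auto
        with t show False by blast
      qed
    qed
  qed
qed

text \<open>
  Finitely many of the open sets \<open>{t. norm (F s - F t) < d}\<close> cover \<open>K\<close>; making them disjoint keeps the
  oscillation small.
\<close>

lemma compact_partition_small_oscillation:
  fixes F :: "'t::t2_space \<Rightarrow> 'b::real_normed_vector"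
  assumes K: "compact K" and F: "continuous_on UNIV F" and d: "0 < d"
  shows "\<exists>(n :: nat) (D :: nat \<Rightarrow> 't set) (h :: nat \<Rightarrow> 't). (\<forall>i. D i \<in> sets borel) \<and>
    disjoint_family D \<and> K = (\<Union>i<n. D i) \<and> (\<forall>i<n. \<forall>t\<in>D i. norm (F (h i) - F t) < d)"
proof -
  let ?B = "\<lambda>s. {t. norm (F s - F t) < d}"
  have opn: "open (?B s)" for s
    by (intro open_Collect_less continuous_intros F)
  have "K \<subseteq> (\<Union>s\<in>K. ?B s)" using d by auto
  then obtain C where "C \<subseteq> K" and C: "finite C" "K \<subseteq> (\<Union>s\<in>C. ?B s)"
    by (rule compactE_image[OF K opn])
  obtain n :: nat and h where h: "C = h ` {i. i < n}"
    using finite_imp_nat_seg_image_inj_on[OF C(1)] by blast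
  define E where "E i = (if i < n then K \<inter> ?B (h i) else {})" for i
  have "K \<in> sets borel" using K by (simp add: compact_imp_closed)
  then have E: "E i \<in> sets borel" for i
    using opn[of "h i"] by (auto simp: E_def)
  show ?thesis
  proof (intro exI conjI allI ballI impI)
    show "disjointed E i \<in> sets borel" for i
      using sets.range_disjointed_sets[of E borel] E by blast
    show "disjoint_family (disjointed E)" by (rule disjoint_family_disjointed)
    have "(\<Union>i<n. disjointed E i) = (\<Union>i<n. E i)"
      using finite_UN_disjointed_eq[of E n] by (simp add: atLeast0LessThan)
    also have "\<dots> = K" using C(2) h by (auto simp: E_def)
    finally show "K = (\<Union>i<n. disjointed E i)" by simp
    show "norm (F (h i) - F t) < d" if "i < n" "t \<in> disjointed E i" for i t
      using that disjointed_subset[of E i] by (auto simp: E_def)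
  qed
qed

text \<open>
  A functional on \<open>S\<close> is a total function, with arbitrary values outside \<open>S\<close>, as in \<open>dual_space\<close>. The bound \<open>b\<close>
  is a parameter because the approximation below is uniform over all functionals with the same bound.
\<close>

definition bounded_functional_on :: "'b::real_normed_vector set \<Rightarrow> ('b \<Rightarrow> complex) \<Rightarrow> real \<Rightarrow> bool" where
  "bounded_functional_on S \<phi> b \<longleftrightarrow> 0 \<le> b \<and>
     (\<forall>X\<in>S. \<forall>Y\<in>S. \<phi> (X + Y) = \<phi> X + \<phi> Y) \<and> (\<forall>r. \<forall>X\<in>S. \<phi> (r *\<^sub>R X) = r *\<^sub>R \<phi> X) \<and>
     (\<forall>X\<in>S. cmod (\<phi> X) \<le> b * norm X)"

context
  fixes S :: "'b::real_normed_vector set" and \<phi> :: "'b \<Rightarrow> complex" and b :: real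
  assumes S: "subspace S" and \<phi>: "bounded_functional_on S \<phi> b"
begin

lemma bounded_functional_on_diff:
  assumes "X \<in> S" "Y \<in> S"
  shows "\<phi> (X - Y) = \<phi> X - \<phi> Y"
proof -
  have "\<phi> (X + (-1) *\<^sub>R Y) = \<phi> X + (-1) *\<^sub>R \<phi> Y"
    using \<phi> S assms subspace_scale[OF S, of Y "-1"] unfolding bounded_functional_on_def by metis
  then show ?thesis by simp
qed

lemma bounded_functional_on_diff_le:
  assumes "X \<in> S" "Y \<in> S"
  shows "cmod (\<phi> X - \<phi> Y) \<le> b * norm (X - Y)"
  using \<phi> subspace_diff[OF S assms] bounded_functional_on_diff[OF assms]
  unfolding bounded_functional_on_def by metis

lemma bounded_functional_on_sum:
  "finite I \<Longrightarrow> (\<And>i. i \<in> I \<Longrightarrow> X i \<in> S) \<Longrightarrow>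
    \<phi> (\<Sum>i\<in>I. r i *\<^sub>R X i) = (\<Sum>i\<in>I. r i *\<^sub>R \<phi> (X i))"
proof (induction rule: finite_induct)
  case empty
  show ?case
    using bounded_functional_on_diff[OF subspace_0[OF S] subspace_0[OF S]] by simp
next
  case (insert i I)
  have "(\<Sum>i\<in>I. r i *\<^sub>R X i) \<in> S" "r i *\<^sub>R X i \<in> S"
    using insert by (auto intro!: subspace_sum subspace_scale S)
  with insert \<phi> show ?case
    by (simp add: bounded_functional_on_def)
qed

lemma integrable_bounded_functional_on:
  fixes M :: "'t::t2_space measure"
  assumes M: "radon_measure M" and F: "continuous_on UNIV F" and FS: "\<And>t. F t \<in> S"
    and int: "integrable M (\<lambda>t. norm (F t))"
  shows "integrable M (\<lambda>t. \<phi> (F t))"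
proof (rule Bochner_Integration.integrable_bound)
  show "integrable M (\<lambda>t. b * norm (F t))" using int by simp
  have b: "0 \<le> b" using \<phi> by (simp add: bounded_functional_on_def)
  have "continuous_on UNIV (\<lambda>t. \<phi> (F t))"
    unfolding continuous_on_def
  proof
    fix s
    have "((\<lambda>t. F t) \<longlongrightarrow> F s) (at s within UNIV)"
      using F by (simp add: continuous_on_def)
    then have lim: "((\<lambda>t. b * norm (F t - F s)) \<longlongrightarrow> b * norm (F s - F s)) (at s within UNIV)"
      by (intro tendsto_intros)
    have "((\<lambda>t. \<phi> (F t) - \<phi> (F s)) \<longlongrightarrow> 0) (at s within UNIV)"
    proof (rule Lim_null_comparison)
      show "\<forall>\<^sub>F t in at s within UNIV. norm (\<phi> (F t) - \<phi> (F s)) \<le> b * norm (F t - F s)"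
        by (rule always_eventually) (simp add: bounded_functional_on_diff_le FS)
      show "((\<lambda>t. b * norm (F t - F s)) \<longlongrightarrow> 0) (at s within UNIV)"
        using lim by simp
    qed
    then show "((\<lambda>t. \<phi> (F t)) \<longlongrightarrow> \<phi> (F s)) (at s within UNIV)"
      by (simp add: LIM_zero_iff)
  qed
  then show "(\<lambda>t. \<phi> (F t)) \<in> borel_measurable M"
    by (rule radon_measure_continuous_measurable[OF M])
  show "AE t in M. norm (\<phi> (F t)) \<le> norm (b * norm (F t))"
    using \<phi> FS b by (auto simp: bounded_functional_on_def)
qed

end

text \<open>
  A Riemann sum \<open>Z\<close> over a partition of a compact set \<open>K\<close>. On \<open>K\<close> the error comes from the oscillation of \<open>F\<close> on the
  pieces, off \<open>K\<close> from the part of the integral of \<open>norm (F t)\<close> that is neglected; dominated convergence makes the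
  latter small. The same \<open>Z\<close> serves for all functionals, and therefore approximates the integral in norm.
\<close>

lemma approximate_integral:
  fixes M :: "'t::t2_space measure" and F :: "'t \<Rightarrow> 'b::real_normed_vector"
  assumes M: "radon_measure M" and S: "subspace S" and FS: "\<And>t. F t \<in> S"
    and F: "continuous_on UNIV F" and int: "integrable M (\<lambda>t. norm (F t))" and e: "0 < e"
  obtains Z where "Z \<in> S"
    "\<And>\<phi> b. bounded_functional_on S \<phi> b \<Longrightarrow> cmod (\<phi> Z - (LINT t|M. \<phi> (F t))) \<le> b * e"
proof -
  obtain L where L: "incseq L" "\<And>n::nat. compact (L n)" "AE t in M. t \<notin> (\<Union>n. L n) \<longrightarrow> F t = 0"
    using continuous_field_sigma_compact_support[OF M F int] by blast
  have Lmeas: "L n \<in> sets M" for n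
    using L(2) by (simp add: radon_measure_sets[OF M] compact_imp_closed)
  have [measurable]: "(\<lambda>t. norm (F t)) \<in> borel_measurable M"
    using int by (rule borel_measurable_integrable)
  have "(\<lambda>n. LINT t|M. norm (F t) * indicator (- L n) t) \<longlonglongrightarrow> (LINT t|M. 0)"
  proof (rule integral_dominated_convergence[where w = "\<lambda>t. norm (F t)"])
    have "- L n \<in> sets M" for n
      using sets.compl_sets[OF Lmeas[of n]] by (simp add: radon_measure_space[OF M] Compl_eq_Diff_UNIV)
    then show "(\<lambda>t. norm (F t) * indicator (- L n) t) \<in> borel_measurable M" for n
      by (intro borel_measurable_times borel_measurable_indicator) simp_all
    show "AE t in M. (\<lambda>n. norm (F t) * indicator (- L n) t) \<longlonglongrightarrow> 0"
      using L(3)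
    proof eventually_elim
      case (elim t)
      show ?case
      proof (cases "t \<in> (\<Union>n. L n)")
        case True
        then obtain N where "t \<in> L N" by blast
        then have "norm (F t) * indicator (- L n) t = 0" if "N \<le> n" for n
          using incseqD[OF L(1) that] by (auto simp: indicator_def)
        then show ?thesis
          by (intro tendsto_eventually) (auto simp: eventually_sequentially)
      qed (use elim in simp)
    qed
  qed (use int in \<open>auto simp: indicator_def\<close>)
  from LIMSEQ_D[OF this, of "e / 2"] e
  obtain n where "norm ((LINT t|M. norm (F t) * indicator (- L n) t) - (LINT t|M. 0)) < e / 2" by auto
  then have tail: "(LINT t|M. norm (F t) * indicator (- L n) t) < e / 2" by simp
  define K where "K = L n"
  have K: "compact K" "K \<in> sets M" "- K \<in> sets M"
    using L(2) Lmeas sets.compl_sets[OF Lmeas[of n]]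
    by (simp_all add: K_def radon_measure_space[OF M] Compl_eq_Diff_UNIV)
  have Kfin: "emeasure M K < \<infinity>" using M K(1) by (rule radon_measure_compact)
  define m where "m = measure M K"
  \<comment> \<open>The denominator contains \<open>m + 1\<close> since \<open>K\<close> may be a null set.\<close>
  define d where "d = e / (2 * (m + 1))"
  have m: "0 \<le> m" by (simp add: m_def)
  have d: "0 < d" using e m by (simp add: d_def)
  have dm: "d * m \<le> e / 2" using e m by (simp add: d_def field_simps)
  obtain N :: nat and D :: "nat \<Rightarrow> 't set" and h :: "nat \<Rightarrow> 't" where
    D: "\<forall>i. D i \<in> sets borel" "disjoint_family D" "K = (\<Union>i<N. D i)"
      "\<forall>i<N. \<forall>t\<in>D i. norm (F (h i) - F t) < d"
    using compact_partition_small_oscillation[OF K(1) F d] by blast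
  have Dmeas: "D i \<in> sets M" for i using D(1) by (simp add: radon_measure_sets[OF M])
  have Dfin: "emeasure M (D i) < \<infinity>" if "i < N" for i
  proof -
    have "emeasure M (D i) \<le> emeasure M K"
      using K(2) that by (intro emeasure_mono) (auto simp: D(3))
    with Kfin show ?thesis by (rule le_less_trans[rotated])
  qed
  define Z where "Z = (\<Sum>i<N. measure M (D i) *\<^sub>R F (h i))"
  show thesis
  proof (rule that)
    show "Z \<in> S"
      unfolding Z_def by (intro subspace_sum subspace_scale S FS)
    fix \<phi> b assume \<phi>: "bounded_functional_on S \<phi> b"
    have b: "0 \<le> b" using \<phi> by (simp add: bounded_functional_on_def)
    define G where "G t = (\<Sum>i<N. indicator (D i) t *\<^sub>R \<phi> (F (h i)))" for t
    have Gint1: "integrable M (\<lambda>t. indicator (D i) t *\<^sub>R \<phi> (F (h i)))" if "i < N" for i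
      using Dfin[OF that] Dmeas by (intro integrable_scaleR_left) (simp add: integrable_indicator_iff)
    have Gint: "integrable M G"
      unfolding G_def by (intro Bochner_Integration.integrable_sum Gint1) simp
    have "(LINT t|M. G t) = (\<Sum>i<N. LINT t|M. indicator (D i) t *\<^sub>R \<phi> (F (h i)))"
      unfolding G_def by (rule Bochner_Integration.integral_sum) (simp add: Gint1)
    also have "\<dots> = (\<Sum>i<N. measure M (D i) *\<^sub>R \<phi> (F (h i)))"
    proof (rule sum.cong[OF refl])
      fix i assume "i \<in> {..<N}"
      then have "integrable M (indicator (D i) :: 't \<Rightarrow> real)"
        using Dfin Dmeas by (simp add: integrable_indicator_iff)
      then show "(LINT t|M. indicator (D i) t *\<^sub>R \<phi> (F (h i))) = measure M (D i) *\<^sub>R \<phi> (F (h i))"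
        using Dmeas by (simp add: radon_measure_space[OF M])
    qed
    also have "\<dots> = \<phi> Z"
      unfolding Z_def by (rule bounded_functional_on_sum[OF S \<phi>, symmetric]) (auto intro: FS)
    finally have GZ: "(LINT t|M. G t) = \<phi> Z" .
    have \<phi>F: "integrable M (\<lambda>t. \<phi> (F t))"
      by (rule integrable_bounded_functional_on[OF S \<phi> M F FS int])
    define w where "w t = b * (d * indicator K t + norm (F t) * indicator (- K) t)" for t
    have i1: "integrable M (indicator K :: 't \<Rightarrow> real)"
      using K Kfin by (simp add: integrable_indicator_iff)
    have i2: "integrable M (\<lambda>t. norm (F t) * indicator (- K) t)"
      using integrable_mult_indicator[OF K(3) int] by (simp add: mult.commute)
    have pointwise: "norm (G t - \<phi> (F t)) \<le> w t" for t
    proof (cases "t \<in> K")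
      case True
      then obtain i where i: "i < N" "t \<in> D i" using D(3) by auto
      have "indicator (D j) t = (if j = i then 1 else 0 :: real)" for j
        using i D(2) by (auto simp: indicator_def disjoint_family_on_def)
      then have "G t = (\<Sum>j<N. if j = i then \<phi> (F (h j)) else 0)"
        unfolding G_def by (intro sum.cong) auto
      also have "\<dots> = \<phi> (F (h i))" using i by simp
      finally have "norm (G t - \<phi> (F t)) \<le> b * norm (F (h i) - F t)"
        using bounded_functional_on_diff_le[OF S \<phi> FS FS] by simp
      also have "\<dots> \<le> b * d"
        using D(4) i b by (intro mult_left_mono) (auto intro: less_imp_le)
      finally show ?thesis using True by (simp add: w_def)
    next
      case False
      then have "indicator (D j) t = (0::real)" if "j < N" for j
        using that D(3) by (auto simp: indicator_def)
      then have "G t = 0" by (simp add: G_def)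
      then show ?thesis
        using False \<phi> FS by (simp add: w_def bounded_functional_on_def)
    qed
    have "\<phi> Z - (LINT t|M. \<phi> (F t)) = (LINT t|M. G t - \<phi> (F t))"
      using Gint \<phi>F by (simp add: GZ)
    also have "cmod \<dots> \<le> (LINT t|M. norm (G t - \<phi> (F t)))"
      by (rule integral_norm_bound)
    also have "\<dots> \<le> (LINT t|M. w t)"
      unfolding w_def[abs_def]
      by (intro integral_mono integrable_norm Bochner_Integration.integrable_diff Gint \<phi>F
          integrable_mult_right Bochner_Integration.integrable_add i1 i2)
        (use pointwise in \<open>simp add: w_def\<close>)
    also have "\<dots> = b * (d * m + (LINT t|M. norm (F t) * indicator (- K) t))"
      unfolding w_def m_def using i1 i2 K by (simp add: radon_measure_space[OF M])
    also have "\<dots> \<le> b * e"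
      using b dm tail by (intro mult_left_mono) (auto simp: K_def)
    finally show "cmod (\<phi> Z - (LINT t|M. \<phi> (F t))) \<le> b * e" .
  qed
qed

lemma cstar_algebra_subspace:
  assumes "cstar_algebra \<A>"
  shows "subspace \<A>"
proof (rule subspaceI)
  show "c *\<^sub>R X \<in> \<A>" if "X \<in> \<A>" for c X
    using assms that unfolding cstar_algebra_def op_scaleC_of_real[symmetric] by blast
qed (use assms in \<open>auto simp: cstar_algebra_def\<close>)

lemma dual_space_bounded_functional:
  assumes "\<phi> \<in> dual_space \<A>"
  obtains b where "bounded_functional_on \<A> \<phi> b"
proof -
  obtain b where b: "\<forall>X\<in>\<A>. cmod (\<phi> X) \<le> b * norm X"
    using assms by (auto simp: dual_space_def)
  have "cmod (\<phi> X) \<le> \<bar>b\<bar> * norm X" if "X \<in> \<A>" for X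
    using b that mult_right_mono[of b "\<bar>b\<bar>" "norm X"] by fastforce
  moreover have "\<phi> (r *\<^sub>R X) = r *\<^sub>R \<phi> X" if "X \<in> \<A>" for r X
    using assms that unfolding op_scaleC_of_real[symmetric]
    by (simp add: dual_space_def scaleR_conv_of_real)
  ultimately have "bounded_functional_on \<A> \<phi> \<bar>b\<bar>"
    using assms by (auto simp: bounded_functional_on_def dual_space_def)
  then show thesis by (rule that)
qed

lemma cmod_cinner_apply_le:
  fixes X :: "'h::chilbert_space \<Rightarrow>\<^sub>L 'h"
  shows "cmod (cinner (X x) y) \<le> (norm x * norm y) * norm X"
  using cinner_Cauchy_Schwarz[of "X x" y] mult_right_mono[OF norm_blinfun[of X x], of "norm y"]
  by (simp add: mult_ac)

lemma cinner_in_dual_space: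
  "(\<lambda>X :: 'h::chilbert_space \<Rightarrow>\<^sub>L 'h. cinner (X x) y) \<in> dual_space \<A>"
  using cmod_cinner_apply_le by (auto simp: dual_space_def blinfun.add_left cinner_simps)

lemma bounded_functional_cinner:
  "bounded_functional_on \<A> (\<lambda>X :: 'h::chilbert_space \<Rightarrow>\<^sub>L 'h. cinner (X x) y) (norm x * norm y)"
  using cmod_cinner_apply_le
  by (auto simp: bounded_functional_on_def blinfun.bilinear_simps cinner_simps)

text \<open>
  Riemann sums with errors \<open>1/(n+1)\<close> form a Cauchy sequence, because the functionals \<open>X \<mapsto> \<langle>X x, y\<rangle>\<close> determine the
  operator norm; the limit lies in the closed set \<open>\<A>\<close>. The same functionals separate operators, so the
  definite description denotes this limit.
\<close>

lemma field_integral: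
  fixes \<A> :: "('h::chilbert_space \<Rightarrow>\<^sub>L 'h) set" and M :: "'t::t2_space measure"
  assumes alg: "cstar_algebra \<A>" and M: "radon_measure M" and F: "continuous_field \<A> M F"
  shows "field_integral \<A> M F \<in> \<A>"
    and "\<And>\<phi>. \<phi> \<in> dual_space \<A> \<Longrightarrow> \<phi> (field_integral \<A> M F) = (LINT t|M. \<phi> (F t))"
proof -
  note S = cstar_algebra_subspace[OF alg]
  have FA: "\<And>t. F t \<in> \<A>" and cont: "continuous_on UNIV F" and int: "integrable M (\<lambda>t. norm (F t))"
    using F by (auto simp: continuous_field_def)
  let ?P = "\<lambda>Z. Z \<in> \<A> \<and> (\<forall>\<phi>\<in>dual_space \<A>. \<phi> Z = (LINT t|M. \<phi> (F t)))"
  have "\<exists>Z. Z \<in> \<A> \<and> (\<forall>\<phi> b. bounded_functional_on \<A> \<phi> b \<longrightarrow>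
      cmod (\<phi> Z - (LINT t|M. \<phi> (F t))) \<le> b * inverse (real (Suc n)))" for n
    by (rule approximate_integral[OF M S FA cont int, of "inverse (real (Suc n))"]) auto
  then obtain Z where Z: "\<And>n. Z n \<in> \<A>" "\<And>n \<phi> b. bounded_functional_on \<A> \<phi> b \<Longrightarrow>
      cmod (\<phi> (Z n) - (LINT t|M. \<phi> (F t))) \<le> b * inverse (real (Suc n))"
    by metis
  have dist: "norm (Z n - Z m) \<le> inverse (real (Suc n)) + inverse (real (Suc m))" for n m
  proof (rule norm_blinfun_bound)
    fix x
    define y where "y = (Z n - Z m) x"
    let ?I = "LINT t|M. cinner (F t x) y"
    have "cinner ((Z n - Z m) x) y = (cinner (Z n x) y - ?I) - (cinner (Z m x) y - ?I)"
      by (simp add: blinfun.diff_left cinner_simps)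
    then have "cmod (cinner ((Z n - Z m) x) y) \<le> cmod (cinner (Z n x) y - ?I) + cmod (cinner (Z m x) y - ?I)"
      by (simp only: norm_triangle_ineq4)
    also have "\<dots> \<le> norm x * norm y * inverse (real (Suc n)) + norm x * norm y * inverse (real (Suc m))"
      by (intro add_mono Z(2)[OF bounded_functional_cinner])
    finally have "norm y * norm y \<le> (inverse (real (Suc n)) + inverse (real (Suc m))) * norm x * norm y"
      by (simp add: y_def[symmetric] algebra_simps power2_eq_square)
    then show "norm ((Z n - Z m) x) \<le> (inverse (real (Suc n)) + inverse (real (Suc m))) * norm x"
      unfolding y_def[symmetric] by (cases "y = 0") (auto simp: mult_le_cancel_right)
  qed simp
  have "Cauchy Z"
  proof (rule CauchyI)
    fix e :: real assume "0 < e"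
    then obtain N where N: "inverse (real (Suc N)) < e / 2"
      using reals_Archimedean[of "e / 2"] by auto
    have le: "inverse (real (Suc n)) \<le> inverse (real (Suc N))" if "N \<le> n" for n
      using that by (simp add: field_simps)
    show "\<exists>N. \<forall>m\<ge>N. \<forall>n\<ge>N. norm (Z m - Z n) < e"
    proof (intro exI[of _ N] allI impI)
      fix m n assume mn: "N \<le> m" "N \<le> n"
      show "norm (Z m - Z n) < e"
        using dist[of m n] le[OF mn(1)] le[OF mn(2)] N by linarith
    qed
  qed
  then obtain Z0 where Z0: "Z \<longlonglongrightarrow> Z0"
    using Cauchy_convergent convergentD by blast
  have Z0A: "Z0 \<in> \<A>"
    using alg closed_sequentially[OF _ _ Z0] Z(1) by (simp add: cstar_algebra_def)
  have "\<phi> Z0 = (LINT t|M. \<phi> (F t))" if dual: "\<phi> \<in> dual_space \<A>" for \<phi>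
  proof -
    obtain b where b: "bounded_functional_on \<A> \<phi> b"
      using dual by (rule dual_space_bounded_functional)
    have "(\<lambda>n. \<phi> (Z n) - \<phi> Z0) \<longlonglongrightarrow> 0"
    proof (rule Lim_null_comparison)
      show "\<forall>\<^sub>F n in sequentially. norm (\<phi> (Z n) - \<phi> Z0) \<le> b * norm (Z n - Z0)"
        by (intro always_eventually allI bounded_functional_on_diff_le[OF S b] Z Z0A)
      have "(\<lambda>n. b * norm (Z n - Z0)) \<longlonglongrightarrow> b * norm (Z0 - Z0)"
        by (intro tendsto_intros Z0)
      then show "(\<lambda>n. b * norm (Z n - Z0)) \<longlonglongrightarrow> 0" by simp
    qed
    then have "(\<lambda>n. \<phi> (Z n)) \<longlonglongrightarrow> \<phi> Z0" by (simp add: LIM_zero_iff)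
    moreover have "(\<lambda>n. \<phi> (Z n)) \<longlonglongrightarrow> (LINT t|M. \<phi> (F t))"
    proof (rule LIM_zero_cancel, rule Lim_null_comparison)
      show "\<forall>\<^sub>F n in sequentially. norm (\<phi> (Z n) - (LINT t|M. \<phi> (F t))) \<le> b * inverse (real (Suc n))"
        by (intro always_eventually allI Z(2)[OF b])
      show "(\<lambda>n. b * inverse (real (Suc n))) \<longlonglongrightarrow> 0"
        by (rule tendsto_mult_right_zero[OF LIMSEQ_inverse_real_of_nat])
    qed
    ultimately show ?thesis by (rule LIMSEQ_unique)
  qed
  then have PZ0: "?P Z0" using Z0A by blast
  have uniq: "Y = Z0" if "?P Y" for Y
  proof (rule blinfun_eqI, rule cinner_ext)
    fix x y
    note dual = cinner_in_dual_space[of x y \<A>]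
    have "cinner (Y x) y = (LINT t|M. cinner (F t x) y)" using bspec[OF conjunct2[OF that] dual] .
    moreover have "cinner (Z0 x) y = (LINT t|M. cinner (F t x) y)" using bspec[OF conjunct2[OF PZ0] dual] .
    ultimately show "cinner (Y x) y = cinner (Z0 x) y" by simp
  qed
  have "?P (field_integral \<A> M F)"
    unfolding field_integral_def by (rule theI[of ?P, OF PZ0 uniq])
  then show "field_integral \<A> M F \<in> \<A>"
    and "\<And>\<phi>. \<phi> \<in> dual_space \<A> \<Longrightarrow> \<phi> (field_integral \<A> M F) = (LINT t|M. \<phi> (F t))"
    by blast+
qed

lemma cinner_field_integral:
  fixes \<A> :: "('h::chilbert_space \<Rightarrow>\<^sub>L 'h) set" and M :: "'t::t2_space measure"
  assumes alg: "cstar_algebra \<A>" and M: "radon_measure M" and F: "continuous_field \<A> M F"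
  shows "cinner (field_integral \<A> M F x) y = (LINT t|M. cinner (F t x) y)"
    and "integrable M (\<lambda>t. cinner (F t x) y)"
  using field_integral(2)[OF alg M F cinner_in_dual_space[of x y]]
    integrable_bounded_functional_on[OF cstar_algebra_subspace[OF alg] bounded_functional_cinner M]
    F by (auto simp: continuous_field_def)

lemma hermitian_field_integral:
  fixes \<A> :: "('h::chilbert_space \<Rightarrow>\<^sub>L 'h) set" and M :: "'t::t2_space measure"
  assumes alg: "cstar_algebra \<A>" and M: "radon_measure M" and F: "continuous_field \<A> M F"
    and herm: "\<And>t. hermitian (F t)"
  shows "hermitian (field_integral \<A> M F)"
proof -
  have "cinner (field_integral \<A> M F x) y = cinner x (field_integral \<A> M F y)" for x y
  proof -
    have "cinner x (field_integral \<A> M F y) = cnj (cinner (field_integral \<A> M F y) x)"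
      by (rule cinner_commute)
    also have "\<dots> = (LINT t|M. cnj (cinner (F t y) x))"
      by (simp add: cinner_field_integral[OF alg M F])
    also have "\<dots> = (LINT t|M. cinner (F t x) y)"
      by (simp add: hermitianD[OF herm] flip: cinner_commute)
    also have "\<dots> = cinner (field_integral \<A> M F x) y"
      by (simp add: cinner_field_integral[OF alg M F])
    finally show ?thesis ..
  qed
  then show ?thesis by (simp add: is_adjoint_def)
qed

section \<open>Strictly positive elements of an operator algebra\<close>

lemma cstar_algebra_closed_limit:
  assumes "cstar_algebra \<A>" "X \<longlonglongrightarrow> X0" "\<And>n. X n \<in> \<A>"
  shows "X0 \<in> \<A>"
  using assms closed_sequentially unfolding cstar_algebra_def by blast

text \<open>
  The factor \<open>X\<close> turns the constant term of \<open>p\<close>, a multiple of the identity, into an element of \<open>\<A>\<close>.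
\<close>

lemma cstar_algebra_op_rpoly:
  assumes alg: "cstar_algebra \<A>" and X: "X \<in> \<A>"
  shows "X o\<^sub>L op_rpoly p X \<in> \<A>"
proof (induction p)
  case 0
  show ?case using alg by (simp add: cstar_algebra_def)
next
  case (pCons a p)
  have "X o\<^sub>L op_rpoly (pCons a p) X = a *\<^sub>R X + (X o\<^sub>L (X o\<^sub>L op_rpoly p X))"
    by (rule blinfun_eqI) (simp add: blinfun.bilinear_simps)
  moreover have "a *\<^sub>R X \<in> \<A>"
    by (rule subspace_scale[OF cstar_algebra_subspace[OF alg] X])
  ultimately show ?case
    using alg X pCons by (simp add: cstar_algebra_def)
qed

text \<open>
  As the spectrum of \<open>X\<close> stays away from 0, \<open>g(t) = f(t)/t\<close> is continuous on it and \<open>f(X) = X g(X)\<close> is a limit of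
  polynomials in \<open>X\<close> without constant term. For \<open>f = 1\<close> this shows that \<open>\<A>\<close> contains the identity.
\<close>

lemma cstar_algebra_op_fun:
  assumes alg: "cstar_algebra \<A>" and X: "X \<in> \<A>" and pos: "strictly_positive X"
    and f: "continuous_on {0<..} f"
  shows "op_fun f X \<in> \<A>"
proof -
  obtain a b where ab: "0 < a" "a \<le> b" "hermitian_between a b X"
    using pos by (rule strictly_positiveE)
  define g where "g = (\<lambda>t. f t / t)"
  have g: "continuous_on {a..b} g"
    unfolding g_def using ab
    by (intro continuous_on_divide continuous_on_subset[OF f] continuous_on_id) auto
  obtain p where p: "uniform_limit {a..b} (\<lambda>n. poly (p n)) g sequentially"
    using uniform_polynomial_approximation[OF g] .
  have "(\<lambda>n. X o\<^sub>L op_rpoly (p n) X) \<longlonglongrightarrow> (X o\<^sub>L op_fun g X)"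
    by (intro bounded_bilinear.tendsto[OF bounded_bilinear_blinfun_compose] tendsto_const
        op_fun_limit[OF ab(3) g p])
  then have "X o\<^sub>L op_fun g X \<in> \<A>"
    by (rule cstar_algebra_closed_limit[OF alg]) (rule cstar_algebra_op_rpoly[OF alg X])
  also have "X o\<^sub>L op_fun g X = op_fun (\<lambda>t. t * g t) X"
    using op_fun_mult[OF ab(3) continuous_on_id g] by (simp add: op_fun_ident[OF ab(3)])
  also have "\<dots> = op_fun f X"
    using ab(1) by (intro op_fun_cong[OF ab(3)] continuous_on_mult continuous_on_id g) (auto simp: g_def)
  finally show ?thesis .
qed

lemma cstar_algebra_op_powr:
  assumes "cstar_algebra \<A>" "X \<in> \<A>" "strictly_positive X"
  shows "op_powr X r \<in> \<A>"
  unfolding op_powr_def using assms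
  by (intro cstar_algebra_op_fun continuous_on_powr continuous_on_id continuous_on_const) auto

lemma cstar_algebra_compose: "cstar_algebra \<A> \<Longrightarrow> X \<in> \<A> \<Longrightarrow> Y \<in> \<A> \<Longrightarrow> X o\<^sub>L Y \<in> \<A>"
  by (simp add: cstar_algebra_def)

lemma cstar_algebra_rel_entropy0:
  assumes "cstar_algebra \<A>" "A \<in> \<A>" "C \<in> \<A>" "strictly_positive A" "strictly_positive C"
    and "continuous_on {0<..} f"
  shows "rel_entropy0 f A C \<in> \<A>"
  unfolding rel_entropy0_def
  by (intro cstar_algebra_compose cstar_algebra_op_powr cstar_algebra_op_fun
      strictly_positive_entropy_argument assms)

lemma continuous_field_add:
  assumes alg: "cstar_algebra \<A>" and M: "radon_measure M"
    and A: "continuous_field \<A> M A" and B: "continuous_field \<A> M B"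
  shows "continuous_field \<A> M (\<lambda>s. A s + B s)"
  unfolding continuous_field_def
proof (intro conjI allI)
  show "A s + B s \<in> \<A>" for s
    using alg A B by (simp add: cstar_algebra_def continuous_field_def)
  show cont: "continuous_on UNIV (\<lambda>s. A s + B s)"
    using A B by (intro continuous_on_add) (simp_all add: continuous_field_def)
  show "integrable M (\<lambda>s. norm (A s + B s))"
  proof (rule Bochner_Integration.integrable_bound)
    show "integrable M (\<lambda>s. norm (A s) + norm (B s))"
      using A B by (simp add: continuous_field_def)
    show "(\<lambda>s. norm (A s + B s)) \<in> borel_measurable M"
      by (rule radon_measure_continuous_measurable[OF M continuous_on_norm[OF cont]])
    show "AE s in M. norm (norm (A s + B s)) \<le> norm (norm (A s) + norm (B s))"
      by (simp add: norm_triangle_ineq)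
  qed
qed

lemma continuous_field_rel_entropy0:
  fixes \<A> :: "('h::chilbert_space \<Rightarrow>\<^sub>L 'h) set" and M :: "'t::t2_space measure"
  assumes alg: "cstar_algebra \<A>" and M: "radon_measure M"
    and f: "operator_monotone TYPE('h \<Rightarrow> complex) {0<..} f" and nonneg: "\<And>t. 0 < t \<Longrightarrow> 0 \<le> f t"
    and A: "continuous_field \<A> M A" "\<And>s. strictly_positive (A s)"
    and C: "continuous_field \<A> M C" "\<And>s. strictly_positive (C s)"
  shows "continuous_field \<A> M (\<lambda>s. rel_entropy0 f (A s) (C s))"
  unfolding continuous_field_def
proof (intro conjI allI)
  have fc: "continuous_on {0<..} f"
    using f by (simp add: operator_monotone_def)
  show "rel_entropy0 f (A s) (C s) \<in> \<A>" for s
    using A C by (intro cstar_algebra_rel_entropy0 alg fc) (simp_all add: continuous_field_def)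
  have "(A \<longlongrightarrow> A s) (at s)" "(C \<longlongrightarrow> C s) (at s)" for s
    using A(1) C(1) by (auto simp: continuous_field_def continuous_on_def)
  then show cont: "continuous_on UNIV (\<lambda>s. rel_entropy0 f (A s) (C s))"
    unfolding continuous_on_def using A(2) C(2)
    by (auto intro!: tendsto_rel_entropy0 fc)
  show "integrable M (\<lambda>s. norm (rel_entropy0 f (A s) (C s)))"
  proof (rule Bochner_Integration.integrable_bound)
    show "integrable M (\<lambda>s. f 1 * (norm (A s) + norm (C s)))"
      using A(1) C(1) by (simp add: continuous_field_def)
    show "(\<lambda>s. norm (rel_entropy0 f (A s) (C s))) \<in> borel_measurable M"
      by (rule radon_measure_continuous_measurable[OF M continuous_on_norm[OF cont]])
    have "norm (norm (rel_entropy0 f (A s) (C s))) \<le> norm (f 1 * (norm (A s) + norm (C s)))" for s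
      using norm_rel_entropy0_le[OF f nonneg A(2) C(2), of s s] by simp
    then show "AE s in M. norm (norm (rel_entropy0 f (A s) (C s))) \<le> norm (f 1 * (norm (A s) + norm (C s)))"
      by simp
  qed
qed

theorem theorem2p8:
  fixes f :: "real \<Rightarrow> real"
    and \<A> :: "('h::chilbert_space \<Rightarrow>\<^sub>L 'h) set"
    and \<mu> :: "'t::t2_space measure"
    and A B C D :: "'t \<Rightarrow> 'h \<Rightarrow>\<^sub>L 'h"
  assumes "cstar_algebra \<A>"
    and "locally_compact_space (euclidean :: 't topology)"
    and "radon_measure \<mu>"
    and "operator_monotone TYPE('h \<Rightarrow> complex) {0<..} f"
    and "\<And>t. t > 0 \<Longrightarrow> f t \<ge> 0"
    and "continuous_field \<A> \<mu> A" "\<And>s. strictly_positive (A s)"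
    and "continuous_field \<A> \<mu> B" "\<And>s. strictly_positive (B s)"
    and "continuous_field \<A> \<mu> C" "\<And>s. strictly_positive (C s)"
    and "continuous_field \<A> \<mu> D" "\<And>s. strictly_positive (D s)"
  shows "gen_rel_entropy0 \<A> \<mu> f A C + gen_rel_entropy0 \<A> \<mu> f B D
           \<preceq> gen_rel_entropy0 \<A> \<mu> f (\<lambda>s. A s + B s) (\<lambda>s. C s + D s)"
proof -
  note alg = assms(1) and M = assms(3) and f = assms(4) and nonneg = assms(5)
    and A = assms(6,7) and B = assms(8,9) and C = assms(10,11) and D = assms(12,13)
  note AB = continuous_field_add[OF alg M A(1) B(1)] strictly_positive_add[OF A(2) B(2)]
  note CD = continuous_field_add[OF alg M C(1) D(1)] strictly_positive_add[OF C(2) D(2)]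
  have fc: "continuous_on {0<..} f"
    using f by (simp add: operator_monotone_def)
  let ?F = "\<lambda>s. rel_entropy0 f (A s) (C s)" and ?G = "\<lambda>s. rel_entropy0 f (B s) (D s)"
    and ?H = "\<lambda>s. rel_entropy0 f (A s + B s) (C s + D s)"
  have F: "continuous_field \<A> \<mu> ?F"
    by (rule continuous_field_rel_entropy0[OF alg M f nonneg A C])
  have G: "continuous_field \<A> \<mu> ?G"
    by (rule continuous_field_rel_entropy0[OF alg M f nonneg B D])
  have H: "continuous_field \<A> \<mu> ?H"
    by (rule continuous_field_rel_entropy0[OF alg M f nonneg AB CD])
  have herm: "hermitian (field_integral \<A> \<mu> ?F)" "hermitian (field_integral \<A> \<mu> ?G)"
      "hermitian (field_integral \<A> \<mu> ?H)"
    by (intro hermitian_field_integral[OF alg M] F G H hermitian_rel_entropy0 fc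
        A(2) B(2) C(2) D(2) AB(2) CD(2))+
  note integral = cinner_field_integral[OF alg M]
  have "Re (cinner (field_integral \<A> \<mu> ?F x) x) + Re (cinner (field_integral \<A> \<mu> ?G x) x)
      \<le> Re (cinner (field_integral \<A> \<mu> ?H x) x)" for x
  proof -
    have "Re (cinner (field_integral \<A> \<mu> ?F x) x) + Re (cinner (field_integral \<A> \<mu> ?G x) x) =
        (LINT s|\<mu>. Re (cinner (?F s x) x) + Re (cinner (?G s x) x))"
      using integral(2)[OF F, of x x] integral(2)[OF G, of x x]
      by (simp add: integral(1)[OF F] integral(1)[OF G])
    also have "\<dots> \<le> (LINT s|\<mu>. Re (cinner (?H s x) x))"
      using integral(2)[OF F, of x x] integral(2)[OF G, of x x] integral(2)[OF H, of x x]
      by (intro integral_mono rel_entropy0_superadditive f A(2) B(2) C(2) D(2)) simp_all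
    also have "\<dots> = Re (cinner (field_integral \<A> \<mu> ?H x) x)"
      using integral(2)[OF H, of x x] by (simp add: integral(1)[OF H])
    finally show ?thesis .
  qed
  with herm show ?thesis
    unfolding gen_rel_entropy0_def op_le_iff
    by (simp add: is_adjoint_def blinfun.add_left cinner_simps)
qed

end
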